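(* Let $p$ be a prime, let $G=\mathbb{Z}/p$, and let $X$ be a $G$-CW-complex. Then there is a long exact sequence $$\cdots\to H_n(X/G;\mathbb{Z})\to H_n(G,X;\mathbb{Z})\to H_n(X^G;\mathbb{Z}/p)\to H_{n-1}(X/G;\mathbb{Z})\to\cdots.$$
   Context: A $G$-CW-complex ($G$ a finite group) is a CW-complex $X$ with a cellular $G$-action such that if $g\in G$ fixes a cell $\sigma$ (i.e. $g\sigma=\sigma$), then $g$ fixes $\sigma$ pointwise. Then the fixed point set $X^G$ is a subcomplex and $X/G$ is a CW-complex. For an abelian group $A$, $C_\bullet(X;A)$ denotes the cellular chain complex of $X$ with coefficients in $A$, with the induced $G$-action $g(\sigma\otimes a)=(g\sigma)\otimes a$, and $C_\bullet(X;A)^G$ is the subcomplex of $G$-invariant chains. Define $H_i(G,X;A)$ to be the $i$-th homology group of the chain complex $C_\bullet(X;A)^G$. *)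

theory Defs
  imports "HOL-Homology.Homology" "HOL-Algebra.Group_Action"
    "HOL-Computational_Algebra.Primes"
begin

section \<open>CW-complexes\<close>

definition closed_disc :: "nat \<Rightarrow> (nat \<Rightarrow> real) topology" where
  "closed_disc n = subtopology (Euclidean_space n) {x. (\<Sum>i<n. (x i)\<^sup>2) \<le> 1}"

definition open_disc_set :: "nat \<Rightarrow> (nat \<Rightarrow> real) set" where
  "open_disc_set n = {x \<in> topspace (Euclidean_space n). (\<Sum>i<n. (x i)\<^sup>2) < 1}"

definition boundary_sphere_set :: "nat \<Rightarrow> (nat \<Rightarrow> real) set" where
  "boundary_sphere_set n = {x \<in> topspace (Euclidean_space n). (\<Sum>i<n. (x i)\<^sup>2) = 1}"

text \<open>A cell structure is a family \<open>E\<close>, where \<open>E n\<close> is the set of open \<open>n\<close>-cells.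
  The finiteness of the family \<open>F\<close> below is the closure-finiteness condition.\<close>

definition characteristic_map ::
    "'a topology \<Rightarrow> (nat \<Rightarrow> 'a set set) \<Rightarrow> nat \<Rightarrow> 'a set \<Rightarrow> ((nat \<Rightarrow> real) \<Rightarrow> 'a) \<Rightarrow> bool" where
  "characteristic_map X E n e \<Phi> \<longleftrightarrow>
     continuous_map (closed_disc n) X \<Phi> \<and>
     homeomorphic_map (subtopology (Euclidean_space n) (open_disc_set n)) (subtopology X e) \<Phi> \<and>
     (\<exists>F. finite F \<and> F \<subseteq> (\<Union>k<n. E k) \<and> \<Phi> ` boundary_sphere_set n \<subseteq> \<Union>F)"

definition cw_complex :: "'a topology \<Rightarrow> (nat \<Rightarrow> 'a set set) \<Rightarrow> bool" where
  "cw_complex X E \<longleftrightarrow>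
     Hausdorff_space X \<and>
     (\<Union>n. \<Union>(E n)) = topspace X \<and>
     (\<forall>m n. \<forall>e\<in>E m. \<forall>f\<in>E n. (m, e) \<noteq> (n, f) \<longrightarrow> e \<inter> f = {}) \<and>
     (\<forall>n. \<forall>e\<in>E n. \<exists>\<Phi>. characteristic_map X E n e \<Phi>) \<and>
     (\<forall>A. A \<subseteq> topspace X \<longrightarrow>
        (closedin X A \<longleftrightarrow> (\<forall>n. \<forall>e\<in>E n. closedin X (A \<inter> X closure_of e))))"

definition skeleton :: "(nat \<Rightarrow> 'a set set) \<Rightarrow> int \<Rightarrow> 'a set" where
  "skeleton E n = (\<Union>k \<in> {k. int k \<le> n}. \<Union>(E k))"


section \<open>\<open>G\<close>-CW-complexes, orbit space and fixed points\<close>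

text \<open>The action is by homeomorphisms that permute the open cells, preserving dimension.\<close>

definition G_CW_complex ::
    "'g monoid \<Rightarrow> ('g \<Rightarrow> 'a \<Rightarrow> 'a) \<Rightarrow> 'a topology \<Rightarrow> (nat \<Rightarrow> 'a set set) \<Rightarrow> bool" where
  "G_CW_complex G \<phi> X E \<longleftrightarrow>
     finite (carrier G) \<and>
     cw_complex X E \<and>
     group_action G (topspace X) \<phi> \<and>
     (\<forall>g\<in>carrier G. continuous_map X X (\<phi> g)) \<and>
     (\<forall>g\<in>carrier G. \<forall>n. \<forall>e\<in>E n. \<phi> g ` e \<in> E n) \<and>
     (\<forall>g\<in>carrier G. \<forall>n. \<forall>e\<in>E n. \<phi> g ` e = e \<longrightarrow> (\<forall>x\<in>e. \<phi> g x = x))"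

definition orbit_space :: "'g monoid \<Rightarrow> ('g \<Rightarrow> 'a \<Rightarrow> 'a) \<Rightarrow> 'a topology \<Rightarrow> 'a set topology" where
  "orbit_space G \<phi> X =
     topology (\<lambda>U. U \<subseteq> orbits G (topspace X) \<phi> \<and> openin X {x \<in> topspace X. orbit G \<phi> x \<in> U})"

definition orbit_cells ::
    "'g monoid \<Rightarrow> ('g \<Rightarrow> 'a \<Rightarrow> 'a) \<Rightarrow> (nat \<Rightarrow> 'a set set) \<Rightarrow> nat \<Rightarrow> 'a set set set" where
  "orbit_cells G \<phi> E n = (\<lambda>e. orbit G \<phi> ` e) ` E n"

definition fixed_points :: "'g monoid \<Rightarrow> ('g \<Rightarrow> 'a \<Rightarrow> 'a) \<Rightarrow> 'a topology \<Rightarrow> 'a set" where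
  "fixed_points G \<phi> X = {x \<in> topspace X. \<forall>g\<in>carrier G. \<phi> g x = x}"

definition fixed_space :: "'g monoid \<Rightarrow> ('g \<Rightarrow> 'a \<Rightarrow> 'a) \<Rightarrow> 'a topology \<Rightarrow> 'a topology" where
  "fixed_space G \<phi> X = subtopology X (fixed_points G \<phi> X)"

definition fixed_cells ::
    "'g monoid \<Rightarrow> ('g \<Rightarrow> 'a \<Rightarrow> 'a) \<Rightarrow> 'a topology \<Rightarrow> (nat \<Rightarrow> 'a set set) \<Rightarrow> nat \<Rightarrow> 'a set set" where
  "fixed_cells G \<phi> X E n = {e \<in> E n. e \<subseteq> fixed_points G \<phi> X}"


section \<open>Tensor products of abelian groups\<close>

definition tensor_relations ::
    "'m monoid \<Rightarrow> 'b monoid \<Rightarrow> ('m \<times> 'b \<Rightarrow>\<^sub>0 int) set" where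
  "tensor_relations M A =
     {frag_of (x \<otimes>\<^bsub>M\<^esub> y, a) - frag_of (x, a) - frag_of (y, a) | x y a.
        x \<in> carrier M \<and> y \<in> carrier M \<and> a \<in> carrier A} \<union>
     {frag_of (x, a \<otimes>\<^bsub>A\<^esub> b) - frag_of (x, a) - frag_of (x, b) | x a b.
        x \<in> carrier M \<and> a \<in> carrier A \<and> b \<in> carrier A}"

definition tensor_kernel ::
    "'m monoid \<Rightarrow> 'b monoid \<Rightarrow> ('m \<times> 'b \<Rightarrow>\<^sub>0 int) set" where
  "tensor_kernel M A =
     generate (free_Abelian_group (carrier M \<times> carrier A)) (tensor_relations M A)"

definition tensor_product ::
    "'m monoid \<Rightarrow> 'b monoid \<Rightarrow> ('m \<times> 'b \<Rightarrow>\<^sub>0 int) set monoid" where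
  "tensor_product M A =
     free_Abelian_group (carrier M \<times> carrier A) Mod tensor_kernel M A"

text \<open>The homomorphism \<open>f \<otimes> id\<^sub>A\<close> into \<open>N \<otimes> A\<close>. For a homomorphism \<open>f\<close>, all
  representatives \<open>z\<close> of the class \<open>c\<close> give the same coset, so the union is that coset.\<close>

definition tensor_map ::
    "'n monoid \<Rightarrow> 'b monoid \<Rightarrow> ('m \<Rightarrow> 'n) \<Rightarrow> ('m \<times> 'b \<Rightarrow>\<^sub>0 int) set \<Rightarrow> ('n \<times> 'b \<Rightarrow>\<^sub>0 int) set" where
  "tensor_map N A f c =
     (\<Union>z\<in>c. tensor_kernel N A #>\<^bsub>free_Abelian_group (carrier N \<times> carrier A)\<^esub>
               frag_extend (\<lambda>(x, a). frag_of (f x, a)) z)"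


section \<open>Cellular chains and homology\<close>

text \<open>The integral cellular chain group \<open>C\<^sub>n(X) = H\<^sub>n(X\<^sub>n, X\<^sub>n\<^sub>-\<^sub>1)\<close>, whose boundary map is that of the
  triple \<open>(X\<^sub>n, X\<^sub>n\<^sub>-\<^sub>1, X\<^sub>n\<^sub>-\<^sub>2)\<close>.\<close>

definition cell_chain ::
    "'a topology \<Rightarrow> (nat \<Rightarrow> 'a set set) \<Rightarrow> int \<Rightarrow> 'a chain set monoid" where
  "cell_chain X E n =
     relative_homology_group n (subtopology X (skeleton E n)) (skeleton E (n - 1))"

definition cell_boundary ::
    "'a topology \<Rightarrow> (nat \<Rightarrow> 'a set set) \<Rightarrow> int \<Rightarrow> 'a chain set \<Rightarrow> 'a chain set" where
  "cell_boundary X E n =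
     hom_relboundary n (subtopology X (skeleton E n)) (skeleton E (n - 1)) (skeleton E (n - 2))"

definition cell_induced ::
    "'a topology \<Rightarrow> (nat \<Rightarrow> 'a set set) \<Rightarrow> int \<Rightarrow> ('a \<Rightarrow> 'a) \<Rightarrow> 'a chain set \<Rightarrow> 'a chain set" where
  "cell_induced X E n f =
     hom_induced n (subtopology X (skeleton E n)) (skeleton E (n - 1))
                   (subtopology X (skeleton E n)) (skeleton E (n - 1)) f"

type_synonym ('a, 'b) cell_coeff_chain = "('a chain set \<times> 'b \<Rightarrow>\<^sub>0 int) set"

definition cell_chain_coeff ::
    "'a topology \<Rightarrow> (nat \<Rightarrow> 'a set set) \<Rightarrow> 'b monoid \<Rightarrow> int \<Rightarrow> ('a, 'b) cell_coeff_chain monoid" where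
  "cell_chain_coeff X E A n = tensor_product (cell_chain X E n) A"

definition cell_boundary_coeff ::
    "'a topology \<Rightarrow> (nat \<Rightarrow> 'a set set) \<Rightarrow> 'b monoid \<Rightarrow> int
      \<Rightarrow> ('a, 'b) cell_coeff_chain \<Rightarrow> ('a, 'b) cell_coeff_chain" where
  "cell_boundary_coeff X E A n = tensor_map (cell_chain X E (n - 1)) A (cell_boundary X E n)"

definition cell_action_coeff ::
    "('g \<Rightarrow> 'a \<Rightarrow> 'a) \<Rightarrow> 'a topology \<Rightarrow> (nat \<Rightarrow> 'a set set) \<Rightarrow> 'b monoid \<Rightarrow> int
      \<Rightarrow> 'g \<Rightarrow> ('a, 'b) cell_coeff_chain \<Rightarrow> ('a, 'b) cell_coeff_chain" where
  "cell_action_coeff \<phi> X E A n g = tensor_map (cell_chain X E n) A (cell_induced X E n (\<phi> g))"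

definition invariant_cell_chain ::
    "'g monoid \<Rightarrow> ('g \<Rightarrow> 'a \<Rightarrow> 'a) \<Rightarrow> 'a topology \<Rightarrow> (nat \<Rightarrow> 'a set set) \<Rightarrow> 'b monoid \<Rightarrow> int
      \<Rightarrow> ('a, 'b) cell_coeff_chain monoid" where
  "invariant_cell_chain G \<phi> X E A n =
     (cell_chain_coeff X E A n)
       \<lparr>carrier := {c \<in> carrier (cell_chain_coeff X E A n).
                     \<forall>g\<in>carrier G. cell_action_coeff \<phi> X E A n g c = c}\<rparr>"

definition complex_homology :: "(int \<Rightarrow> 'c monoid) \<Rightarrow> (int \<Rightarrow> 'c \<Rightarrow> 'c) \<Rightarrow> int \<Rightarrow> 'c set monoid" where
  "complex_homology C d n =
     (C n)\<lparr>carrier := kernel (C n) (C (n - 1)) (d n)\<rparr> Mod (d (n + 1) ` carrier (C (n + 1)))"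

text \<open>\<open>H\<^sub>n(X; A)\<close> of a CW-complex, and \<open>H\<^sub>n(G, X; A)\<close> of a \<open>G\<close>-CW-complex.\<close>

definition cw_homology ::
    "'a topology \<Rightarrow> (nat \<Rightarrow> 'a set set) \<Rightarrow> 'b monoid \<Rightarrow> int
      \<Rightarrow> ('a, 'b) cell_coeff_chain set monoid" where
  "cw_homology X E A = complex_homology (cell_chain_coeff X E A) (cell_boundary_coeff X E A)"

definition invariant_homology ::
    "'g monoid \<Rightarrow> ('g \<Rightarrow> 'a \<Rightarrow> 'a) \<Rightarrow> 'a topology \<Rightarrow> (nat \<Rightarrow> 'a set set) \<Rightarrow> 'b monoid \<Rightarrow> int
      \<Rightarrow> ('a, 'b) cell_coeff_chain set monoid" where
  "invariant_homology G \<phi> X E A =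
     complex_homology (invariant_cell_chain G \<phi> X E A) (cell_boundary_coeff X E A)"

definition exact_at ::
    "'a monoid \<Rightarrow> 'b monoid \<Rightarrow> 'c monoid \<Rightarrow> ('a \<Rightarrow> 'b) \<Rightarrow> ('b \<Rightarrow> 'c) \<Rightarrow> bool" where
  "exact_at A B C f g \<longleftrightarrow>
     group_hom A B f \<and> group_hom B C g \<and> f ` carrier A = kernel B C g"

end

theory Submission
  imports Defs "HOL-Analysis.Abstract_Topological_Spaces"
begin

text \<open>Characteristic maps can be chosen \<open>G\<close>-equivariantly, so the cells of \<open>X\<close>, \<open>X/G\<close> and \<open>X\<^sup>G\<close>
  give compatible bases of the cellular chain groups, and \<open>G\<close> permutes the basis of \<open>C(X)\<close>. Since \<open>p\<close> is
  prime, every cell is either fixed or has a free orbit. The norm \<open>N = \<Sum>g\<close> factors through an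
  injective chain map \<open>C(X/G) \<rightarrow> C(X)\<^sup>G\<close>. An invariant chain is a chain on fixed cells plus a norm, and
  the norms supported on fixed cells are exactly the multiples of \<open>p\<close>; hence the cokernel is
  \<open>C(X\<^sup>G) \<otimes> \<int>/p\<close>, and the sequence is the long exact homology sequence of
  \<open>0 \<rightarrow> C(X/G) \<rightarrow> C(X)\<^sup>G \<rightarrow> C(X\<^sup>G) \<otimes> \<int>/p \<rightarrow> 0\<close>.

  The basis of \<open>H\<^sub>n(X\<^sub>n, X\<^sub>n\<^sub>-\<^sub>1)\<close> needs only that \<open>X\<^sub>n\<close> carries the weak topology with respect to \<open>X\<^sub>n\<^sub>-\<^sub>1\<close> and
  the characteristic maps; \<open>X/G\<close> inherits this directly from \<open>X\<close>, so it need not be shown to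
  be a CW-complex.\<close>

section \<open>The closed disc\<close>

text \<open>Cellular chains are defined by singular homology of pairs of skeleta, so their bases
  have to be computed. For one cell this is excision along a collar. Many cells need no wedge or
  disjoint sum: singular chains have compact support, so generation is an induction over finitely
  many cells, and independence is read off one cell at a time, in homology modulo the complement of
  that cell. A single generator of the homology of the disc modulo its sphere serves all cells of
  all three spaces. As an element that preserves a cell fixes it pointwise, action, projection and
  inclusion then send basis elements to basis elements without signs or degrees. Coefficients enter
  only through the map from \<open>x\<close> to \<open>x \<otimes> 1\<close>, which is onto and has
  the multiples of \<open>m\<close> as kernel; all other algebra takes place in integral chains. The
  map onto the cokernel sends a chain \<open>x\<close> on fixed cells plus a norm to
  \<open>x\<close> modulo \<open>p\<close>. It is well defined because a chain on fixed cells that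
  is also a norm is divisible by \<open>p\<close>.\<close>

lemma Euclidean_space_eq_top_of_set: "Euclidean_space n = top_of_set {x. \<forall>i\<ge>n. x i = 0}"
  by (simp add: Euclidean_space_def euclidean_product_topology)

text \<open>Puts the disc into the type class topology of \<open>nat \<Rightarrow> real\<close>, so
  that continuity can be proved with \<open>continuous_on\<close> and compactness in the product
  topology.\<close>

lemma closed_disc_eq_top_of_set:
  "closed_disc n = top_of_set {x. (\<forall>i\<ge>n. x i = 0) \<and> (\<Sum>i<n. (x i)\<^sup>2) \<le> 1}"
  by (simp add: closed_disc_def Euclidean_space_eq_top_of_set subtopology_subtopology Collect_conj_eq)

lemma topspace_closed_disc:
  "topspace (closed_disc n) = {x. (\<forall>i\<ge>n. x i = 0) \<and> (\<Sum>i<n. (x i)\<^sup>2) \<le> 1}"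
  by (simp add: closed_disc_eq_top_of_set)

lemma open_disc_set_eq: "open_disc_set n = {x. (\<forall>i\<ge>n. x i = 0) \<and> (\<Sum>i<n. (x i)\<^sup>2) < 1}"
  by (auto simp: open_disc_set_def topspace_Euclidean_space)

lemma boundary_sphere_set_eq:
  "boundary_sphere_set n = {x. (\<forall>i\<ge>n. x i = 0) \<and> (\<Sum>i<n. (x i)\<^sup>2) = 1}"
  by (auto simp: boundary_sphere_set_def topspace_Euclidean_space)

lemma open_disc_Un_boundary: "topspace (closed_disc n) = open_disc_set n \<union> boundary_sphere_set n"
  by (auto simp: topspace_closed_disc open_disc_set_eq boundary_sphere_set_eq)

lemma open_disc_Int_boundary: "open_disc_set n \<inter> boundary_sphere_set n = {}"
  by (auto simp: open_disc_set_eq boundary_sphere_set_eq)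

lemma continuous_on_disc_norm: "continuous_on S (\<lambda>x::nat\<Rightarrow>real. \<Sum>i<n. (x i)\<^sup>2)"
  by (intro continuous_intros continuous_on_subset[OF continuous_on_product_coordinates]) auto

lemma openin_disc_norm_greater: "openin (closed_disc n) {x \<in> topspace (closed_disc n). a < (\<Sum>i<n. (x i)\<^sup>2)}"
  using openin_continuous_map_preimage[of "closed_disc n" euclideanreal "\<lambda>x. \<Sum>i<n. (x i)\<^sup>2" "{a<..}"]
  by (simp add: closed_disc_eq_top_of_set continuous_on_disc_norm)

lemma openin_disc_norm_less: "openin (closed_disc n) {x \<in> topspace (closed_disc n). (\<Sum>i<n. (x i)\<^sup>2) < a}"
  using openin_continuous_map_preimage[of "closed_disc n" euclideanreal "\<lambda>x. \<Sum>i<n. (x i)\<^sup>2" "{..<a}"]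
  by (simp add: closed_disc_eq_top_of_set continuous_on_disc_norm)

lemma openin_open_disc: "openin (closed_disc n) (open_disc_set n)"
proof -
  have eq: "open_disc_set n = {x \<in> topspace (closed_disc n). (\<Sum>i<n. (x i)\<^sup>2) < 1}"
    by (auto simp: topspace_closed_disc open_disc_set_eq)
  show ?thesis unfolding eq by (rule openin_disc_norm_less)
qed

lemma closedin_boundary_sphere: "closedin (closed_disc n) (boundary_sphere_set n)"
proof -
  have "boundary_sphere_set n = topspace (closed_disc n) - open_disc_set n"
    using open_disc_Un_boundary open_disc_Int_boundary by blast
  then show ?thesis using openin_open_disc[of n] by (metis closedin_diff closedin_topspace)
qed

lemma disc_coordinate_bound:
  assumes "x \<in> topspace (closed_disc n)" shows "\<bar>x i\<bar> \<le> 1"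
proof (cases "i < n")
  case True
  then have "(x i)\<^sup>2 \<le> (\<Sum>i<n. (x i)\<^sup>2)"
    by (intro member_le_sum) auto
  then show ?thesis using assms using abs_square_le_1[of "x i"] by (simp add: topspace_closed_disc)
qed (use assms in \<open>auto simp: topspace_closed_disc\<close>)

text \<open>The disc is a closed subset of the product of intervals \<open>{-1..1}\<close> over all
  coordinates, which is compact by Tychonoff's theorem.\<close>

lemma compact_space_closed_disc: "compact_space (closed_disc n)"
proof -
  let ?D = "topspace (closed_disc n)"
  have "compactin (product_topology (\<lambda>i. euclideanreal) UNIV) (\<Pi>\<^sub>E i\<in>UNIV. {-1..1})"
    by (subst compactin_PiE) auto
  moreover have "closedin (product_topology (\<lambda>i. euclideanreal) UNIV) ?D"
  proof -
    have "?D = (\<Inter>i\<in>{n..}. {x. x i = 0}) \<inter> {x. (\<Sum>i<n. (x i)\<^sup>2) \<le> 1}"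
      by (auto simp: topspace_closed_disc)
    moreover have "closed \<dots>"
      by (intro closed_Int closed_INT ballI closed_Collect_eq closed_Collect_le continuous_on_disc_norm
          continuous_intros continuous_on_product_coordinates)
    ultimately show ?thesis by (simp add: euclidean_product_topology)
  qed
  moreover have "?D \<subseteq> (\<Pi>\<^sub>E i\<in>UNIV. {-1..1})"
    using disc_coordinate_bound by (fastforce simp: abs_le_iff)
  ultimately have "compactin (product_topology (\<lambda>i. euclideanreal) UNIV) ?D"
    using closed_compactin by blast
  then have "compactin euclidean {x::nat\<Rightarrow>real. (\<forall>i\<ge>n. x i = 0) \<and> (\<Sum>i<n. (x i)\<^sup>2) \<le> 1}"
    unfolding topspace_closed_disc euclidean_product_topology .
  then show ?thesis
    unfolding closed_disc_eq_top_of_set by (rule compact_space_subtopology)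
qed

lemma Hausdorff_space_closed_disc: "Hausdorff_space (closed_disc n)"
  unfolding closed_disc_eq_top_of_set by (simp add: Hausdorff_space_subtopology)

section \<open>Radial push of a collar onto the boundary sphere\<close>

definition disc_push :: "nat \<Rightarrow> real \<Rightarrow> (nat \<Rightarrow> real) \<Rightarrow> nat \<Rightarrow> real" where
  "disc_push n t x = (\<lambda>i. x i * ((1 + t) / max 1 ((1 + t) * sqrt (\<Sum>i<n. (x i)\<^sup>2))))"

text \<open>The factor in \<open>disc_push\<close> stretches radii by \<open>1 + t\<close> and caps
  them at the unit sphere. That the disc and the collar are preserved, and that the collar ends on
  the sphere, is read off from this formula.\<close>

lemma disc_push_norm:
  assumes "0 \<le> t"
  shows "(\<Sum>i<n. (disc_push n t x i)\<^sup>2) = (min 1 ((1 + t) * sqrt (\<Sum>i<n. (x i)\<^sup>2)))\<^sup>2"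
proof -
  let ?r = "sqrt (\<Sum>i<n. (x i)\<^sup>2)" and ?c = "(1 + t) / max 1 ((1 + t) * sqrt (\<Sum>i<n. (x i)\<^sup>2))"
  have "(\<Sum>i<n. (disc_push n t x i)\<^sup>2) = (\<Sum>i<n. (x i)\<^sup>2) * ?c\<^sup>2"
    unfolding disc_push_def power_mult_distrib sum_distrib_right ..
  also have "\<dots> = (?r * ?c)\<^sup>2"
    unfolding power_mult_distrib[of ?r] by (simp add: sum_nonneg)
  also have "?r * ?c = min 1 ((1 + t) * ?r)"
  proof (cases "(1+t) * ?r \<le> 1")
    case True then show ?thesis by (simp add: max_def min_def mult.commute)
  next
    case False
    then have "max 1 ((1+t) * ?r) = (1+t) * ?r" "min 1 ((1+t) * ?r) = 1" "(1+t) * ?r \<noteq> 0" by auto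
    then show ?thesis by (simp add: field_simps)
  qed
  finally show ?thesis .
qed

lemma disc_push_in_disc:
  assumes "0 \<le> t" "x \<in> topspace (closed_disc n)"
  shows "disc_push n t x \<in> topspace (closed_disc n)"
proof -
  have "0 \<le> (1 + t) * sqrt (\<Sum>i<n. (x i)\<^sup>2)" using assms by (simp add: sum_nonneg)
  then have "(min 1 ((1 + t) * sqrt (\<Sum>i<n. (x i)\<^sup>2)))\<^sup>2 \<le> 1"
    by (simp add: abs_square_le_1)
  moreover have "\<forall>i\<ge>n. disc_push n t x i = 0"
    using assms by (auto simp: disc_push_def topspace_closed_disc)
  ultimately show ?thesis
    using disc_push_norm[OF assms(1), of n x] by (simp add: topspace_closed_disc)
qed

lemma disc_push_0:
  assumes "x \<in> topspace (closed_disc n)"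
  shows "disc_push n 0 x = x"
proof -
  have "sqrt (\<Sum>i<n. (x i)\<^sup>2) \<le> 1" using assms by (simp add: topspace_closed_disc)
  then show ?thesis by (simp add: disc_push_def max_absorb1)
qed

lemma disc_push_boundary:
  assumes "0 \<le> t" "x \<in> boundary_sphere_set n"
  shows "disc_push n t x = x"
  using assms by (simp add: disc_push_def boundary_sphere_set_eq max_def)

text \<open>Radii never shrink under the push. This is what keeps the collar inside itself at every
  time, as a homotopy of pairs requires.\<close>

lemma disc_push_collar:
  assumes "0 \<le> t" "x \<in> topspace (closed_disc n)" "1/4 < (\<Sum>i<n. (x i)\<^sup>2)"
  shows "1/4 < (\<Sum>i<n. (disc_push n t x i)\<^sup>2)"
proof -
  have "1/2 < sqrt (\<Sum>i<n. (x i)\<^sup>2)"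
    using assms(3) by (intro real_less_rsqrt) (simp add: power2_eq_square)
  moreover have "sqrt (\<Sum>i<n. (x i)\<^sup>2) \<le> (1 + t) * sqrt (\<Sum>i<n. (x i)\<^sup>2)"
    using assms(1) by (simp add: sum_nonneg mult_left_le algebra_simps)
  ultimately have "1/2 < min 1 ((1 + t) * sqrt (\<Sum>i<n. (x i)\<^sup>2))" by linarith
  then have "(1/2)\<^sup>2 < (min 1 ((1 + t) * sqrt (\<Sum>i<n. (x i)\<^sup>2)))\<^sup>2"
    by (intro power_strict_mono) auto
  then show ?thesis using disc_push_norm[OF assms(1)] by (simp add: power2_eq_square)
qed

text \<open>At time 1 the push doubles radii, so everything beyond radius 1/2 reaches the sphere;
  the bound 1/4 is the square of that radius.\<close>

lemma disc_push_1:
  assumes "x \<in> topspace (closed_disc n)" "1/4 < (\<Sum>i<n. (x i)\<^sup>2)"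
  shows "disc_push n 1 x \<in> boundary_sphere_set n"
proof -
  have "1/2 < sqrt (\<Sum>i<n. (x i)\<^sup>2)"
    using assms(2) by (intro real_less_rsqrt) (simp add: power2_eq_square)
  then have "min 1 ((1 + 1) * sqrt (\<Sum>i<n. (x i)\<^sup>2)) = 1" by simp
  then show ?thesis
    using disc_push_norm[of 1 n x] disc_push_in_disc[of 1 x n] assms
    by (simp add: boundary_sphere_set_eq topspace_closed_disc)
qed

lemma continuous_map_disc_push:
  "continuous_map (prod_topology (top_of_set {0..1}) (closed_disc n)) (closed_disc n)
     (\<lambda>(t, x). disc_push n t x)"
proof -
  define D where "D = topspace (closed_disc n)"
  have eq: "closed_disc n = top_of_set D" by (simp add: D_def closed_disc_eq_top_of_set)
  have coord: "continuous_on A (\<lambda>z::real\<times>(nat\<Rightarrow>real). snd z i)" for A i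
    by (rule continuous_on_compose2[OF continuous_on_product_coordinates]) (auto intro: continuous_intros)
  have "continuous_on ({0..1} \<times> D) (\<lambda>z i. disc_push n (fst z) (snd z) i)"
    unfolding disc_push_def
    by (intro continuous_on_coordinatewise_then_product continuous_intros coord) auto
  moreover have "disc_push n t x \<in> D" if "t \<in> {0..1}" "x \<in> D" for t x
    using that disc_push_in_disc by (auto simp: D_def)
  ultimately show ?thesis
    unfolding eq by (auto simp: case_prod_unfold)
qed

section \<open>Homology of the disc relative to its sphere\<close>

lemma contractible_space_closed_disc: "contractible_space (closed_disc n)"
proof -
  define D where "D = topspace (closed_disc n)"
  let ?h = "\<lambda>z::real\<times>(nat\<Rightarrow>real). \<lambda>i. (1 - fst z) * snd z i"
  have eq: "closed_disc n = top_of_set D" by (simp add: D_def closed_disc_eq_top_of_set)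
  have coord: "continuous_on A (\<lambda>z::real\<times>(nat\<Rightarrow>real). snd z i)" for A i
    by (rule continuous_on_compose2[OF continuous_on_product_coordinates]) (auto intro: continuous_intros)
  have "continuous_on ({0..1} \<times> D) ?h"
    by (intro continuous_on_coordinatewise_then_product continuous_intros coord)
  moreover have "(\<lambda>i. (1 - t) * x i) \<in> D" if "t \<in> {0..1}" "x \<in> D" for t x
  proof -
    have "(\<Sum>i<n. ((1 - t) * x i)\<^sup>2) = (1 - t)\<^sup>2 * (\<Sum>i<n. (x i)\<^sup>2)"
      by (simp add: power_mult_distrib sum_distrib_left)
    also have "\<dots> \<le> 1 * 1"
      using that by (intro mult_mono) (auto simp: D_def topspace_closed_disc abs_square_le_1 sum_nonneg)
    finally show ?thesis using that by (auto simp: D_def topspace_closed_disc)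
  qed
  ultimately have "continuous_map (prod_topology (top_of_set {0..1}) (closed_disc n)) (closed_disc n) ?h"
    unfolding eq by auto
  then have "homotopic_with (\<lambda>x. True) (closed_disc n) (closed_disc n) id (\<lambda>x i. 0)"
    unfolding homotopic_with_def by (intro exI[of _ ?h]) auto
  then show ?thesis unfolding contractible_space_def by blast
qed

text \<open>The disc is contractible, so the relative group is the reduced homology of the boundary
  sphere one degree lower, which is known.\<close>

lemma isomorphic_group_disc_integer:
  "relative_homology_group (int n) (closed_disc n) (boundary_sphere_set n) \<cong> integer_group"
proof (cases n)
  \<comment> \<open>The sphere is empty and the disc is a point, so the coefficient group appears
    directly; the argument with reduced homology needs a nonempty sphere.\<close>
  case 0
  then have "boundary_sphere_set n = {}" "topspace (closed_disc n) = {\<lambda>i. 0}"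
    by (auto simp: boundary_sphere_set_eq topspace_closed_disc)
  then show ?thesis using homology_coefficients 0 by fastforce
next
  case (Suc m)
  \<comment> \<open>\<open>nsphere m\<close> uses the first \<open>Suc m\<close> coordinates, so the
    \<open>n\<close>-disc is bounded by the sphere with index one less than
    \<open>n\<close>.\<close>
  have "subtopology (closed_disc n) (boundary_sphere_set n) = nsphere m"
  proof -
    have "{x. (\<Sum>i<n. (x i)\<^sup>2) \<le> 1} \<inter> boundary_sphere_set n
        = topspace (Euclidean_space (Suc m)) \<inter> {x. (\<Sum>i\<le>m. (x i)\<^sup>2) = 1}"
      by (auto simp: boundary_sphere_set_def Suc lessThan_Suc_atMost)
    then show ?thesis
      unfolding nsphere_def closed_disc_def subtopology_subtopology Suc
      by (metis subtopology_restrict)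
  qed
  moreover have "boundary_sphere_set n \<noteq> {}"
  proof -
    have "topspace (nsphere m) \<subseteq> boundary_sphere_set n"
      unfolding nsphere_def boundary_sphere_set_def Suc lessThan_Suc_atMost by auto
    then show ?thesis using in_topspace_nsphere[of m] by blast
  qed
  ultimately have "subtopology (closed_disc n) (boundary_sphere_set n) = nsphere m"
      "topspace (closed_disc n) \<inter> boundary_sphere_set n \<noteq> {}"
    using open_disc_Un_boundary[of n] by blast+
  then have "relative_homology_group (int n) (closed_disc n) (boundary_sphere_set n)
       \<cong> reduced_homology_group (int n - 1) (nsphere m)"
    using isomorphic_group_relative_homology_of_contractible[OF contractible_space_closed_disc, of n "boundary_sphere_set n" "int n"]
    by metis
  also have "int n - 1 = int m" using Suc by simp
  also have "reduced_homology_group (int m) (nsphere m) \<cong> integer_group"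
    by (rule reduced_homology_group_nsphere)
  finally show ?thesis .
qed

section \<open>Attaching a single cell\<close>

text \<open>\<open>weak\<close> expresses that \<open>Y\<close> has the quotient topology of
  \<open>S\<close> and a disc glued along its sphere. That \<open>f\<close> is a homeomorphism on
  the open cell is a consequence, proved in \<open>homeomorphic_map_cell\<close>. As the description
  involves no separation axiom of \<open>Y\<close>, orbit spaces fall under it at once.\<close>

locale cell_attachment =
  fixes Y :: "'a topology" and S :: "'a set" and n :: nat and f :: "(nat \<Rightarrow> real) \<Rightarrow> 'a"
  assumes closed_base: "closedin Y S"
    and cont: "continuous_map (closed_disc n) Y f"
    and boundary_into_base: "f ` boundary_sphere_set n \<subseteq> S"
    and inj: "inj_on f (open_disc_set n)"
    and cell_disjoint_base: "f ` open_disc_set n \<inter> S = {}"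
    and cover: "topspace Y = S \<union> f ` open_disc_set n"
    and weak: "\<And>A. \<lbrakk>A \<subseteq> topspace Y; closedin Y (A \<inter> S);
                 closedin (closed_disc n) {x \<in> topspace (closed_disc n). f x \<in> A}\<rbrakk> \<Longrightarrow> closedin Y A"
begin

lemma disc_cases [consumes 1, case_names interior boundary]:
  assumes "x \<in> topspace (closed_disc n)"
  obtains "x \<in> open_disc_set n" "f x \<notin> S" | "x \<in> boundary_sphere_set n" "x \<notin> open_disc_set n" "f x \<in> S"
  using assms open_disc_Un_boundary[of n] open_disc_Int_boundary[of n] boundary_into_base cell_disjoint_base
  by blast

lemma weak_open:
  assumes V: "V \<subseteq> topspace Y" and VS: "openin (subtopology Y S) (V \<inter> S)"
    and Vd: "openin (closed_disc n) {x \<in> topspace (closed_disc n). f x \<in> V}"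
  shows "openin Y V"
proof -
  have ST: "S \<subseteq> topspace Y" using closed_base closedin_subset by blast
  have "closedin Y (topspace Y - V)"
  proof (rule weak)
    have "closedin (subtopology Y S) (topspace (subtopology Y S) - V \<inter> S)"
      using VS by blast
    moreover have "topspace (subtopology Y S) - V \<inter> S = (topspace Y - V) \<inter> S" by auto
    ultimately show "closedin Y ((topspace Y - V) \<inter> S)"
      using closed_base closedin_trans_full by metis
    have "{x \<in> topspace (closed_disc n). f x \<in> topspace Y - V}
        = topspace (closed_disc n) - {x \<in> topspace (closed_disc n). f x \<in> V}"
      using cont by (auto simp: continuous_map_def)
    then show "closedin (closed_disc n) {x \<in> topspace (closed_disc n). f x \<in> topspace Y - V}"
      using Vd by (metis (no_types, lifting) closedin_diff closedin_topspace)
  qed auto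
  then show ?thesis using V by (metis openin_closedin)
qed

text \<open>An open neighbourhood of \<open>S\<close> that can be pushed into \<open>S\<close>. It
  provides the room that excision demands between the closed set cut out and the open set around
  it.\<close>

definition collar :: "'a set" where
  "collar = S \<union> f ` {x \<in> open_disc_set n. 1/4 < (\<Sum>i<n. (x i)\<^sup>2)}"

lemma collar_iff:
  assumes "x \<in> topspace (closed_disc n)"
  shows "f x \<in> collar \<longleftrightarrow> 1/4 < (\<Sum>i<n. (x i)\<^sup>2)"
  using assms
proof (cases rule: disc_cases)
  case interior
  then show ?thesis using inj by (auto simp: collar_def inj_on_def)
next
  case boundary
  then show ?thesis by (auto simp: collar_def boundary_sphere_set_eq)
qed

lemma base_subset_collar: "S \<subseteq> collar" by (simp add: collar_def)

lemma openin_collar: "openin Y collar"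
proof (rule weak_open)
  show "collar \<subseteq> topspace Y" using cover by (auto simp: collar_def)
  have "collar \<inter> S = topspace (subtopology Y S)" using closedin_subset[OF closed_base] by (auto simp: collar_def)
  then show "openin (subtopology Y S) (collar \<inter> S)" using openin_topspace[of "subtopology Y S"] by simp
  have "{x \<in> topspace (closed_disc n). f x \<in> collar} = {x \<in> topspace (closed_disc n). 1/4 < (\<Sum>i<n. (x i)\<^sup>2)}"
    using collar_iff by blast
  then show "openin (closed_disc n) {x \<in> topspace (closed_disc n). f x \<in> collar}"
    by (simp only: openin_disc_norm_greater)
qed

text \<open>\<open>disc_push\<close> written in the coordinate
  \<open>inv_into (open_disc_set n) f\<close> of the open cell. The two clauses fit together because
  \<open>disc_push\<close> fixes the sphere; \<open>push_cell\<close> is the resulting uniform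
  formula on the closed disc.\<close>

definition push :: "real \<Rightarrow> 'a \<Rightarrow> 'a" where
  "push t y = (if y \<in> f ` open_disc_set n then f (disc_push n t (inv_into (open_disc_set n) f y)) else y)"

lemma push_base: "y \<in> S \<Longrightarrow> push t y = y"
  using cell_disjoint_base by (auto simp: push_def)

lemma push_cell:
  assumes "x \<in> topspace (closed_disc n)" "0 \<le> t"
  shows "push t (f x) = f (disc_push n t x)"
  using assms(1)
proof (cases rule: disc_cases)
  case interior
  then show ?thesis using inj by (simp add: push_def)
next
  case boundary
  then show ?thesis using assms by (simp add: push_base disc_push_boundary)
qed

lemma push_0: "push 0 y = y"
proof (cases "y \<in> f ` open_disc_set n")
  case True
  then obtain x where "x \<in> open_disc_set n" "y = f x" by blast
  then show ?thesis using push_cell[of x 0] disc_push_0[of x n] open_disc_Un_boundary[of n] by auto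
qed (simp add: push_def)

lemma topspace_cases:
  assumes "y \<in> topspace Y"
  obtains "y \<in> S" | x where "x \<in> topspace (closed_disc n)" "x \<in> open_disc_set n" "y = f x"
  using assms cover open_disc_Un_boundary[of n] by blast

lemma push_in:
  assumes "y \<in> topspace Y" "0 \<le> t" shows "push t y \<in> topspace Y"
  using assms(1)
proof (cases rule: topspace_cases)
  case 1
  then show ?thesis using assms by (simp add: push_base)
next
  case (2 x)
  then have "push t y = f (disc_push n t x)" "disc_push n t x \<in> topspace (closed_disc n)"
    using assms push_cell disc_push_in_disc by auto
  then show ?thesis using continuous_map_image_subset_topspace[OF cont] by auto
qed

lemma push_collar:
  assumes "y \<in> collar" "0 \<le> t" shows "push t y \<in> collar"
proof -
  have "y \<in> topspace Y" using assms openin_collar openin_subset by blast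
  then show ?thesis
  proof (cases rule: topspace_cases)
    case 1 then show ?thesis using assms by (simp add: push_base)
  next
    case (2 x)
    then show ?thesis using assms collar_iff push_cell disc_push_collar disc_push_in_disc by metis
  qed
qed

lemma push_1_collar: assumes "y \<in> collar" shows "push 1 y \<in> S"
proof -
  have "y \<in> topspace Y" using assms openin_collar openin_subset by blast
  then show ?thesis
  proof (cases rule: topspace_cases)
    case 1 then show ?thesis using assms by (simp add: push_base)
  next
    case (2 x)
    then have "disc_push n 1 x \<in> boundary_sphere_set n" using assms collar_iff disc_push_1 by blast
    then show ?thesis using 2 push_cell[of x 1] boundary_into_base by auto
  qed
qed

text \<open>The tube lemma on the disc makes the set of points that stay in \<open>V\<close> during a compact
  time interval open, so no product of quotient maps is needed.\<close>

lemma continuous_map_push: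
  "continuous_map (prod_topology (top_of_set {0..1}) Y) Y (\<lambda>(t, y). push t y)"
proof -
  let ?D = "topspace (closed_disc n)"
  let ?F = "\<lambda>(t, x). f (disc_push n t x)"
  have F: "continuous_map (prod_topology (top_of_set {0..1}) (closed_disc n)) Y ?F"
    using continuous_map_compose[OF continuous_map_disc_push cont] by (simp add: o_def case_prod_unfold)
  have path: "continuous_map (top_of_set {0..1}) Y (\<lambda>t. push t y)" if y: "y \<in> topspace Y" for y
    using y
  proof (cases rule: topspace_cases)
    case 1
    then show ?thesis using y by (simp add: push_base)
  next
    case (2 x)
    have "continuous_map (top_of_set {0..1}) (prod_topology (top_of_set {0..1}) (closed_disc n)) (\<lambda>t. (t, x))"
      using 2 by (simp add: continuous_map_pairwise o_def)
    from continuous_map_compose[OF this F] show ?thesis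
      by (rule continuous_map_eq) (use 2 in \<open>auto simp: push_cell\<close>)
  qed
  have nbhd: "\<exists>T. openin (prod_topology (top_of_set {0..1}) Y) T \<and> z \<in> T \<and>
        T \<subseteq> {z \<in> topspace (prod_topology (top_of_set {0..1}) Y). (\<lambda>(t, y). push t y) z \<in> V}"
    if V: "openin Y V" and z: "z \<in> topspace (prod_topology (top_of_set {0..1}) Y)" "(\<lambda>(t, y). push t y) z \<in> V" for V z
  proof -
    obtain t y where zt: "z = (t, y)" and t: "t \<in> {0..1}" and y: "y \<in> topspace Y" and ty: "push t y \<in> V"
      using z by auto
    have "openin (top_of_set {0..1}) {s \<in> {0..1}. push s y \<in> V}"
      using openin_continuous_map_preimage[OF path[OF y] V] by simp
    then obtain e where "e > 0" and e: "\<And>s. s \<in> {0..1} \<Longrightarrow> dist s t \<le> e \<Longrightarrow> push s y \<in> V"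
      using t ty unfolding openin_contains_cball by (force simp: dist_commute)
    define J where "J = cball t e \<inter> {0..1}"
    have tJ: "t \<in> J" and J01: "J \<subseteq> {0..1}" using t \<open>e > 0\<close> by (auto simp: J_def)
    define V' where "V' = {y \<in> topspace Y. \<forall>s\<in>J. push s y \<in> V}"
    have "openin Y V'"
    proof (rule weak_open)
      have ST: "S \<subseteq> topspace Y" using closed_base closedin_subset by blast
      have "V' \<inter> S = V \<inter> S" using tJ ST by (auto simp: V'_def push_base)
      then show "openin (subtopology Y S) (V' \<inter> S)"
        using V openin_subtopology_Int by metis
      \<comment> \<open>The pairs of a time and a disc point that are pushed out of
        \<open>V\<close>. This set is closed in a compact product, so its projection to the disc is
        compact and hence closed; the complement of the projection is the preimage of
        \<open>V'\<close>.\<close>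
      let ?K = "{z \<in> topspace (prod_topology (top_of_set J) (closed_disc n)). ?F z \<in> topspace Y - V}"
      have "continuous_map (prod_topology (top_of_set J) (closed_disc n)) Y ?F"
      proof -
        have "prod_topology (top_of_set J) (closed_disc n)
            = subtopology (prod_topology (top_of_set {0..1}) (closed_disc n)) (J \<times> topspace (closed_disc n))"
          using J01 by (simp add: prod_topology_subtopology subtopology_subtopology Int_absorb1 Times_Int_Times)
        then show ?thesis using continuous_map_from_subtopology[OF F] by metis
      qed
      then have "closedin (prod_topology (top_of_set J) (closed_disc n)) ?K"
        by (rule closedin_continuous_map_preimage) (use V in blast)
      moreover have "compact_space (prod_topology (top_of_set J) (closed_disc n))"
      proof -
        have "compactin euclidean J" by (simp add: J_def compact_Int_closed)
        then show ?thesis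
          using compact_space_closed_disc by (simp add: compact_space_prod_topology compact_space_subtopology)
      qed
      ultimately have "compactin (closed_disc n) (snd ` ?K)"
        using closedin_compact_space image_compactin[OF _ continuous_map_snd] by blast
      then have "closedin (closed_disc n) (snd ` ?K)"
        using Hausdorff_space_closed_disc compactin_imp_closedin by blast
      then have "openin (closed_disc n) (?D - snd ` ?K)" by blast
      moreover have "?D - snd ` ?K = {x \<in> ?D. f x \<in> V'}"
      proof -
        have fD: "f x \<in> topspace Y" if "x \<in> ?D" for x
          using that continuous_map_image_subset_topspace[OF cont] by auto
        have "push s (f x) = f (disc_push n s x)" "f (disc_push n s x) \<in> topspace Y"
          if "x \<in> ?D" "s \<in> J" for x s
        proof -
          have "0 \<le> s" using that J01 by auto
          then show "push s (f x) = f (disc_push n s x)" "f (disc_push n s x) \<in> topspace Y"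
            using that push_cell[of x s] fD[OF disc_push_in_disc] by auto
        qed
        then have K: "x \<in> snd ` ?K \<longleftrightarrow> (\<exists>s\<in>J. push s (f x) \<notin> V)" if "x \<in> ?D" for x
          using that by (auto simp: image_iff)
        show ?thesis
        proof (rule Set.set_eqI)
          fix x
          show "x \<in> ?D - snd ` ?K \<longleftrightarrow> x \<in> {x \<in> ?D. f x \<in> V'}"
            unfolding Diff_iff mem_Collect_eq using K[of x] fD[of x] unfolding V'_def mem_Collect_eq by blast
        qed
      qed
      ultimately show "openin (closed_disc n) {x \<in> ?D. f x \<in> V'}" by simp
    qed (auto simp: V'_def)
    moreover have "openin (top_of_set {0..1}) ({0..1} \<inter> ball t e)" by (simp add: openin_open_Int)
    ultimately have "openin (prod_topology (top_of_set {0..1}) Y) (({0..1} \<inter> ball t e) \<times> V')"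
      by (simp add: openin_prod_Times_iff)
    moreover have "z \<in> ({0..1} \<inter> ball t e) \<times> V'"
      using zt t y e \<open>e > 0\<close> by (auto simp: V'_def J_def dist_commute)
    moreover have "({0..1} \<inter> ball t e) \<times> V' \<subseteq> {z \<in> topspace (prod_topology (top_of_set {0..1}) Y). (\<lambda>(t, y). push t y) z \<in> V}"
      by (auto simp: V'_def J_def)
    ultimately show ?thesis by blast
  qed
  show ?thesis
    unfolding continuous_map
  proof (intro conjI allI impI)
    show "(\<lambda>(t, y). push t y) ` topspace (prod_topology (top_of_set {0..1}) Y) \<subseteq> topspace Y"
      using push_in by auto
    show "openin (prod_topology (top_of_set {0..1}) Y)
            {z \<in> topspace (prod_topology (top_of_set {0..1}) Y). (\<lambda>(t, y). push t y) z \<in> V}" if "openin Y V" for V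
      by (subst openin_subopen) (use nbhd[OF that] in blast)
  qed
qed

lemma homotopic_push:
  assumes "\<And>t. t \<in> {0..1} \<Longrightarrow> push t \<in> A \<rightarrow> A"
  shows "homotopic_with (\<lambda>h. h \<in> A \<rightarrow> A) Y Y (push 1) id"
proof -
  have "homotopic_with (\<lambda>h. h \<in> A \<rightarrow> A) Y Y id (push 1)"
    unfolding homotopic_with_def
    by (intro exI[of _ "\<lambda>(t, y). push t y"] conjI continuous_map_push) (use assms push_0 in auto)
  then show ?thesis by (simp add: homotopic_with_sym)
qed

text \<open>The inclusion of pairs is a homotopy equivalence with inverse \<open>push 1\<close>: the
  latter moves the collar into \<open>S\<close>, and the intermediate pushes preserve both
  \<open>S\<close> and the collar.\<close>

lemma iso_base_collar:
  "hom_induced p Y S Y collar id \<in> iso (relative_homology_group p Y S) (relative_homology_group p Y collar)"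
proof (rule homotopy_equivalence_relative_homology_group_isomorphism)
  show "continuous_map Y Y (push 1)"
    using homotopic_push[of UNIV] homotopic_with_imp_continuous_maps by blast
  have "homotopic_with (\<lambda>h. h \<in> S \<rightarrow> S) Y Y (push 1) id"
    by (rule homotopic_push) (auto simp: push_base)
  then show "homotopic_with (\<lambda>h. h \<in> S \<rightarrow> S) Y Y (push 1 \<circ> id) id" by simp
  have "homotopic_with (\<lambda>h. h \<in> collar \<rightarrow> collar) Y Y (push 1) id"
    by (rule homotopic_push) (auto simp: push_collar)
  then show "homotopic_with (\<lambda>h. h \<in> collar \<rightarrow> collar) Y Y (id \<circ> push 1) id" by simp
qed (use base_subset_collar push_1_collar in auto)

text \<open>The closed base lies in the open collar, so it may be cut out. What remains is the open
  cell together with its outer annulus.\<close>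

lemma iso_excise_base:
  "hom_induced p (subtopology Y (topspace Y - S)) (collar - S) Y collar id
     \<in> iso (relative_homology_group p (subtopology Y (topspace Y - S)) (collar - S))
            (relative_homology_group p Y collar)"
proof -
  have "Y closure_of S \<subseteq> Y interior_of collar"
    using closed_base openin_collar base_subset_collar by (simp add: closure_of_closedin interior_of_openin)
  from homology_excision_axiom[OF this openin_subset[OF openin_collar]] show ?thesis by simp
qed

text \<open>Openness comes from the weak topology: the image of an open part \<open>V\<close> of the
  open disc misses \<open>S\<close>, and by injectivity its preimage in the closed disc is
  \<open>V\<close> again.\<close>

lemma homeomorphic_map_cell:
  "homeomorphic_map (subtopology (closed_disc n) (open_disc_set n)) (subtopology Y (topspace Y - S)) f"
proof (rule bijective_open_imp_homeomorphic_map)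
  have B: "topspace (subtopology (closed_disc n) (open_disc_set n)) = open_disc_set n"
    using open_disc_Un_boundary[of n] by auto
  have Y: "topspace (subtopology Y (topspace Y - S)) = f ` open_disc_set n"
    using cover cell_disjoint_base by auto
  show "continuous_map (subtopology (closed_disc n) (open_disc_set n)) (subtopology Y (topspace Y - S)) f"
    using cont continuous_map_from_subtopology Y B
    by (auto simp: continuous_map_in_subtopology)
  show "open_map (subtopology (closed_disc n) (open_disc_set n)) (subtopology Y (topspace Y - S)) f"
    unfolding open_map_def
  proof (intro allI impI)
    fix V assume "openin (subtopology (closed_disc n) (open_disc_set n)) V"
    then have V: "openin (closed_disc n) V" "V \<subseteq> open_disc_set n"
      using openin_open_disc openin_open_subtopology by blast+
    have "openin Y (f ` V)"
    proof (rule weak_open)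
      show "f ` V \<subseteq> topspace Y" using V cover by blast
      have "f ` V \<inter> S = {}" using V cell_disjoint_base by blast
      then show "openin (subtopology Y S) (f ` V \<inter> S)" by simp
      have "x \<in> V" if "x \<in> topspace (closed_disc n)" "f x \<in> f ` V" for x
        using that(1)
      proof (cases rule: disc_cases)
        case interior
        then show ?thesis using that V inj by (auto dest: inj_onD)
      next
        case boundary
        then show ?thesis using that V cell_disjoint_base by blast
      qed
      then have "{x \<in> topspace (closed_disc n). f x \<in> f ` V} = V"
        using openin_subset[OF V(1)] by blast
      then show "openin (closed_disc n) {x \<in> topspace (closed_disc n). f x \<in> f ` V}" using V by simp
    qed
    then show "openin (subtopology Y (topspace Y - S)) (f ` V)"
    proof -
      have "openin Y (topspace Y - S)" using closed_base by blast
      moreover have "f ` V \<subseteq> topspace Y - S" using V cell_disjoint_base cover by blast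
      ultimately show ?thesis using \<open>openin Y (f ` V)\<close> by (simp add: openin_open_subtopology)
    qed
  qed
qed (use inj cover cell_disjoint_base open_disc_Un_boundary[of n] in \<open>auto simp: Int_absorb1\<close>)

end

text \<open>The disc is itself a cell attached to its boundary sphere. Hence everything proved for
  \<open>Y\<close> also holds on the side of the disc, and the two can be compared by
  \<open>f\<close>.\<close>

lemma cell_attachment_disc: "cell_attachment (closed_disc n) (boundary_sphere_set n) n id"
proof
  show "closedin (closed_disc n) A"
    if "A \<subseteq> topspace (closed_disc n)" "closedin (closed_disc n) {x \<in> topspace (closed_disc n). id x \<in> A}" for A
  proof -
    have "{x \<in> topspace (closed_disc n). id x \<in> A} = A" using that by auto
    then show ?thesis using that by simp
  qed
qed (use closedin_boundary_sphere open_disc_Un_boundary[of n] open_disc_Int_boundary[of n] in auto)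

text \<open>For the disc and for \<open>Y\<close> alike, passing from base to collar and excising
  the base leads to the open cell with its annulus. There \<open>f\<close> is a homeomorphism, and
  the two squares below carry the isomorphism back to the original pairs.\<close>

theorem (in cell_attachment) iso_attached_cell:
  "hom_induced p (closed_disc n) (boundary_sphere_set n) Y S f
     \<in> iso (relative_homology_group p (closed_disc n) (boundary_sphere_set n)) (relative_homology_group p Y S)"
proof -
  interpret disc: cell_attachment "closed_disc n" "boundary_sphere_set n" n id
    by (rule cell_attachment_disc)
  let ?D = "closed_disc n" and ?B = "topspace (closed_disc n) - boundary_sphere_set n"
  have B: "?B = open_disc_set n"
    using open_disc_Un_boundary[of n] open_disc_Int_boundary[of n] by blast
  have DU: "disc.collar = {x \<in> topspace ?D. 1/4 < (\<Sum>i<n. (x i)\<^sup>2)}"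
    using disc.collar_iff openin_subset[OF disc.openin_collar] by auto
  have fU: "f \<in> disc.collar \<rightarrow> collar" using DU collar_iff by auto
  let ?F' = "hom_induced p ?D disc.collar Y collar f"
  let ?H = "\<lambda>X T. carrier (relative_homology_group p X T)"
  have homeo: "hom_induced p (subtopology ?D ?B) (disc.collar - boundary_sphere_set n)
        (subtopology Y (topspace Y - S)) (collar - S) f
      \<in> iso (relative_homology_group p (subtopology ?D ?B) (disc.collar - boundary_sphere_set n))
            (relative_homology_group p (subtopology Y (topspace Y - S)) (collar - S))"
  proof (rule homeomorphic_map_relative_homology_iso)
    show "homeomorphic_map (subtopology ?D ?B) (subtopology Y (topspace Y - S)) f"
      using homeomorphic_map_cell B by simp
    have "disc.collar - boundary_sphere_set n = {x \<in> open_disc_set n. 1/4 < (\<Sum>i<n. (x i)\<^sup>2)}"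
      using DU B by auto
    then show "f ` (disc.collar - boundary_sphere_set n) = collar - S"
      using cell_disjoint_base by (auto simp: collar_def)
    show "disc.collar - boundary_sphere_set n \<subseteq> topspace (subtopology ?D ?B)"
      using DU by auto
  qed
  \<comment> \<open>The excision square. Three of its sides are bijective, hence so is
    \<open>?F'\<close>.\<close>
  have sq1: "?F' \<circ> hom_induced p (subtopology ?D ?B) (disc.collar - boundary_sphere_set n) ?D disc.collar id
      = hom_induced p (subtopology Y (topspace Y - S)) (collar - S) Y collar id \<circ>
        hom_induced p (subtopology ?D ?B) (disc.collar - boundary_sphere_set n)
          (subtopology Y (topspace Y - S)) (collar - S) f"
  proof -
    have "continuous_map (subtopology ?D ?B) (subtopology Y (topspace Y - S)) f"
      using homeomorphic_map_cell B homeomorphic_imp_continuous_map by auto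
    moreover have "f \<in> disc.collar - boundary_sphere_set n \<rightarrow> collar - S"
      using fU DU B cell_disjoint_base by fastforce
    ultimately show ?thesis
      using fU cont by (subst (1 2) hom_induced_compose[symmetric]) auto
  qed
  \<comment> \<open>The square of the passage from base to collar, which transfers bijectivity from
    \<open>?F'\<close> to the map in question.\<close>
  have sq2: "?F' \<circ> hom_induced p ?D (boundary_sphere_set n) ?D disc.collar id
     = hom_induced p Y S Y collar id \<circ> hom_induced p ?D (boundary_sphere_set n) Y S f"
    using fU cont boundary_into_base base_subset_collar disc.base_subset_collar
    by (subst (1 2) hom_induced_compose[symmetric]) auto
  have "bij_betw (hom_induced p (subtopology Y (topspace Y - S)) (collar - S) Y collar id \<circ>
        hom_induced p (subtopology ?D ?B) (disc.collar - boundary_sphere_set n)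
          (subtopology Y (topspace Y - S)) (collar - S) f)
      (?H (subtopology ?D ?B) (disc.collar - boundary_sphere_set n)) (?H Y collar)"
    using homeo iso_excise_base by (intro bij_betw_trans) (auto simp: iso_def)
  then have "bij_betw ?F' (?H ?D disc.collar) (?H Y collar)"
    using disc.iso_excise_base[of p] unfolding sq1[symmetric]
    by (subst bij_betw_comp_iff) (auto simp: iso_def)
  then have "bij_betw (hom_induced p Y S Y collar id \<circ> hom_induced p ?D (boundary_sphere_set n) Y S f)
      (?H ?D (boundary_sphere_set n)) (?H Y collar)"
    using disc.iso_base_collar[of p] unfolding sq2[symmetric]
    by (intro bij_betw_trans) (auto simp: iso_def)
  then have "bij_betw (hom_induced p ?D (boundary_sphere_set n) Y S f) (?H ?D (boundary_sphere_set n)) (?H Y S)"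
    using iso_base_collar[of p] hom_induced_carrier by (subst bij_betw_comp_iff2) (auto simp: iso_def)
  then show ?thesis by (simp add: iso_def hom_induced_hom)
qed

section \<open>Free basis of the relative homology of an attachment\<close>

text \<open>Write \<open>c\<close> as the product of its quotient by \<open>d\<close> and
  \<open>d\<close>. The quotient lies in the kernel of \<open>f\<close>, hence in the image of
  \<open>e\<close>. This is the diagram chase in the induction over cells, with an exact sequence
  supplying \<open>ker\<close>.\<close>

lemma hom_mem_of_kernel:
  assumes "group G" "group K" "group L"
    and f: "f \<in> hom G K" and g: "g \<in> hom G L"
    and c: "c \<in> carrier G" and d: "d \<in> carrier G" and fcd: "f c = f d"
    and ker: "kernel G K f = e ` A"
    and H: "subgroup H L" and gd: "g d \<in> H" and ge: "\<And>x. x \<in> A \<Longrightarrow> g (e x) \<in> H"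
  shows "g c \<in> H"
proof -
  interpret f: group_hom G K f by (intro group_hom.intro group_hom_axioms.intro assms)
  interpret g: group_hom G L g by (intro group_hom.intro group_hom_axioms.intro assms)
  have "c \<otimes>\<^bsub>G\<^esub> inv\<^bsub>G\<^esub> d \<in> kernel G K f" using c d fcd by (simp add: kernel_def)
  then have "g (c \<otimes>\<^bsub>G\<^esub> inv\<^bsub>G\<^esub> d) \<in> H" using ker ge by auto
  moreover have "g c = g (c \<otimes>\<^bsub>G\<^esub> inv\<^bsub>G\<^esub> d) \<otimes>\<^bsub>L\<^esub> g d"
    using c d by (simp flip: g.hom_mult add: f.G.m_assoc)
  ultimately show ?thesis using gd H subgroup.m_closed by metis
qed

text \<open>A homomorphism that kills every basis element except one reads off a single coefficient.
  It is applied to projections onto one cell in order to prove independence.\<close>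

lemma hom_free_Abelian_group_coeff:
  assumes "group K" and g: "g \<in> hom (free_Abelian_group I) K" and i: "i \<in> I"
    and other: "\<And>j. \<lbrakk>j \<in> I; j \<noteq> i\<rbrakk> \<Longrightarrow> g (frag_of j) = \<one>\<^bsub>K\<^esub>"
    and c: "Poly_Mapping.keys c \<subseteq> I"
  shows "g c = g (frag_of i) [^]\<^bsub>K\<^esub> Poly_Mapping.lookup c i"
proof -
  interpret g: group_hom "free_Abelian_group I" K g
    by (intro group_hom.intro group_hom_axioms.intro assms group_free_Abelian_group)
  have w: "g (frag_of i) \<in> carrier K" using g.hom_closed[of "frag_of i"] i by simp
  show ?thesis
    using c
  proof (induction c rule: free_Abelian_group_induct[consumes 1])
    case 1
    show ?case using g.hom_one by simp
  next
    case (2 x y)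
    have "g (x - y) = g x \<otimes>\<^bsub>K\<^esub> inv\<^bsub>K\<^esub> g y"
      using g.hom_mult[of x "- y"] g.hom_inv[of y] 2 by simp
    then show ?case using 2 w by (simp add: lookup_minus g.H.int_pow_diff)
  next
    case (3 j)
    then show ?case using other w by (cases "j = i") auto
  qed
qed

text \<open>The version of \<open>cell_attachment\<close> with arbitrarily many cells. Cells are
  indexed by a type of its own, since the points of the orbit space are sets of points of
  \<open>X\<close>, while the same discs parametrize the cells of both.\<close>

definition attaching ::
  "'a topology \<Rightarrow> 'a set \<Rightarrow> nat \<Rightarrow> 'i set \<Rightarrow> ('i \<Rightarrow> (nat \<Rightarrow> real) \<Rightarrow> 'a) \<Rightarrow> bool" where
  "attaching Y S n I \<Phi> \<longleftrightarrow>
     closedin Y S \<and>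
     (\<forall>i\<in>I. continuous_map (closed_disc n) Y (\<Phi> i) \<and> \<Phi> i ` boundary_sphere_set n \<subseteq> S \<and>
        inj_on (\<Phi> i) (open_disc_set n) \<and> \<Phi> i ` open_disc_set n \<inter> S = {}) \<and>
     (\<forall>i\<in>I. \<forall>j\<in>I. i \<noteq> j \<longrightarrow> \<Phi> i ` open_disc_set n \<inter> \<Phi> j ` open_disc_set n = {}) \<and>
     topspace Y = S \<union> (\<Union>i\<in>I. \<Phi> i ` open_disc_set n) \<and>
     (\<forall>A. A \<subseteq> topspace Y \<longrightarrow> closedin Y (A \<inter> S) \<longrightarrow>
        (\<forall>i\<in>I. closedin (closed_disc n) {x \<in> topspace (closed_disc n). \<Phi> i x \<in> A}) \<longrightarrow> closedin Y A)"

context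
  fixes Y :: "'a topology" and S n and I :: "'i set" and \<Phi>
  assumes att: "attaching Y S n I \<Phi>"
begin

section \<open>The weak topology of an attachment of many cells\<close>

lemma attaching_base: "closedin Y S" "S \<subseteq> topspace Y"
  using att closedin_subset unfolding attaching_def by blast+

lemma attaching_map:
  assumes "i \<in> I"
  shows "continuous_map (closed_disc n) Y (\<Phi> i)" "\<Phi> i ` boundary_sphere_set n \<subseteq> S"
    "inj_on (\<Phi> i) (open_disc_set n)" "\<Phi> i ` open_disc_set n \<inter> S = {}"
    "\<Phi> i ` topspace (closed_disc n) \<subseteq> topspace Y"
proof -
  have c: "continuous_map (closed_disc n) Y (\<Phi> i) \<and> \<Phi> i ` boundary_sphere_set n \<subseteq> S \<and>
        inj_on (\<Phi> i) (open_disc_set n) \<and> \<Phi> i ` open_disc_set n \<inter> S = {}"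
    using att assms by (simp add: attaching_def)
  then show "continuous_map (closed_disc n) Y (\<Phi> i)" "\<Phi> i ` boundary_sphere_set n \<subseteq> S"
    "inj_on (\<Phi> i) (open_disc_set n)" "\<Phi> i ` open_disc_set n \<inter> S = {}" by simp_all
  show "\<Phi> i ` topspace (closed_disc n) \<subseteq> topspace Y"
    using continuous_map_image_subset_topspace[of "closed_disc n" Y "\<Phi> i"] c by simp
qed

lemma attaching_disjoint:
  "\<lbrakk>i \<in> I; j \<in> I; i \<noteq> j\<rbrakk> \<Longrightarrow> \<Phi> i ` open_disc_set n \<inter> \<Phi> j ` open_disc_set n = {}"
  using att by (simp add: attaching_def)

lemma attaching_cover: "topspace Y = S \<union> (\<Union>i\<in>I. \<Phi> i ` open_disc_set n)"
  using att by (simp add: attaching_def)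

lemma attaching_weak:
  "\<lbrakk>A \<subseteq> topspace Y; closedin Y (A \<inter> S);
    \<And>i. i \<in> I \<Longrightarrow> closedin (closed_disc n) {x \<in> topspace (closed_disc n). \<Phi> i x \<in> A}\<rbrakk> \<Longrightarrow> closedin Y A"
  using att by (simp add: attaching_def)

lemma attaching_disc_cases [consumes 2, case_names interior boundary]:
  assumes "i \<in> I" "x \<in> topspace (closed_disc n)"
  obtains "x \<in> open_disc_set n" "\<Phi> i x \<in> \<Phi> i ` open_disc_set n" "\<Phi> i x \<notin> S" "x \<notin> boundary_sphere_set n"
        | "x \<in> boundary_sphere_set n" "x \<notin> open_disc_set n" "\<Phi> i x \<in> S"
  using assms open_disc_Un_boundary[of n] open_disc_Int_boundary[of n] attaching_map(2,4)[OF assms(1)]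
  by blast

text \<open>Pulled back to the disc of a cell, the set is the whole disc if the cell belongs to
  \<open>J\<close>, and the boundary sphere otherwise. Both are closed.\<close>

lemma attaching_closed_union:
  assumes J: "J \<subseteq> I"
  shows "closedin Y (S \<union> (\<Union>i\<in>J. \<Phi> i ` open_disc_set n))" (is "closedin Y ?Z")
proof (rule attaching_weak)
  show "?Z \<subseteq> topspace Y" using attaching_cover J by blast
  have "?Z \<inter> S = S" by blast
  then show "closedin Y (?Z \<inter> S)" using attaching_base by simp
  show "closedin (closed_disc n) {x \<in> topspace (closed_disc n). \<Phi> i x \<in> ?Z}" if i: "i \<in> I" for i
  proof (cases "i \<in> J")
    case True
    have "\<Phi> i x \<in> ?Z" if "x \<in> topspace (closed_disc n)" for x
      using i that by (cases rule: attaching_disc_cases) (use True in auto)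
    then have "{x \<in> topspace (closed_disc n). \<Phi> i x \<in> ?Z} = topspace (closed_disc n)" by blast
    then show ?thesis by simp
  next
    case False
    have "\<Phi> i x \<in> ?Z \<longleftrightarrow> x \<in> boundary_sphere_set n" if "x \<in> topspace (closed_disc n)" for x
      using i that
    proof (cases rule: attaching_disc_cases)
      case interior
      then show ?thesis using attaching_disjoint[OF i, of _] J False by blast
    next
      case boundary
      then show ?thesis by auto
    qed
    then have "{x \<in> topspace (closed_disc n). \<Phi> i x \<in> ?Z} = boundary_sphere_set n"
      using closedin_subset[OF closedin_boundary_sphere] by blast
    then show ?thesis using closedin_boundary_sphere by simp
  qed
qed

text \<open>For a cell outside \<open>J\<close>, a subset of the smaller space can be met only
  through its part in \<open>S\<close>, so the required closedness in that disc is mere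
  continuity.\<close>

lemma attaching_subset:
  assumes J: "J \<subseteq> I"
  shows "attaching (subtopology Y (S \<union> (\<Union>i\<in>J. \<Phi> i ` open_disc_set n))) S n J \<Phi>"
proof -
  define Z where "Z = S \<union> (\<Union>i\<in>J. \<Phi> i ` open_disc_set n)"
  have Z: "closedin Y Z" "Z \<subseteq> topspace Y"
    unfolding Z_def using attaching_closed_union[OF J] closedin_subset by blast+
  have into: "\<Phi> i ` topspace (closed_disc n) \<subseteq> Z" if "i \<in> J" for i
    unfolding open_disc_Un_boundary Z_def using attaching_map(2)[of i] J that by blast
  have weak: "closedin (subtopology Y Z) A"
    if "A \<subseteq> topspace (subtopology Y Z)" "closedin (subtopology Y Z) (A \<inter> S)"
      "\<forall>i\<in>J. closedin (closed_disc n) {x \<in> topspace (closed_disc n). \<Phi> i x \<in> A}" for A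
  proof -
    have AZ: "A \<subseteq> Z" and AS: "closedin Y (A \<inter> S)"
      using that Z closedin_trans_full by auto
    have "closedin Y A"
    proof (rule attaching_weak)
      show "closedin (closed_disc n) {x \<in> topspace (closed_disc n). \<Phi> i x \<in> A}" if i: "i \<in> I" for i
      proof (cases "i \<in> J")
        case False
        have "\<Phi> i x \<in> A \<longleftrightarrow> \<Phi> i x \<in> A \<inter> S" if "x \<in> topspace (closed_disc n)" for x
          using i that
        proof (cases rule: attaching_disc_cases)
          case interior
          then show ?thesis using attaching_disjoint[OF i, of _] J False AZ unfolding Z_def by blast
        qed auto
        then have "{x \<in> topspace (closed_disc n). \<Phi> i x \<in> A} = {x \<in> topspace (closed_disc n). \<Phi> i x \<in> A \<inter> S}"
          by blast
        then show ?thesis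
          using closedin_continuous_map_preimage[OF attaching_map(1)[OF i] AS] by simp
      qed (use \<open>\<forall>i\<in>J. _ i\<close> in blast)
    qed (use AZ AS Z in auto)
    then show ?thesis using AZ Z closedin_subset_topspace by blast
  qed
  have base: "closedin (subtopology Y Z) S"
    using closedin_subset_topspace[OF attaching_base(1)] by (simp add: Z_def)
  have cov: "topspace (subtopology Y Z) = Z"
    using Z by auto
  have maps: "\<forall>i\<in>J. continuous_map (closed_disc n) (subtopology Y Z) (\<Phi> i) \<and> \<Phi> i ` boundary_sphere_set n \<subseteq> S \<and>
        inj_on (\<Phi> i) (open_disc_set n) \<and> \<Phi> i ` open_disc_set n \<inter> S = {}"
  proof
    fix i assume "i \<in> J"
    then have "i \<in> I" using J by blast
    then show "continuous_map (closed_disc n) (subtopology Y Z) (\<Phi> i) \<and> \<Phi> i ` boundary_sphere_set n \<subseteq> S \<and>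
        inj_on (\<Phi> i) (open_disc_set n) \<and> \<Phi> i ` open_disc_set n \<inter> S = {}"
      using attaching_map[of i] into[OF \<open>i \<in> J\<close>] by (simp add: continuous_map_in_subtopology image_subset_iff_funcset)
  qed
  have disj: "\<forall>i\<in>J. \<forall>j\<in>J. i \<noteq> j \<longrightarrow> \<Phi> i ` open_disc_set n \<inter> \<Phi> j ` open_disc_set n = {}"
    using attaching_disjoint J by (meson subsetD)
  show ?thesis
    unfolding attaching_def Z_def[symmetric]
    by (intro conjI allI impI; (rule base maps disj cov | erule (2) weak))
qed

text \<open>All cells but one are absorbed into the base, so that the theory of a single attached
  cell applies to each cell in turn.\<close>

lemma attaching_cell:
  assumes i: "i \<in> I"
  shows "cell_attachment Y (topspace Y - \<Phi> i ` open_disc_set n) n (\<Phi> i)"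
proof -
  let ?R = "topspace Y - \<Phi> i ` open_disc_set n"
  have R: "?R = S \<union> (\<Union>j\<in>I - {i}. \<Phi> j ` open_disc_set n)"
    using attaching_cover attaching_disjoint[OF i] attaching_map(4)[OF i] i by blast
  show ?thesis
  proof
    show "topspace Y = ?R \<union> \<Phi> i ` open_disc_set n" using attaching_cover i by blast
    show closed: "closedin Y ?R" unfolding R by (rule attaching_closed_union) auto
    show "closedin Y A"
      if A: "A \<subseteq> topspace Y" "closedin Y (A \<inter> ?R)"
         "closedin (closed_disc n) {x \<in> topspace (closed_disc n). \<Phi> i x \<in> A}" for A
    proof (rule attaching_weak)
      have "A \<inter> S = (A \<inter> ?R) \<inter> S" using R by blast
      then show "closedin Y (A \<inter> S)" using A attaching_base by (metis closedin_Int)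
      show "closedin (closed_disc n) {x \<in> topspace (closed_disc n). \<Phi> j x \<in> A}" if j: "j \<in> I" for j
      proof (cases "j = i")
        case False
        have "\<Phi> j x \<in> ?R" if "x \<in> topspace (closed_disc n)" for x
          using j that by (cases rule: attaching_disc_cases) (use R j False in auto)
        then have "{x \<in> topspace (closed_disc n). \<Phi> j x \<in> A} = {x \<in> topspace (closed_disc n). \<Phi> j x \<in> A \<inter> ?R}"
          by blast
        then show ?thesis
          using closedin_continuous_map_preimage[OF attaching_map(1)[OF j] A(2)] by simp
      qed (use A in simp)
    qed (use A in simp)
    show "\<Phi> i ` boundary_sphere_set n \<subseteq> ?R" using attaching_map(2)[OF i] R by blast
  qed (use attaching_map[OF i] in auto)
qed

text \<open>Choose a point of \<open>K\<close> in each open cell that meets \<open>K\<close>. The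
  chosen points miss \<open>S\<close> and each disc sees at most one of them, so every set of such
  points is closed. They form a closed discrete subset of a compact set, which is finite.\<close>

lemma finite_cells_meeting_compact:
  assumes K: "compactin Y K"
  shows "finite {i \<in> I. \<Phi> i ` open_disc_set n \<inter> K \<noteq> {}}" (is "finite ?J")
proof -
  have "\<forall>i\<in>?J. \<exists>x. x \<in> open_disc_set n \<and> \<Phi> i x \<in> K" by auto
  then obtain b where "\<forall>i\<in>?J. b i \<in> open_disc_set n \<and> \<Phi> i (b i) \<in> K"
    by (rule bchoice[THEN exE])
  then have b: "b i \<in> open_disc_set n \<and> \<Phi> i (b i) \<in> K" if "i \<in> ?J" for i
    using that by (rule bspec)
  define P where "P = (\<lambda>i. \<Phi> i (b i)) ` ?J"
  have cl: "closedin Y T" if T: "T \<subseteq> P" for T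
  proof (rule attaching_weak)
    have "P \<inter> S = {}"
    proof -
      have "\<Phi> i (b i) \<notin> S" if "i \<in> ?J" for i
        using b[OF that] attaching_map(4)[of i] that by blast
      then show ?thesis unfolding P_def by blast
    qed
    then have "T \<inter> S = {}" using T by blast
    then show "closedin Y (T \<inter> S)" by simp
    have "P \<subseteq> topspace Y"
    proof -
      have "\<Phi> i (b i) \<in> topspace Y" if "i \<in> ?J" for i
        using compactin_subset_topspace[OF K] b[OF that] by blast
      then show ?thesis unfolding P_def by blast
    qed
    then show "T \<subseteq> topspace Y" using T by blast
    show "closedin (closed_disc n) {x \<in> topspace (closed_disc n). \<Phi> i x \<in> T}" if i: "i \<in> I" for i
    proof -
      have "x = b i" if x: "x \<in> topspace (closed_disc n)" "\<Phi> i x \<in> T" for x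
      proof -
        obtain j where j: "j \<in> ?J" "\<Phi> i x = \<Phi> j (b j)" using x(2) T unfolding P_def by blast
        then have nS: "\<Phi> i x \<notin> S" using b[OF j(1)] attaching_map(4)[of j] by auto
        show ?thesis
          using i x(1)
        proof (cases rule: attaching_disc_cases)
          case interior
          then have "i = j" using j b[OF j(1)] attaching_disjoint[OF i, of j] by auto
          then show ?thesis using j interior b[OF j(1)] attaching_map(3)[OF i] by (auto dest: inj_onD)
        qed (use nS in simp)
      qed
      then have "{x \<in> topspace (closed_disc n). \<Phi> i x \<in> T} \<subseteq> {b i}" by blast
      then have "finite {x \<in> topspace (closed_disc n). \<Phi> i x \<in> T}" using finite_subset by blast
      then show ?thesis
        using Hausdorff_space_closed_disc by (intro closedin_Hausdorff_finite) auto
    qed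
  qed
  have PK: "P \<subseteq> K" using b by (auto simp: P_def)
  have "subtopology Y P = discrete_topology P"
  proof -
    have "openin (subtopology Y P) {x}" if "x \<in> P" for x
    proof -
      have "closedin (subtopology Y P) (P - {x})" by (rule closedin_subset_topspace) (use cl in auto)
      moreover have "topspace (subtopology Y P) = P" using cl closedin_subset by fastforce
      ultimately show ?thesis using that by (simp add: openin_closedin Diff_Diff_Int Int_absorb1 openin_closedin_eq)
    qed
    moreover have "topspace (subtopology Y P) = P" using cl closedin_subset by fastforce
    ultimately show ?thesis by (metis discrete_topology_unique)
  qed
  moreover have "compactin Y P" using closed_compactin[OF K PK] cl by blast
  ultimately have "finite P" using compact_space_discrete_topology compact_space_subtopology by metis
  moreover have "inj_on (\<lambda>i. \<Phi> i (b i)) ?J"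
  proof (rule inj_onI)
    fix i j assume ij: "i \<in> ?J" "j \<in> ?J" "\<Phi> i (b i) = \<Phi> j (b j)"
    then have "\<Phi> i (b i) \<in> \<Phi> i ` open_disc_set n \<inter> \<Phi> j ` open_disc_set n"
      using b[OF ij(1)] b[OF ij(2)] ij(3) by (metis IntI imageI)
    then show "i = j" using attaching_disjoint[of i j] ij by blast
  qed
  ultimately show ?thesis unfolding P_def by (rule finite_imageD)
qed

text \<open>A relative cycle involves finitely many singular simplices, and their images are
  compact, so they meet only finitely many open cells.\<close>

lemma attaching_finite_support:
  assumes c: "c \<in> carrier (relative_homology_group (int p) Y S)"
  obtains J where "finite J" "J \<subseteq> I"
    "c \<in> hom_induced p (subtopology Y (S \<union> (\<Union>i\<in>J. \<Phi> i ` open_disc_set n))) S Y S id `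
        carrier (relative_homology_group p (subtopology Y (S \<union> (\<Union>i\<in>J. \<Phi> i ` open_disc_set n))) S)"
proof -
  obtain z where z: "singular_relcycle p Y S z" "c = homologous_rel_set p Y S z"
    using c by (auto simp: carrier_relative_homology_group)
  define K where "K = (\<Union>f\<in>Poly_Mapping.keys z. f ` standard_simplex p)"
  define J where "J = {i \<in> I. \<Phi> i ` open_disc_set n \<inter> K \<noteq> {}}"
  define Z where "Z = S \<union> (\<Union>i\<in>J. \<Phi> i ` open_disc_set n)"
  have zc: "singular_chain p Y z" "singular_chain (p - 1) (subtopology Y S) (chain_boundary p z)"
    using z by (auto simp: singular_relcycle)
  have Kf: "compactin Y (f ` standard_simplex p)" if "f \<in> Poly_Mapping.keys z" for f
  proof -
    have "continuous_map (subtopology (powertop_real UNIV) (standard_simplex p)) Y f"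
      using that zc by (auto simp: singular_chain_def singular_simplex_def)
    moreover have "compactin (subtopology (powertop_real UNIV) (standard_simplex p)) (standard_simplex p)"
      by (simp add: compactin_subtopology compactin_standard_simplex)
    ultimately show ?thesis using image_compactin by blast
  qed
  then have "compactin Y K" unfolding K_def by (intro compactin_Union) auto
  then have J: "finite J" unfolding J_def by (rule finite_cells_meeting_compact)
  have "K \<subseteq> Z"
    using compactin_subset_topspace[OF \<open>compactin Y K\<close>] attaching_cover by (auto simp: Z_def J_def)
  then have "singular_chain p (subtopology Y Z) z"
    using zc by (auto simp: singular_chain_subtopology K_def)
  moreover have "subtopology (subtopology Y Z) S = subtopology Y S"
    by (simp add: subtopology_subtopology Z_def Int_absorb1)
  ultimately have zZ: "singular_relcycle p (subtopology Y Z) S z"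
    using zc by (simp add: singular_relcycle)
  have "hom_induced p (subtopology Y Z) S Y S id (homologous_rel_set p (subtopology Y Z) S z) = c"
    using zZ z by (subst hom_induced_chain_map) (auto simp: chain_map_id_gen[OF zc(1)])
  then have "c \<in> hom_induced p (subtopology Y Z) S Y S id ` carrier (relative_homology_group p (subtopology Y Z) S)"
    using zZ by (force simp: carrier_relative_homology_group)
  then show thesis using J that[of J] by (auto simp: Z_def J_def)
qed

text \<open>Induction over a finite set of cells. In the exact sequence of the triple formed by a
  subspace with one more cell, the subspace without it, and \<open>S\<close>, a class agrees with a
  disc class modulo the smaller subspace, and their difference comes from there. An arbitrary
  subgroup \<open>H\<close> of the homology of the whole pair lets every stage be compared inside
  one group.\<close>

lemma attaching_generate:
  assumes H: "subgroup H (relative_homology_group (int p) Y S)"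
    and cells: "\<And>i d. \<lbrakk>i \<in> I; d \<in> carrier (relative_homology_group p (closed_disc n) (boundary_sphere_set n))\<rbrakk>
        \<Longrightarrow> hom_induced p (closed_disc n) (boundary_sphere_set n) Y S (\<Phi> i) d \<in> H"
  shows "carrier (relative_homology_group p Y S) \<subseteq> H"
proof -
  let ?Z = "\<lambda>J. S \<union> (\<Union>i\<in>J. \<Phi> i ` open_disc_set n)"
  let ?D = "closed_disc n" and ?B = "boundary_sphere_set n"
  have "hom_induced p (subtopology Y (?Z J)) S Y S id c \<in> H"
    if "finite J" "J \<subseteq> I" "c \<in> carrier (relative_homology_group p (subtopology Y (?Z J)) S)" for J c
    using that
  proof (induction J arbitrary: c rule: finite_induct)
    case empty
    \<comment> \<open>Without cells the pair is \<open>S\<close> relative to itself, so its homology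
      vanishes.\<close>
    have "trivial_group (relative_homology_group p (subtopology Y S) (topspace (subtopology Y S)))"
      by (rule trivial_relative_homology_group_topspace)
    then have c: "c = \<one>\<^bsub>relative_homology_group p (subtopology Y S) S\<^esub>"
      using empty attaching_base(2) by (simp add: trivial_group_def Int_absorb1)
    have "hom_induced p (subtopology Y S) S Y S id c = \<one>\<^bsub>relative_homology_group p Y S\<^esub>"
      unfolding c by (rule hom_one[OF hom_induced_hom]) simp_all
    then show ?case
      using subgroup.one_closed[OF H] by (simp only: image_empty Union_empty Un_empty_right)
  next
    case (insert i J)
    then have i: "i \<in> I" and J: "J \<subseteq> I" by auto
    let ?Y = "subtopology Y (?Z (insert i J))"
    have attY: "attaching ?Y S n (insert i J) \<Phi>"
      by (rule attaching_subset) (use insert in auto)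
    interpret Yg: group "relative_homology_group p ?Y S" by simp
    have top: "topspace ?Y = ?Z (insert i J)"
      using attaching_cover insert by auto
    have R: "topspace ?Y - \<Phi> i ` open_disc_set n = ?Z J"
      unfolding top using attaching_disjoint[OF i] attaching_map(4)[OF i] J insert by blast
    interpret cell: cell_attachment ?Y "?Z J" n "\<Phi> i"
      using Submission.attaching_cell[OF attY, of i] unfolding R by simp
    have "hom_induced p ?Y S ?Y (?Z J) id c \<in> carrier (relative_homology_group p ?Y (?Z J))"
      by (rule hom_induced_carrier)
    then obtain d where d: "d \<in> carrier (relative_homology_group p ?D ?B)"
      "hom_induced p ?Y S ?Y (?Z J) id c = hom_induced p ?D ?B ?Y (?Z J) (\<Phi> i) d"
      using cell.iso_attached_cell[of p] by (auto simp: iso_def bij_betw_def)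
    let ?d = "hom_induced p ?D ?B ?Y S (\<Phi> i) d"
    have dc: "?d \<in> carrier (relative_homology_group p ?Y S)" by (rule hom_induced_carrier)
    have comp: "hom_induced p ?Y S ?Y (?Z J) id ?d = hom_induced p ?D ?B ?Y (?Z J) (\<Phi> i) d"
      using cell.cont attaching_map(2)[OF i] by (subst hom_induced_compose') auto
    have sub: "subtopology ?Y (?Z J) = subtopology Y (?Z J)"
      by (simp add: subtopology_subtopology Int_absorb1 subset_iff)
    show ?case
    \<comment> \<open>The kernel is described by exactness of the triple, the disc class lies in
      \<open>H\<close> by hypothesis, and classes from the smaller subspace lie in \<open>H\<close>
      by induction.\<close>
    proof (rule hom_mem_of_kernel[OF _ _ _ hom_induced_hom hom_induced_hom insert.prems(2) dc _ _ H])
      show "hom_induced p ?Y S ?Y (?Z J) id c = hom_induced p ?Y S ?Y (?Z J) id ?d"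
        using d(2) comp by simp
      show "kernel (relative_homology_group p ?Y S) (relative_homology_group p ?Y (?Z J)) (hom_induced p ?Y S ?Y (?Z J) id)
          = hom_induced p (subtopology Y (?Z J)) S ?Y S id ` carrier (relative_homology_group p (subtopology Y (?Z J)) S)"
        using homology_exactness_triple_3[of S "?Z J" p ?Y] unfolding sub exact_seq_cons_iff by simp
      have "hom_induced p ?Y S Y S id ?d = hom_induced p ?D ?B Y S (\<Phi> i) d"
        using cell.cont attaching_map(2)[OF i]
        by (subst hom_induced_compose') (auto simp: continuous_map_from_subtopology)
      then show "hom_induced p ?Y S Y S id ?d \<in> H" using cells[OF i d(1)] by simp
      show "hom_induced p ?Y S Y S id (hom_induced p (subtopology Y (?Z J)) S ?Y S id x) \<in> H"
        if "x \<in> carrier (relative_homology_group p (subtopology Y (?Z J)) S)" for x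
      proof -
        have "continuous_map (subtopology Y (?Z J)) ?Y id"
          by (auto simp: continuous_map_in_subtopology continuous_map_from_subtopology)
        then have "hom_induced p ?Y S Y S id (hom_induced p (subtopology Y (?Z J)) S ?Y S id x)
            = hom_induced p (subtopology Y (?Z J)) S Y S id x"
          by (subst hom_induced_compose') (auto simp: continuous_map_from_subtopology)
        then show ?thesis using insert.IH[OF J that] by (simp only:)
      qed
    qed (rule group_relative_homology_group)+
  qed
  then show ?thesis by (auto elim!: attaching_finite_support)
qed

text \<open>A cell other than \<open>i\<close> is mapped entirely into \<open>R\<close>, so its
  class factors through the trivial homology of \<open>R\<close> relative to itself. Passing from
  \<open>S\<close> to \<open>R\<close> therefore isolates the contribution of the cell
  \<open>i\<close>.\<close>

lemma attaching_project:
  assumes i: "i \<in> I" and j: "j \<in> I"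
    and d: "d \<in> carrier (relative_homology_group p (closed_disc n) (boundary_sphere_set n))"
  defines "R \<equiv> topspace Y - \<Phi> i ` open_disc_set n"
  shows "hom_induced p Y S Y R id (hom_induced p (closed_disc n) (boundary_sphere_set n) Y S (\<Phi> j) d)
    = (if j = i then hom_induced p (closed_disc n) (boundary_sphere_set n) Y R (\<Phi> i) d
       else \<one>\<^bsub>relative_homology_group p Y R\<^esub>)"
proof -
  have SR: "S \<subseteq> R" using attaching_base attaching_map(4)[OF i] by (auto simp: R_def)
  have comp: "hom_induced p Y S Y R id (hom_induced p (closed_disc n) (boundary_sphere_set n) Y S (\<Phi> j) d)
     = hom_induced p (closed_disc n) (boundary_sphere_set n) Y R (\<Phi> j) d"
    using attaching_map[OF j] SR by (subst hom_induced_compose') auto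
  show ?thesis
  proof (cases "j = i")
    case False
    have "\<Phi> j x \<in> R" if "x \<in> topspace (closed_disc n)" for x
      using j that
    proof (cases rule: attaching_disc_cases)
      case interior
      then show ?thesis using attaching_map(5)[OF j] attaching_disjoint[OF i j] False that by (auto simp: R_def)
    qed (use SR in auto)
    then have c: "continuous_map (closed_disc n) (subtopology Y R) (\<Phi> j)"
      using attaching_map(1)[OF j] by (auto simp: continuous_map_in_subtopology)
    have "hom_induced p (closed_disc n) (boundary_sphere_set n) Y R (\<Phi> j) d
      = hom_induced p (subtopology Y R) R Y R id (hom_induced p (closed_disc n) (boundary_sphere_set n) (subtopology Y R) R (\<Phi> j) d)"
      using c attaching_map(2)[OF j] SR
      by (subst hom_induced_compose') (auto simp: continuous_map_from_subtopology)
    also have "hom_induced p (closed_disc n) (boundary_sphere_set n) (subtopology Y R) R (\<Phi> j) d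
      = \<one>\<^bsub>relative_homology_group p (subtopology Y R) R\<^esub>"
    proof -
      have "topspace (subtopology Y R) = R" by (auto simp: R_def)
      then have "trivial_group (relative_homology_group p (subtopology Y R) R)"
        using trivial_relative_homology_group_topspace[of p "subtopology Y R"] by simp
      then show ?thesis using hom_induced_carrier by (fastforce simp: trivial_group_def)
    qed
    also have "hom_induced p (subtopology Y R) R Y R id \<one>\<^bsub>relative_homology_group p (subtopology Y R) R\<^esub>
      = \<one>\<^bsub>relative_homology_group p Y R\<^esub>"
      by (rule hom_one[OF hom_induced_hom]) auto
    finally show ?thesis using False comp by simp
  qed (use comp in simp)
qed

text \<open>Surjectivity is \<open>attaching_generate\<close> for the image of \<open>h\<close>. For
  injectivity, homology modulo the complement of the cell \<open>i\<close> is infinite cyclic, and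
  \<open>h c\<close> becomes there the power of a generator whose exponent is the coefficient of
  \<open>c\<close> at \<open>i\<close>.\<close>

theorem attaching_free_basis:
  assumes h: "h \<in> hom (free_Abelian_group I) (relative_homology_group p Y S)"
    and hu: "\<And>i. i \<in> I \<Longrightarrow> h (frag_of i) = hom_induced p (closed_disc n) (boundary_sphere_set n) Y S (\<Phi> i) u"
    and p: "p = int n"
    and uD: "u \<in> carrier (relative_homology_group p (closed_disc n) (boundary_sphere_set n))"
    and u: "pow (relative_homology_group p (closed_disc n) (boundary_sphere_set n)) u
       \<in> iso integer_group (relative_homology_group p (closed_disc n) (boundary_sphere_set n))"
  shows "h \<in> iso (free_Abelian_group I) (relative_homology_group p Y S)"
proof -
  let ?D = "relative_homology_group p (closed_disc n) (boundary_sphere_set n)"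
  let ?H = "relative_homology_group p Y S"
  let ?F = "\<lambda>i. hom_induced p (closed_disc n) (boundary_sphere_set n) Y S (\<Phi> i)"
  interpret D: group ?D by simp
  interpret hh: group_hom "free_Abelian_group I" ?H h
    by (intro group_hom.intro group_hom_axioms.intro h) simp_all
  have gen: "\<exists>z::int. d = u [^]\<^bsub>?D\<^esub> z" if "d \<in> carrier ?D" for d
    using u that by (auto simp: iso_def bij_betw_def)
  have indep: "z = 0" if "u [^]\<^bsub>?D\<^esub> (z::int) = \<one>\<^bsub>?D\<^esub>" for z
  proof -
    have "inj (pow ?D u :: int \<Rightarrow> _)" using u by (simp add: iso_def bij_betw_def)
    moreover have "u [^]\<^bsub>?D\<^esub> z = u [^]\<^bsub>?D\<^esub> (0::int)" using that by simp
    ultimately show ?thesis by (rule injD)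
  qed
  have "carrier ?H \<subseteq> h ` carrier (free_Abelian_group I)"
    unfolding p
  proof (rule attaching_generate)
    show "subgroup (h ` carrier (free_Abelian_group I)) (relative_homology_group (int n) Y S)"
      using hh.img_is_subgroup p by simp
    fix i d
    assume i: "i \<in> I" and "d \<in> carrier (relative_homology_group (int n) (closed_disc n) (boundary_sphere_set n))"
    then obtain z :: int where z: "d = u [^]\<^bsub>?D\<^esub> z" using gen p by blast
    interpret Fi: group_hom ?D ?H "?F i"
      by (intro group_hom.intro group_hom_axioms.intro group_relative_homology_group hom_induced_hom)
    have "?F i d = h (frag_of i) [^]\<^bsub>?H\<^esub> z" using z Fi.hom_int_pow[OF uD] hu[OF i] by simp
    also have "\<dots> = h (frag_of i [^]\<^bsub>free_Abelian_group I\<^esub> z)"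
      by (rule hh.hom_int_pow[symmetric]) (use i in simp)
    finally have "?F i d = h (frag_of i [^]\<^bsub>free_Abelian_group I\<^esub> z)" .
    moreover have "frag_of i [^]\<^bsub>free_Abelian_group I\<^esub> z \<in> carrier (free_Abelian_group I)"
      using i by (intro group.int_pow_closed) simp_all
    ultimately show "hom_induced (int n) (closed_disc n) (boundary_sphere_set n) Y S (\<Phi> i) d \<in> h ` carrier (free_Abelian_group I)"
      unfolding p by blast
  qed
  moreover have "c = 0" if c: "c \<in> carrier (free_Abelian_group I)" "h c = \<one>\<^bsub>?H\<^esub>" for c
  proof -
    have "Poly_Mapping.lookup c i = 0" for i
    proof (cases "i \<in> I")
      case i: True
      define R where "R = topspace Y - \<Phi> i ` open_disc_set n"
      interpret cell: cell_attachment Y R n "\<Phi> i"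
        unfolding R_def by (rule attaching_cell) (rule i)
      let ?R = "relative_homology_group p Y R"
      interpret P: group_hom ?H ?R "hom_induced p Y S Y R id"
        by (intro group_hom.intro group_hom_axioms.intro group_relative_homology_group hom_induced_hom)
      let ?f = "hom_induced p (closed_disc n) (boundary_sphere_set n) Y R (\<Phi> i)"
      interpret f: group_hom ?D ?R ?f
        by (intro group_hom.intro group_hom_axioms.intro group_relative_homology_group hom_induced_hom)
      let ?g = "hom_induced p Y S Y R id \<circ> h"
      have gj: "?g (frag_of j) = (if j = i then ?f u else \<one>\<^bsub>?R\<^esub>)" if "j \<in> I" for j
        using attaching_project[OF i that uD] hu[OF that] by (simp only: o_apply R_def)
      have "?g \<in> hom (free_Abelian_group I) ?R"
        using h hom_induced_hom by (rule hom_compose)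
      then have "?g c = ?g (frag_of i) [^]\<^bsub>?R\<^esub> Poly_Mapping.lookup c i"
        by (rule hom_free_Abelian_group_coeff[OF group_relative_homology_group])
           (use gj i c(1) in \<open>simp_all only: carrier_free_Abelian_group_iff if_False\<close>)
      then have "hom_induced p Y S Y R id (h c) = ?f u [^]\<^bsub>?R\<^esub> Poly_Mapping.lookup c i"
        using gj[OF i] by (simp only: o_apply if_True simp_thms)
      moreover have "hom_induced p Y S Y R id (h c) = \<one>\<^bsub>?R\<^esub>"
        unfolding c(2) by (rule P.hom_one)
      ultimately have "?f u [^]\<^bsub>?R\<^esub> Poly_Mapping.lookup c i = \<one>\<^bsub>?R\<^esub>" by simp
      then have "?f (u [^]\<^bsub>?D\<^esub> Poly_Mapping.lookup c i) = \<one>\<^bsub>?R\<^esub>"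
        using f.hom_int_pow[OF uD] by simp
      then have "u [^]\<^bsub>?D\<^esub> Poly_Mapping.lookup c i = \<one>\<^bsub>?D\<^esub>"
        using cell.iso_attached_cell[of p] f.hom_one uD
        by (metis (no_types, lifting) D.int_pow_closed D.one_closed bij_betw_imp_inj_on inj_onD iso_def mem_Collect_eq)
      then show ?thesis using indep by blast
    qed (use c in \<open>auto simp: in_keys_iff\<close>)
    then show ?thesis by (simp add: poly_mapping_eqI)
  qed
  then have "inj_on h (carrier (free_Abelian_group I))"
    using hh.inj_on_one_iff by simp
  ultimately show ?thesis
    using h hh.hom_closed by (auto simp: iso_def bij_betw_def)
qed

end

section \<open>Skeleta of CW-complexes\<close>

text \<open>A point of the closed disc is the limit at \<open>t = 1\<close> of its radial segment,
  whose points with \<open>t < 1\<close> lie in the open disc.\<close>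

lemma closed_disc_closure_of_open_disc: "topspace (closed_disc n) \<subseteq> closed_disc n closure_of open_disc_set n"
proof
  fix x assume x: "x \<in> topspace (closed_disc n)"
  let ?p = "\<lambda>t i. t * x i"
  have norm: "(\<Sum>i<n. (?p t i)\<^sup>2) = t\<^sup>2 * (\<Sum>i<n. (x i)\<^sup>2)" for t
    by (simp add: power_mult_distrib sum_distrib_left)
  have le: "(\<Sum>i<n. (x i)\<^sup>2) \<le> 1" using x by (simp add: topspace_closed_disc)
  have le': "(\<Sum>i<n. (?p t i)\<^sup>2) \<le> t\<^sup>2" for t
    unfolding norm using mult_left_mono[OF le, of "t\<^sup>2"] by simp
  have "continuous_on {0..1} ?p"
    by (intro continuous_on_coordinatewise_then_product continuous_intros)
  moreover have "?p t \<in> topspace (closed_disc n)" if "t \<in> {0..1}" for t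
    using le'[of t] that x power_le_one[of t 2] by (auto simp: topspace_closed_disc simp del: power_mult_distrib)
  ultimately have cont: "continuous_map (top_of_set {0..1}) (closed_disc n) ?p"
    unfolding closed_disc_eq_top_of_set by auto
  have "(1::real) \<in> closure {0..<1}" by (simp add: closure_atLeastLessThan)
  then have "(1::real) \<in> top_of_set {0..1} closure_of {0..<1}"
    by (simp add: closure_of_subtopology Int_absorb1 subset_iff)
  then have "?p 1 \<in> closed_disc n closure_of (?p ` {0..<1})"
    using continuous_map_image_closure_subset[OF cont, of "{0..<1}"] by blast
  moreover have "?p ` {0..<1} \<subseteq> open_disc_set n"
  proof clarify
    fix t :: real assume t: "t \<in> {0..<1}"
    then have "t\<^sup>2 < 1" by (auto simp: power_less_one_iff abs_square_less_1)
    then have "(\<Sum>i<n. (?p t i)\<^sup>2) < 1" using le'[of t] by linarith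
    then show "?p t \<in> open_disc_set n" using x by (auto simp: open_disc_set_eq topspace_closed_disc)
  qed
  ultimately show "x \<in> closed_disc n closure_of open_disc_set n"
    using closure_of_mono by (metis (no_types, lifting) ext mult_1 subsetD)
qed

text \<open>By density of the open disc. It extends equivariance from open cells to closed discs,
  and thus to the attaching spheres.\<close>

lemma disc_maps_eqI:
  assumes "continuous_map (closed_disc n) X f" "continuous_map (closed_disc n) X g" "Hausdorff_space X"
    and "\<And>x. x \<in> open_disc_set n \<Longrightarrow> f x = g x" and "x \<in> topspace (closed_disc n)"
  shows "f x = g x"
  using forall_in_closure_of_eq[OF _ assms(3,1,2,4)] closed_disc_closure_of_open_disc assms(5) by blast

text \<open>A form of \<open>characteristic_map\<close> in which the homeomorphism with the open
  cell is weakened to injectivity with image \<open>e\<close>; the topology is recovered from the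
  weak topology of the skeleton. This form passes easily to translates under the action.\<close>

definition cell_parametrization ::
  "'a topology \<Rightarrow> (nat \<Rightarrow> 'a set set) \<Rightarrow> nat \<Rightarrow> 'a set \<Rightarrow> ((nat \<Rightarrow> real) \<Rightarrow> 'a) \<Rightarrow> bool" where
  "cell_parametrization X E n e \<Phi> \<longleftrightarrow>
     continuous_map (closed_disc n) X \<Phi> \<and> inj_on \<Phi> (open_disc_set n) \<and> \<Phi> ` open_disc_set n = e \<and>
     (\<exists>F. finite F \<and> F \<subseteq> (\<Union>k<n. E k) \<and> \<Phi> ` boundary_sphere_set n \<subseteq> \<Union>F)"

lemma characteristic_map_imp_parametrization:
  assumes "characteristic_map X E n e \<Phi>" "e \<subseteq> topspace X"
  shows "cell_parametrization X E n e \<Phi>"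
proof -
  have h: "homeomorphic_map (subtopology (Euclidean_space n) (open_disc_set n)) (subtopology X e) \<Phi>"
    using assms by (simp add: characteristic_map_def)
  have "topspace (subtopology (Euclidean_space n) (open_disc_set n)) = open_disc_set n"
    by (auto simp: open_disc_set_def)
  moreover have "topspace (subtopology X e) = e" using assms by auto
  ultimately have "\<Phi> ` open_disc_set n = e" "inj_on \<Phi> (open_disc_set n)"
    using h unfolding homeomorphic_eq_everything_map by auto
  then show ?thesis using assms by (simp add: characteristic_map_def cell_parametrization_def)
qed

lemma in_skeleton: "x \<in> skeleton E z \<longleftrightarrow> (\<exists>k e. int k \<le> z \<and> e \<in> E k \<and> x \<in> e)"
  by (auto simp: skeleton_def)

lemma skeleton_mono: "z \<le> w \<Longrightarrow> skeleton E z \<subseteq> skeleton E w"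
  unfolding in_skeleton subset_iff by (meson order_trans)

lemma skeleton_step: "skeleton E (int n) = skeleton E (int n - 1) \<union> \<Union>(E n)"
proof (rule Set.set_eqI)
  fix x
  have "int k \<le> int n \<longleftrightarrow> int k \<le> int n - 1 \<or> k = n" for k by auto
  then show "x \<in> skeleton E (int n) \<longleftrightarrow> x \<in> skeleton E (int n - 1) \<union> \<Union>(E n)"
    unfolding Un_iff in_skeleton Union_iff by metis
qed

context
  fixes X :: "'a topology" and E
  assumes cw: "cw_complex X E"
begin

lemma cw_Hausdorff: "Hausdorff_space X"
  using cw by (simp add: cw_complex_def)

lemma cw_cell_subset: "e \<in> E n \<Longrightarrow> e \<subseteq> topspace X"
proof -
  have "(\<Union>n. \<Union>(E n)) = topspace X" using cw by (simp add: cw_complex_def)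
  then show "e \<in> E n \<Longrightarrow> e \<subseteq> topspace X" by blast
qed

lemma cw_cell_unique: "\<lbrakk>e \<in> E m; f \<in> E n; x \<in> e; x \<in> f\<rbrakk> \<Longrightarrow> m = n \<and> e = f"
proof -
  have "\<forall>m n. \<forall>e\<in>E m. \<forall>f\<in>E n. (m, e) \<noteq> (n, f) \<longrightarrow> e \<inter> f = {}" using cw by (simp add: cw_complex_def)
  then show "\<lbrakk>e \<in> E m; f \<in> E n; x \<in> e; x \<in> f\<rbrakk> \<Longrightarrow> m = n \<and> e = f" by blast
qed

lemma cw_closedin:
  "\<lbrakk>A \<subseteq> topspace X; \<And>n e. e \<in> E n \<Longrightarrow> closedin X (A \<inter> (X closure_of e))\<rbrakk> \<Longrightarrow> closedin X A"
  using cw by (simp add: cw_complex_def)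

lemma cw_parametrization: "e \<in> E n \<Longrightarrow> \<exists>\<Phi>. cell_parametrization X E n e \<Phi>"
  using cw characteristic_map_imp_parametrization cw_cell_subset unfolding cw_complex_def by meson

lemma skeleton_subset_topspace: "skeleton E z \<subseteq> topspace X"
  using cw_cell_subset by (auto simp: skeleton_def)

lemma cell_disjoint_skeleton: "\<lbrakk>e \<in> E n; z < int n\<rbrakk> \<Longrightarrow> e \<inter> skeleton E z = {}"
  using cw_cell_unique by (fastforce simp: in_skeleton)

text \<open>The image of the compact disc is compact, hence closed in the Hausdorff space
  \<open>X\<close>.\<close>

lemma cell_closure:
  assumes e: "e \<in> E n" and \<Phi>: "cell_parametrization X E n e \<Phi>"
  shows "(X closure_of e) \<subseteq> \<Phi> ` topspace (closed_disc n)"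
proof (rule closure_of_minimal)
  show "e \<subseteq> \<Phi> ` topspace (closed_disc n)"
    using \<Phi> open_disc_Un_boundary[of n] by (auto simp: cell_parametrization_def)
  have "compactin X (\<Phi> ` topspace (closed_disc n))"
    using \<Phi> compact_space_closed_disc[of n] unfolding cell_parametrization_def compact_space_def
    by (metis image_compactin)
  then show "closedin X (\<Phi> ` topspace (closed_disc n))"
    using cw_Hausdorff compactin_imp_closedin by blast
qed

lemma parametrization_disc_image:
  assumes "cell_parametrization X E n e \<Phi>"
  obtains F where "finite F" "F \<subseteq> (\<Union>k<n. E k)" "\<Phi> ` topspace (closed_disc n) \<subseteq> e \<union> \<Union>F"
proof -
  obtain F where F: "finite F" "F \<subseteq> (\<Union>k<n. E k)" "\<Phi> ` boundary_sphere_set n \<subseteq> \<Union>F" "\<Phi> ` open_disc_set n = e"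
    using assms by (auto simp: cell_parametrization_def)
  have "\<Phi> ` topspace (closed_disc n) \<subseteq> e \<union> \<Union>F"
    unfolding open_disc_Un_boundary image_Un using F by blast
  then show thesis using that F by blast
qed

lemma parametrization_boundary:
  assumes "cell_parametrization X E n e \<Phi>"
  shows "\<Phi> ` boundary_sphere_set n \<subseteq> skeleton E (int n - 1)"
proof -
  obtain F where F: "F \<subseteq> (\<Union>k<n. E k)" "\<Phi> ` boundary_sphere_set n \<subseteq> \<Union>F"
    using assms by (auto simp: cell_parametrization_def)
  have "\<Union>F \<subseteq> skeleton E (int n - 1)"
  proof
    fix x assume "x \<in> \<Union>F"
    then obtain f where f: "f \<in> F" "x \<in> f" by blast
    then obtain k where "k < n" "f \<in> E k" using F(1) by blast
    then show "x \<in> skeleton E (int n - 1)"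
      using f unfolding in_skeleton by (intro exI[of _ k] exI[of _ f]) simp
  qed
  then show ?thesis by (rule order_trans[OF F(2)])
qed

lemma cell_closure_subset_skeleton:
  assumes "e \<in> E n" "int n \<le> z"
  shows "(X closure_of e) \<subseteq> skeleton E z"
proof -
  obtain \<Phi> where \<Phi>: "cell_parametrization X E n e \<Phi>" using cw_parametrization[OF assms(1)] by blast
  have "\<Phi> ` open_disc_set n = e" using \<Phi> by (simp add: cell_parametrization_def)
  then have "\<Phi> ` topspace (closed_disc n) \<subseteq> skeleton E (int n)"
    unfolding open_disc_Un_boundary image_Un skeleton_step
    by (intro Un_least le_supI1[OF parametrization_boundary[OF \<Phi>]] le_supI2) (use assms(1) in auto)
  then show ?thesis
    by (rule order_trans[OF order_trans[OF cell_closure[OF assms(1) \<Phi>]] skeleton_mono[OF assms(2)]])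
qed

text \<open>Descent on the dimension: a cell above dimension \<open>z\<close> misses the skeleton,
  and its boundary meets only finitely many cells of smaller dimension, to which the statement
  applies. As a result, closed subsets of a skeleton can be tested on the cells of that skeleton
  alone.\<close>

lemma cell_closure_Int_skeleton:
  assumes "e \<in> E n"
  shows "\<exists>K. finite K \<and> (\<forall>f\<in>K. \<exists>j. int j \<le> z \<and> f \<in> E j) \<and> (X closure_of e) \<inter> skeleton E z \<subseteq> (\<Union>f\<in>K. (X closure_of f))"
  using assms
proof (induction n arbitrary: e rule: less_induct)
  case (less n)
  show ?case
  proof (cases "int n \<le> z")
    case True
    then show ?thesis by (intro exI[of _ "{e}"]) (use less.prems in auto)
  next
    case False
    obtain \<Phi> where \<Phi>: "cell_parametrization X E n e \<Phi>" using cw_parametrization less.prems by blast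
    obtain F where F: "finite F" "F \<subseteq> (\<Union>k<n. E k)" "\<Phi> ` topspace (closed_disc n) \<subseteq> e \<union> \<Union>F"
      using parametrization_disc_image[OF \<Phi>] by blast
    have "\<forall>f\<in>F. \<exists>K. finite K \<and> (\<forall>f\<in>K. \<exists>j. int j \<le> z \<and> f \<in> E j) \<and> (X closure_of f) \<inter> skeleton E z \<subseteq> (\<Union>f\<in>K. (X closure_of f))"
    proof
      fix f assume "f \<in> F"
      then obtain k where "k < n" "f \<in> E k" using F(2) by blast
      then show "\<exists>K. finite K \<and> (\<forall>f\<in>K. \<exists>j. int j \<le> z \<and> f \<in> E j) \<and> (X closure_of f) \<inter> skeleton E z \<subseteq> (\<Union>f\<in>K. (X closure_of f))"
        by (rule less.IH)
    qed
    then obtain K where K: "\<forall>f\<in>F. finite (K f) \<and> (\<forall>g\<in>K f. \<exists>j. int j \<le> z \<and> g \<in> E j) \<and>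
        (X closure_of f) \<inter> skeleton E z \<subseteq> (\<Union>g\<in>K f. (X closure_of g))"
      by (rule bchoice[THEN exE])
    have sub: "(X closure_of e) \<inter> skeleton E z \<subseteq> (\<Union>f\<in>F. (X closure_of f) \<inter> skeleton E z)"
    proof
      fix x assume x: "x \<in> (X closure_of e) \<inter> skeleton E z"
      have "e \<inter> skeleton E z = {}" using cell_disjoint_skeleton[OF less.prems, of z] False by simp
      moreover have "x \<in> e \<union> \<Union>F"
        using subsetD[OF order_trans[OF cell_closure[OF less.prems \<Phi>] F(3)]] x by blast
      ultimately obtain f where f: "f \<in> F" "x \<in> f" using x by blast
      then obtain k where "f \<in> E k" using F(2) by blast
      then have "f \<subseteq> X closure_of f" by (intro closure_of_subset cw_cell_subset)
      then show "x \<in> (\<Union>f\<in>F. (X closure_of f) \<inter> skeleton E z)" using f x by blast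
    qed
    have "(X closure_of e) \<inter> skeleton E z \<subseteq> (\<Union>f\<in>\<Union>(K ` F). (X closure_of f))"
    proof
      fix x assume "x \<in> (X closure_of e) \<inter> skeleton E z"
      from subsetD[OF sub this] obtain f where f: "f \<in> F" "x \<in> (X closure_of f) \<inter> skeleton E z"
        by (rule UN_E)
      have "(X closure_of f) \<inter> skeleton E z \<subseteq> (\<Union>g\<in>K f. (X closure_of g))" using K f(1) by simp
      from subsetD[OF this f(2)] obtain g where "g \<in> K f" "x \<in> X closure_of g" by (rule UN_E)
      then show "x \<in> (\<Union>f\<in>\<Union>(K ` F). (X closure_of f))" using f(1) by blast
    qed
    moreover have "finite (\<Union>(K ` F))" using K F(1) by simp
    moreover have "\<forall>g\<in>\<Union>(K ` F). \<exists>j. int j \<le> z \<and> g \<in> E j" using K by blast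
    ultimately show ?thesis by (intro exI[of _ "\<Union>(K ` F)"] conjI)
  qed
qed

lemma closedin_in_skeleton:
  assumes A: "A \<subseteq> skeleton E z"
    and cl: "\<And>j f. \<lbrakk>int j \<le> z; f \<in> E j\<rbrakk> \<Longrightarrow> closedin X (A \<inter> (X closure_of f))"
  shows "closedin X A"
proof (rule cw_closedin)
  show "A \<subseteq> topspace X" using A skeleton_subset_topspace by blast
  fix n e assume e: "e \<in> E n"
  obtain K where K: "finite K" "\<forall>f\<in>K. \<exists>j. int j \<le> z \<and> f \<in> E j"
      "(X closure_of e) \<inter> skeleton E z \<subseteq> (\<Union>f\<in>K. (X closure_of f))"
    using cell_closure_Int_skeleton[OF e, of z] by auto
  \<comment> \<open>A finite union of closed sets by the descent above, cut down to the closure of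
    \<open>e\<close>.\<close>
  have "A \<inter> (X closure_of e) = (\<Union>f\<in>K. A \<inter> (X closure_of f)) \<inter> (X closure_of e)"
  proof (intro equalityI subsetI)
    fix x assume x: "x \<in> A \<inter> (X closure_of e)"
    then have "x \<in> (X closure_of e) \<inter> skeleton E z" using subsetD[OF A] by simp
    from subsetD[OF K(3) this] obtain f where "f \<in> K" "x \<in> X closure_of f" by (rule UN_E)
    then show "x \<in> (\<Union>f\<in>K. A \<inter> (X closure_of f)) \<inter> (X closure_of e)" using x by auto
  qed auto
  moreover have "closedin X (\<Union>f\<in>K. A \<inter> (X closure_of f))"
    by (rule closedin_Union) (use K cl in auto)
  ultimately show "closedin X (A \<inter> (X closure_of e))" by (simp add: closedin_Int)
qed

lemma closedin_skeleton: "closedin X (skeleton E z)"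
proof (rule closedin_in_skeleton)
  fix j f assume "int j \<le> z" "f \<in> E j"
  then have "skeleton E z \<inter> (X closure_of f) = (X closure_of f)" by (intro Int_absorb1 cell_closure_subset_skeleton)
  then show "closedin X (skeleton E z \<inter> (X closure_of f))" by simp
qed simp

lemma parametrization_into_skeleton:
  assumes "e \<in> E n" "cell_parametrization X E n e \<Phi>"
  shows "\<Phi> ` topspace (closed_disc n) \<subseteq> skeleton E (int n)"
    "continuous_map (closed_disc n) (subtopology X (skeleton E (int n))) \<Phi>"
proof -
  have "\<Phi> ` open_disc_set n = e" using assms by (simp add: cell_parametrization_def)
  then show *: "\<Phi> ` topspace (closed_disc n) \<subseteq> skeleton E (int n)"
    unfolding open_disc_Un_boundary image_Un skeleton_step
    by (intro Un_least le_supI1[OF parametrization_boundary[OF assms(2)]] le_supI2) (use assms(1) in auto)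
  have "continuous_map (closed_disc n) X \<Phi>" using assms by (simp add: cell_parametrization_def)
  then show "continuous_map (closed_disc n) (subtopology X (skeleton E (int n))) \<Phi>"
    using * by (simp add: continuous_map_in_subtopology image_subset_iff_funcset)
qed

text \<open>The weak topology of a skeleton in inductive form. Cells of smaller dimension only see
  the part of \<open>A\<close> in the previous skeleton. For an \<open>n\<close>-cell the part of
  \<open>A\<close> in its closure is controlled by the image of a closed, hence compact, subset of
  the disc.\<close>

lemma closedin_skeleton_step:
  assumes \<Phi>: "\<And>e. e \<in> E n \<Longrightarrow> cell_parametrization X E n e (\<Phi> e)"
    and A: "A \<subseteq> skeleton E (int n)" "closedin X (A \<inter> skeleton E (int n - 1))"
    and cells: "\<And>e. e \<in> E n \<Longrightarrow> closedin (closed_disc n) {x \<in> topspace (closed_disc n). \<Phi> e x \<in> A}"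
  shows "closedin X A"
proof (rule closedin_in_skeleton[OF A(1)])
  fix j f assume j: "int j \<le> int n" and f: "f \<in> E j"
  show "closedin X (A \<inter> (X closure_of f))"
  proof (cases "j = n")
    case True
    then have f: "f \<in> E n" using f by simp
    let ?D = "{x \<in> topspace (closed_disc n). \<Phi> f x \<in> A}"
    have cont: "continuous_map (closed_disc n) X (\<Phi> f)"
      using \<Phi>[OF f] by (simp add: cell_parametrization_def)
    have "compactin (closed_disc n) ?D"
      using closedin_compact_space[OF compact_space_closed_disc cells[OF f]] .
    then have "compactin X (\<Phi> f ` ?D)"
      using cont by (rule image_compactin)
    then have "closedin X (\<Phi> f ` ?D)" using cw_Hausdorff compactin_imp_closedin by blast
    \<comment> \<open>Only the inclusion of the closure in the image of the disc is at hand, so both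
      sides are intersected with the closure.\<close>
    moreover have "A \<inter> (X closure_of f) = \<Phi> f ` ?D \<inter> (X closure_of f)"
      using subsetD[OF cell_closure[OF f \<Phi>[OF f]]] by (intro equalityI subsetI) auto
    ultimately show ?thesis by (simp add: closedin_Int)
  next
    case False
    then have "(X closure_of f) \<subseteq> skeleton E (int n - 1)"
      using j by (intro cell_closure_subset_skeleton[OF f]) simp
    then have "A \<inter> (X closure_of f) = (A \<inter> skeleton E (int n - 1)) \<inter> (X closure_of f)" by blast
    then show ?thesis using A(2) by (simp add: closedin_Int)
  qed
qed

lemma cw_attaching:
  assumes \<Phi>: "\<And>e. e \<in> E n \<Longrightarrow> cell_parametrization X E n e (\<Phi> e)"
  shows "attaching (subtopology X (skeleton E (int n))) (skeleton E (int n - 1)) n (E n) \<Phi>"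
proof -
  let ?Y = "subtopology X (skeleton E (int n))" and ?S = "skeleton E (int n - 1)"
  have sub: "?S \<subseteq> skeleton E (int n)" by (rule skeleton_mono) simp
  have im: "\<Phi> e ` open_disc_set n = e" "inj_on (\<Phi> e) (open_disc_set n)" if "e \<in> E n" for e
    using \<Phi>[OF that] by (simp_all add: cell_parametrization_def)
  have 1: "closedin ?Y ?S" by (rule closedin_subset_topspace[OF closedin_skeleton sub])
  have 2: "continuous_map (closed_disc n) ?Y (\<Phi> e) \<and> \<Phi> e ` boundary_sphere_set n \<subseteq> ?S \<and>
        inj_on (\<Phi> e) (open_disc_set n) \<and> \<Phi> e ` open_disc_set n \<inter> ?S = {}" if "e \<in> E n" for e
    using parametrization_into_skeleton(2)[OF that \<Phi>[OF that]] parametrization_boundary[OF \<Phi>[OF that]]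
      im[OF that] cell_disjoint_skeleton[OF that, of "int n - 1"] by simp
  have 3: "\<Phi> e ` open_disc_set n \<inter> \<Phi> f ` open_disc_set n = {}" if "e \<in> E n" "f \<in> E n" "e \<noteq> f" for e f
    unfolding im(1)[OF that(1)] im(1)[OF that(2)] using cw_cell_unique[OF that(1,2)] that(3) by auto
  have "(\<Union>e\<in>E n. \<Phi> e ` open_disc_set n) = \<Union>(E n)" using im by simp
  then have 4: "topspace ?Y = ?S \<union> (\<Union>e\<in>E n. \<Phi> e ` open_disc_set n)"
    using skeleton_subset_topspace[of "int n"] skeleton_step[of E n] by auto
  have 5: "closedin ?Y A" if "A \<subseteq> topspace ?Y" "closedin ?Y (A \<inter> ?S)"
      "\<forall>e\<in>E n. closedin (closed_disc n) {x \<in> topspace (closed_disc n). \<Phi> e x \<in> A}" for A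
  proof -
    have AS: "closedin X (A \<inter> ?S)" by (rule closedin_trans_full[OF that(2) closedin_skeleton])
    have A: "A \<subseteq> skeleton E (int n)" using that(1) by simp
    have "closedin X A"
      using \<Phi> A AS that(3)[rule_format] by (rule closedin_skeleton_step[where \<Phi> = \<Phi> and n = n])
    then show ?thesis by (rule closedin_subset_topspace[OF _ A])
  qed
  show ?thesis unfolding attaching_def using 1 2 3 4 5 by simp
qed

end

section \<open>Orbit space and fixed points of a \<open>G\<close>-CW-complex\<close>

locale G_CW =
  fixes G :: "'g monoid" and \<phi> :: "'g \<Rightarrow> 'a \<Rightarrow> 'a" and X :: "'a topology" and E
  assumes gcw: "G_CW_complex G \<phi> X E"
begin

lemma finite_G: "finite (carrier G)" and cw: "cw_complex X E"
  and act: "group_action G (topspace X) \<phi>"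
  and continuous_act: "g \<in> carrier G \<Longrightarrow> continuous_map X X (\<phi> g)"
  and act_cell: "\<lbrakk>g \<in> carrier G; e \<in> E n\<rbrakk> \<Longrightarrow> \<phi> g ` e \<in> E n"
  and act_cell_fix: "\<lbrakk>g \<in> carrier G; e \<in> E n; \<phi> g ` e = e; x \<in> e\<rbrakk> \<Longrightarrow> \<phi> g x = x"
  using gcw by (simp_all add: G_CW_complex_def)

lemma group_G: "group G"
  using act group_action.group_hom group_hom.axioms(1) by blast

lemma G_closed: "\<lbrakk>g \<in> carrier G; h \<in> carrier G\<rbrakk> \<Longrightarrow> g \<otimes>\<^bsub>G\<^esub> h \<in> carrier G" "\<one>\<^bsub>G\<^esub> \<in> carrier G"
    "g \<in> carrier G \<Longrightarrow> inv\<^bsub>G\<^esub> g \<in> carrier G"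
  using group_G by (simp_all add: group.is_monoid monoid.m_closed monoid.one_closed)

lemma act_in: "\<lbrakk>g \<in> carrier G; x \<in> topspace X\<rbrakk> \<Longrightarrow> \<phi> g x \<in> topspace X"
  using group_action.element_image[OF act] by blast

lemma act_mult: "\<lbrakk>x \<in> topspace X; g \<in> carrier G; h \<in> carrier G\<rbrakk> \<Longrightarrow> \<phi> (g \<otimes>\<^bsub>G\<^esub> h) x = \<phi> g (\<phi> h x)"
  using group_action.composition_rule[OF act] by blast

lemma act_one: "x \<in> topspace X \<Longrightarrow> \<phi> \<one>\<^bsub>G\<^esub> x = x"
  using group_action.id_eq_one[OF act] by (metis restrict_apply')

lemma act_inv: "\<lbrakk>g \<in> carrier G; x \<in> topspace X\<rbrakk> \<Longrightarrow> \<phi> (inv\<^bsub>G\<^esub> g) (\<phi> g x) = x"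
  using group_action.orbit_sym_aux[OF act] by blast

lemma act_inv': "\<lbrakk>g \<in> carrier G; x \<in> topspace X\<rbrakk> \<Longrightarrow> \<phi> g (\<phi> (inv\<^bsub>G\<^esub> g) x) = x"
  using act_inv[of "inv\<^bsub>G\<^esub> g" x] group.inv_closed[OF group_G] group.inv_inv[OF group_G] by simp

lemma act_image_mult:
  "\<lbrakk>e \<subseteq> topspace X; g \<in> carrier G; h \<in> carrier G\<rbrakk> \<Longrightarrow> \<phi> (g \<otimes>\<^bsub>G\<^esub> h) ` e = \<phi> g ` \<phi> h ` e"
  unfolding image_image by (intro image_cong refl) (simp add: act_mult subset_iff)

lemma act_image_one: "e \<subseteq> topspace X \<Longrightarrow> \<phi> \<one>\<^bsub>G\<^esub> ` e = e"
  using act_one by (force simp: image_iff)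

lemma act_image_inv: "\<lbrakk>g \<in> carrier G; e \<subseteq> topspace X\<rbrakk> \<Longrightarrow> \<phi> (inv\<^bsub>G\<^esub> g) ` \<phi> g ` e = e"
  using act_inv by (force simp: image_iff)

lemma cell_subset: "e \<in> E n \<Longrightarrow> e \<subseteq> topspace X"
  by (rule cw_cell_subset[OF cw])

lemma act_in_skeleton: "\<lbrakk>g \<in> carrier G; x \<in> skeleton E z\<rbrakk> \<Longrightarrow> \<phi> g x \<in> skeleton E z"
  unfolding in_skeleton using act_cell by blast

lemma act_cell_meet:
  assumes "g \<in> carrier G" "e \<in> E n" "x \<in> e" "\<phi> g x \<in> e"
  shows "\<phi> g ` e = e" "\<phi> g x = x"
proof -
  have "\<phi> g x \<in> \<phi> g ` e" using assms by blast
  then show "\<phi> g ` e = e" using cw_cell_unique[OF cw act_cell[OF assms(1,2)] assms(2)] assms(4) by blast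
  then show "\<phi> g x = x" using act_cell_fix assms by blast
qed

lemma inj_act: "g \<in> carrier G \<Longrightarrow> inj_on (\<phi> g) (topspace X)"
  by (rule group_action.inj_prop[OF act])

lemma cell_parametrization_act:
  assumes "e \<in> E n" "cell_parametrization X E n e \<Phi>" "g \<in> carrier G"
  shows "cell_parametrization X E n (\<phi> g ` e) (\<phi> g \<circ> \<Phi>)"
proof -
  obtain F where F: "finite F" "F \<subseteq> (\<Union>k<n. E k)" "\<Phi> ` boundary_sphere_set n \<subseteq> \<Union>F"
    using assms by (auto simp: cell_parametrization_def)
  have *: "continuous_map (closed_disc n) X \<Phi>" "inj_on \<Phi> (open_disc_set n)" "\<Phi> ` open_disc_set n = e"
    using assms by (simp_all add: cell_parametrization_def)
  have "(\<phi> g \<circ> \<Phi>) ` boundary_sphere_set n \<subseteq> \<Union>((`) (\<phi> g) ` F)"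
  proof -
    have "\<phi> g ` \<Phi> ` boundary_sphere_set n \<subseteq> \<phi> g ` \<Union>F" by (rule image_mono[OF F(3)])
    then show ?thesis unfolding image_comp image_Union .
  qed
  moreover have "(`) (\<phi> g) ` F \<subseteq> (\<Union>k<n. E k)" using F(2) act_cell[OF assms(3)] by blast
  moreover have "inj_on (\<phi> g \<circ> \<Phi>) (open_disc_set n)"
    using * inj_on_subset[OF inj_act[OF assms(3)] cell_subset[OF assms(1)]] by (intro comp_inj_on) auto
  moreover have "continuous_map (closed_disc n) X (\<phi> g \<circ> \<Phi>)"
    by (rule continuous_map_compose[OF *(1) continuous_act[OF assms(3)]])
  moreover have "(\<phi> g \<circ> \<Phi>) ` open_disc_set n = \<phi> g ` e"
    unfolding image_comp[symmetric] *(3) ..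
  ultimately show ?thesis using F(1) unfolding cell_parametrization_def by blast
qed

text \<open>Equivariance is demanded on the closed disc, because the induced maps of relative
  homology also depend on the attaching sphere.\<close>

definition equivariant_family :: "nat \<Rightarrow> ('a set \<Rightarrow> (nat \<Rightarrow> real) \<Rightarrow> 'a) \<Rightarrow> bool" where
  "equivariant_family n \<Phi> \<longleftrightarrow> (\<forall>e\<in>E n. cell_parametrization X E n e (\<Phi> e)) \<and>
     (\<forall>g\<in>carrier G. \<forall>e\<in>E n. \<forall>x\<in>topspace (closed_disc n). \<Phi> (\<phi> g ` e) x = \<phi> g (\<Phi> e x))"

text \<open>Parametrize one representative in each orbit of cells and transport it by a chosen group
  element. Two elements that carry the representative to the same cell differ by one that preserves
  it, and such an element fixes it pointwise; so the choice is invisible on the open disc and, by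
  density, on the closed disc.\<close>

lemma equivariant_family_exists: "\<exists>\<Phi>. equivariant_family n \<Phi>"
proof -
  define orb where "orb e = (\<lambda>g. \<phi> g ` e) ` carrier G" for e
  \<comment> \<open>The choice depends only on the orbit as a set, so \<open>r\<close> is constant
    along orbits once \<open>orb_act\<close> is known.\<close>
  define r where "r e = (SOME e'. e' \<in> orb e)" for e
  obtain \<Phi>0 where \<Phi>0: "\<forall>e\<in>E n. cell_parametrization X E n e (\<Phi>0 e)"
    using bchoice[of "E n" "\<lambda>e \<Phi>. cell_parametrization X E n e \<Phi>"] cw_parametrization[OF cw] by blast
  have r: "\<exists>g\<in>carrier G. r e = \<phi> g ` e" if "e \<in> E n" for e
  proof -
    have "\<phi> \<one>\<^bsub>G\<^esub> ` e \<in> orb e" unfolding orb_def by (rule imageI[OF G_closed(2)])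
    then have "r e \<in> orb e" unfolding r_def by (rule someI)
    then show ?thesis by (auto simp: orb_def)
  qed
  then have rE: "r e \<in> E n" if "e \<in> E n" for e using that act_cell by metis
  have orb_act: "orb (\<phi> h ` e) = orb e" if e: "e \<in> E n" and h: "h \<in> carrier G" for e h
  proof (intro equalityI subsetI)
    fix f assume "f \<in> orb (\<phi> h ` e)"
    then obtain g where g: "g \<in> carrier G" "f = \<phi> g ` \<phi> h ` e" by (auto simp: orb_def)
    then have "f = \<phi> (g \<otimes>\<^bsub>G\<^esub> h) ` e" using act_image_mult[OF cell_subset[OF e] g(1) h] by simp
    then show "f \<in> orb e" unfolding orb_def by (rule image_eqI[OF _ G_closed(1)[OF g(1) h]])
  next
    fix f assume "f \<in> orb e"
    then obtain g where g: "g \<in> carrier G" "f = \<phi> g ` e" by (auto simp: orb_def)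
    have hi: "inv\<^bsub>G\<^esub> h \<in> carrier G" using h group.inv_closed[OF group_G] by blast
    have "f = \<phi> g ` \<phi> (inv\<^bsub>G\<^esub> h) ` \<phi> h ` e" using g act_image_inv[OF h cell_subset[OF e]] by simp
    also have "\<dots> = \<phi> (g \<otimes>\<^bsub>G\<^esub> inv\<^bsub>G\<^esub> h) ` \<phi> h ` e"
      by (rule act_image_mult[symmetric, OF cell_subset[OF act_cell[OF h e]] g(1) hi])
    finally show "f \<in> orb (\<phi> h ` e)"
      unfolding orb_def by (rule image_eqI[OF _ G_closed(1)[OF g(1) hi]])
  qed
  have "\<forall>e\<in>E n. \<exists>g. g \<in> carrier G \<and> \<phi> g ` r e = e"
  proof
    fix e assume e: "e \<in> E n"
    obtain g where g: "g \<in> carrier G" "r e = \<phi> g ` e" using r[OF e] by blast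
    then show "\<exists>g. g \<in> carrier G \<and> \<phi> g ` r e = e"
      using act_image_inv[OF g(1) cell_subset[OF e]] group.inv_closed[OF group_G g(1)] by auto
  qed
  then obtain c where c: "\<forall>e\<in>E n. c e \<in> carrier G \<and> \<phi> (c e) ` r e = e"
    by (rule bchoice[THEN exE])
  define \<Phi> where "\<Phi> e = \<phi> (c e) \<circ> \<Phi>0 (r e)" for e
  have par: "cell_parametrization X E n e (\<Phi> e)" if e: "e \<in> E n" for e
    using cell_parametrization_act[OF rE[OF e] \<Phi>0[rule_format, OF rE[OF e]], of "c e"] c e by (simp add: \<Phi>_def)
  moreover have "\<Phi> (\<phi> h ` e) x = \<phi> h (\<Phi> e x)"
    if h: "h \<in> carrier G" and e: "e \<in> E n" and x: "x \<in> topspace (closed_disc n)" for h e x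
  proof -
    let ?r = "r e" and ?e = "\<phi> h ` e"
    have re: "r ?e = ?r" unfolding r_def orb_act[OF e h] ..
    have eE: "?e \<in> E n" by (rule act_cell[OF h e])
    have ce: "c e \<in> carrier G" "\<phi> (c e) ` ?r = e" "c ?e \<in> carrier G" "\<phi> (c ?e) ` ?r = ?e"
      using c[rule_format, OF e] c[rule_format, OF eE] unfolding re by simp_all
    have cont0: "continuous_map (closed_disc n) X (\<Phi>0 ?r)" and im0: "\<Phi>0 ?r ` open_disc_set n = ?r"
      using \<Phi>0 rE[OF e] by (auto simp: cell_parametrization_def)
    have on_cell: "\<phi> (c ?e) y = \<phi> h (\<phi> (c e) y)" if y: "y \<in> ?r" for y
    proof -
      have yT: "y \<in> topspace X" using y cell_subset[OF rE[OF e]] by blast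
      define z where "z = \<phi> h (\<phi> (c e) y)"
      have zT: "z \<in> topspace X" unfolding z_def by (intro act_in h ce yT)
      have ic: "inv\<^bsub>G\<^esub> c ?e \<in> carrier G" using ce(3) by (rule G_closed(3))
      \<comment> \<open>The discrepancy between the two routes from the representative to
        \<open>?e\<close>. It sends the point \<open>y\<close> of the representative back into the
        representative, hence fixes it.\<close>
      define k where "k = inv\<^bsub>G\<^esub> c ?e \<otimes>\<^bsub>G\<^esub> (h \<otimes>\<^bsub>G\<^esub> c e)"
      have hc: "h \<otimes>\<^bsub>G\<^esub> c e \<in> carrier G" by (rule G_closed(1)[OF h ce(1)])
      have kG: "k \<in> carrier G" unfolding k_def by (rule G_closed(1)[OF ic hc])
      have ky: "\<phi> k y = \<phi> (inv\<^bsub>G\<^esub> c ?e) z"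
        unfolding k_def z_def by (simp add: act_mult yT ic hc h ce)
      have "z \<in> ?e" unfolding z_def using y ce(2) by blast
      then have "\<phi> (inv\<^bsub>G\<^esub> c ?e) z \<in> \<phi> (inv\<^bsub>G\<^esub> c ?e) ` \<phi> (c ?e) ` ?r" using ce(4) by simp
      then have "\<phi> k y \<in> ?r" using act_image_inv[OF ce(3) cell_subset[OF rE[OF e]]] ky by simp
      then have "\<phi> k y = y" by (rule act_cell_meet(2)[OF kG rE[OF e] y])
      then have "\<phi> (c ?e) y = \<phi> (c ?e) (\<phi> (inv\<^bsub>G\<^esub> c ?e) z)" using ky by simp
      also have "\<dots> = z" by (rule act_inv'[OF ce(3) zT])
      finally show ?thesis by (simp add: z_def)
    qed
    \<comment> \<open>The identity holds on the open cell by \<open>on_cell\<close> and extends to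
      the boundary sphere because \<open>X\<close> is Hausdorff.\<close>
    have "(\<phi> (c ?e) \<circ> \<Phi>0 ?r) x = (\<phi> h \<circ> (\<phi> (c e) \<circ> \<Phi>0 ?r)) x"
    proof (rule disc_maps_eqI[OF _ _ cw_Hausdorff[OF cw] _ x])
      show "continuous_map (closed_disc n) X (\<phi> (c ?e) \<circ> \<Phi>0 ?r)"
        by (intro continuous_map_compose[OF cont0] continuous_act ce)
      show "continuous_map (closed_disc n) X (\<phi> h \<circ> (\<phi> (c e) \<circ> \<Phi>0 ?r))"
        by (rule continuous_map_compose[OF continuous_map_compose[OF cont0 continuous_act[OF ce(1)]] continuous_act[OF h]])
      show "(\<phi> (c ?e) \<circ> \<Phi>0 ?r) y = (\<phi> h \<circ> (\<phi> (c e) \<circ> \<Phi>0 ?r)) y" if "y \<in> open_disc_set n" for y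
        using on_cell[of "\<Phi>0 ?r y"] that im0 by auto
    qed
    then show ?thesis by (simp add: \<Phi>_def re)
  qed
  ultimately have "equivariant_family n \<Phi>" by (simp add: equivariant_family_def)
  then show ?thesis by blast
qed

section \<open>The orbit space and its skeleta\<close>

lemma orbit_eq_iff:
  assumes "x \<in> topspace X" "y \<in> topspace X"
  shows "orbit G \<phi> x = orbit G \<phi> y \<longleftrightarrow> (\<exists>g\<in>carrier G. y = \<phi> g x)"
proof
  assume "orbit G \<phi> x = orbit G \<phi> y"
  moreover have "y \<in> orbit G \<phi> y" by (rule group_action.orbit_refl[OF act assms(2)])
  ultimately show "\<exists>g\<in>carrier G. y = \<phi> g x" by (auto simp: orbit_def)
next
  assume "\<exists>g\<in>carrier G. y = \<phi> g x"
  then obtain g where g: "g \<in> carrier G" "y = \<phi> g x" by blast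
  have gi: "inv\<^bsub>G\<^esub> g \<in> carrier G" using g group.inv_closed[OF group_G] by blast
  have xy: "x = \<phi> (inv\<^bsub>G\<^esub> g) y" using act_inv[OF g(1) assms(1)] g by simp
  show "orbit G \<phi> x = orbit G \<phi> y"
  proof (intro equalityI subsetI)
    fix z assume "z \<in> orbit G \<phi> x"
    then obtain h where h: "h \<in> carrier G" "z = \<phi> h x" by (auto simp: orbit_def)
    have "z = \<phi> (h \<otimes>\<^bsub>G\<^esub> inv\<^bsub>G\<^esub> g) y" using h xy act_mult[OF assms(2) h(1) gi] by simp
    moreover have "h \<otimes>\<^bsub>G\<^esub> inv\<^bsub>G\<^esub> g \<in> carrier G" using h(1) gi by (rule G_closed(1))
    ultimately show "z \<in> orbit G \<phi> y" by (auto simp: orbit_def)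
  next
    fix z assume "z \<in> orbit G \<phi> y"
    then obtain h where h: "h \<in> carrier G" "z = \<phi> h y" by (auto simp: orbit_def)
    have "z = \<phi> (h \<otimes>\<^bsub>G\<^esub> g) x" using h g act_mult[OF assms(1) h(1) g(1)] by simp
    moreover have "h \<otimes>\<^bsub>G\<^esub> g \<in> carrier G" using h(1) g(1) by (rule G_closed(1))
    ultimately show "z \<in> orbit G \<phi> x" by (auto simp: orbit_def)
  qed
qed

lemma orbit_act: "\<lbrakk>g \<in> carrier G; x \<in> topspace X\<rbrakk> \<Longrightarrow> orbit G \<phi> (\<phi> g x) = orbit G \<phi> x"
  using orbit_eq_iff[of x "\<phi> g x"] act_in by auto

lemma openin_orbit_space:
  "openin (orbit_space G \<phi> X) U \<longleftrightarrow>
     U \<subseteq> orbits G (topspace X) \<phi> \<and> openin X {x \<in> topspace X. orbit G \<phi> x \<in> U}"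
proof -
  have "istopology (\<lambda>U. U \<subseteq> orbits G (topspace X) \<phi> \<and> openin X {x \<in> topspace X. orbit G \<phi> x \<in> U})"
    unfolding istopology_def
  proof (intro conjI allI impI)
    fix S T assume S: "S \<subseteq> orbits G (topspace X) \<phi> \<and> openin X {x \<in> topspace X. orbit G \<phi> x \<in> S}"
      and T: "T \<subseteq> orbits G (topspace X) \<phi> \<and> openin X {x \<in> topspace X. orbit G \<phi> x \<in> T}"
    have "{x \<in> topspace X. orbit G \<phi> x \<in> S \<inter> T}
        = {x \<in> topspace X. orbit G \<phi> x \<in> S} \<inter> {x \<in> topspace X. orbit G \<phi> x \<in> T}" by auto
    then show "openin X {x \<in> topspace X. orbit G \<phi> x \<in> S \<inter> T}"
      using openin_Int[OF conjunct2[OF S] conjunct2[OF T]] by simp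
    show "S \<inter> T \<subseteq> orbits G (topspace X) \<phi>" using S by auto
  next
    fix K assume K: "\<forall>U\<in>K. U \<subseteq> orbits G (topspace X) \<phi> \<and> openin X {x \<in> topspace X. orbit G \<phi> x \<in> U}"
    then show "\<Union>K \<subseteq> orbits G (topspace X) \<phi>" by auto
    have "{x \<in> topspace X. orbit G \<phi> x \<in> \<Union>K} = (\<Union>U\<in>K. {x \<in> topspace X. orbit G \<phi> x \<in> U})" by auto
    moreover have "openin X (\<Union>U\<in>K. {x \<in> topspace X. orbit G \<phi> x \<in> U})"
      by (rule openin_Union) (use K in auto)
    ultimately show "openin X {x \<in> topspace X. orbit G \<phi> x \<in> \<Union>K}" by (simp only:)
  qed
  then show ?thesis unfolding orbit_space_def by (simp add: topology_inverse')
qed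

lemma topspace_orbit_space: "topspace (orbit_space G \<phi> X) = orbit G \<phi> ` topspace X"
proof -
  have o: "orbits G (topspace X) \<phi> = orbit G \<phi> ` topspace X" by (auto simp: orbits_def)
  have "{x \<in> topspace X. orbit G \<phi> x \<in> orbit G \<phi> ` topspace X} = topspace X" by auto
  then have "openin (orbit_space G \<phi> X) (orbit G \<phi> ` topspace X)"
    unfolding openin_orbit_space o by simp
  then show ?thesis
    using openin_subset[of "orbit_space G \<phi> X"] openin_orbit_space[of "topspace (orbit_space G \<phi> X)"] o
      openin_topspace[of "orbit_space G \<phi> X"] by auto
qed

lemma closedin_orbit_space:
  "closedin (orbit_space G \<phi> X) A \<longleftrightarrow>
     A \<subseteq> orbit G \<phi> ` topspace X \<and> closedin X {x \<in> topspace X. orbit G \<phi> x \<in> A}"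
proof -
  have o: "orbits G (topspace X) \<phi> = orbit G \<phi> ` topspace X" by (auto simp: orbits_def)
  have "{x \<in> topspace X. orbit G \<phi> x \<in> orbit G \<phi> ` topspace X - A}
      = topspace X - {x \<in> topspace X. orbit G \<phi> x \<in> A}" by auto
  then show ?thesis
    unfolding closedin_def topspace_orbit_space openin_orbit_space o by auto
qed

lemma continuous_map_orbit: "continuous_map X (orbit_space G \<phi> X) (orbit G \<phi>)"
  unfolding continuous_map openin_orbit_space topspace_orbit_space by auto

lemma skeleton_orbit_cells: "skeleton (orbit_cells G \<phi> E) z = orbit G \<phi> ` skeleton E z"
  by (auto simp: skeleton_def orbit_cells_def)

text \<open>The skeleta of \<open>X\<close> are stable under the action, so an orbit lies inside a
  skeleton or misses it.\<close>

lemma orbit_in_skeleton: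
  assumes "x \<in> topspace X"
  shows "orbit G \<phi> x \<in> skeleton (orbit_cells G \<phi> E) z \<longleftrightarrow> x \<in> skeleton E z"
proof
  assume "orbit G \<phi> x \<in> skeleton (orbit_cells G \<phi> E) z"
  then obtain y where y: "y \<in> skeleton E z" "orbit G \<phi> y = orbit G \<phi> x"
    unfolding skeleton_orbit_cells by (metis imageE)
  then have "y \<in> topspace X" using subsetD[OF skeleton_subset_topspace[OF cw]] by simp
  then obtain g where g: "g \<in> carrier G" "x = \<phi> g y" using orbit_eq_iff[OF _ assms] y(2) by blast
  then show "x \<in> skeleton E z" using act_in_skeleton[OF g(1) y(1)] by simp
qed (simp add: skeleton_orbit_cells)

lemma orbit_cell_eqD:
  assumes e: "e \<in> E n" and f: "f \<in> E n" and eq: "orbit G \<phi> ` e \<inter> orbit G \<phi> ` f \<noteq> {}"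
  shows "\<exists>g\<in>carrier G. f = \<phi> g ` e"
proof -
  obtain w where w: "w \<in> orbit G \<phi> ` e" "w \<in> orbit G \<phi> ` f" using eq by auto
  obtain x where x: "w = orbit G \<phi> x" "x \<in> e" using w(1) by (rule imageE)
  obtain y where y: "w = orbit G \<phi> y" "y \<in> f" using w(2) by (rule imageE)
  have xy: "x \<in> e" "y \<in> f" "orbit G \<phi> x = orbit G \<phi> y" using x y by simp_all
  then obtain g where g: "g \<in> carrier G" "y = \<phi> g x"
    using orbit_eq_iff[OF subsetD[OF cell_subset[OF e] xy(1)] subsetD[OF cell_subset[OF f] xy(2)]] xy(3) by blast
  then have "f = \<phi> g ` e"
    using cw_cell_unique[OF cw f act_cell[OF g(1) e] xy(2)] imageI[OF xy(1), of "\<phi> g"] by simp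
  then show ?thesis using g by blast
qed

lemma orbit_image_act: "\<lbrakk>g \<in> carrier G; e \<subseteq> topspace X\<rbrakk> \<Longrightarrow> orbit G \<phi> ` \<phi> g ` e = orbit G \<phi> ` e"
  unfolding image_image by (intro image_cong refl orbit_act) auto

text \<open>The cells of the orbit space are parametrized through a representative above each.
  Injectivity on the open disc holds because two points of one cell in the same orbit coincide. The
  weak topology is checked in \<open>X\<close>, on preimages under the projection. The second claim
  makes the choice of representatives harmless for later computations.\<close>

lemma orbit_attaching:
  assumes \<Phi>: "equivariant_family n \<Phi>"
  defines "rep \<equiv> inv_into (E n) (\<lambda>e. orbit G \<phi> ` e)"
  shows "attaching (subtopology (orbit_space G \<phi> X) (skeleton (orbit_cells G \<phi> E) (int n)))
           (skeleton (orbit_cells G \<phi> E) (int n - 1)) n (orbit_cells G \<phi> E n) (\<lambda>c. orbit G \<phi> \<circ> \<Phi> (rep c))"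
    and "\<And>e x. \<lbrakk>e \<in> E n; x \<in> topspace (closed_disc n)\<rbrakk> \<Longrightarrow> orbit G \<phi> (\<Phi> (rep (orbit G \<phi> ` e)) x) = orbit G \<phi> (\<Phi> e x)"
proof -
  let ?q = "orbit G \<phi>" and ?Q = "orbit_space G \<phi> X" and ?C = "orbit_cells G \<phi> E"
  let ?Y = "subtopology ?Q (skeleton ?C (int n))" and ?S = "skeleton ?C (int n - 1)"
  let ?D = "topspace (closed_disc n)"
  have par: "cell_parametrization X E n e (\<Phi> e)" if "e \<in> E n" for e
    using \<Phi> that by (simp add: equivariant_family_def)
  have im: "\<Phi> e ` open_disc_set n = e" "inj_on (\<Phi> e) (open_disc_set n)" "continuous_map (closed_disc n) X (\<Phi> e)"
    if "e \<in> E n" for e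
    using par[OF that] by (simp_all add: cell_parametrization_def)
  have \<Phi>T: "\<Phi> e x \<in> topspace X" if "e \<in> E n" "x \<in> ?D" for e x
    using continuous_map_image_subset_topspace[OF im(3)[OF that(1)]] that(2) by auto
  have rep: "rep o' \<in> E n" "?q ` rep o' = o'" if "o' \<in> ?C n" for o'
    using that inv_into_into[of o' "\<lambda>e. ?q ` e" "E n"] f_inv_into_f[of o' "\<lambda>e. ?q ` e" "E n"]
    by (auto simp: orbit_cells_def rep_def)
  \<comment> \<open>Two cells above the same orbit cell are translates of each other, and
    equivariance of \<open>\<Phi>\<close> reduces the difference to a group element, which the
    projection forgets.\<close>
  show 2: "?q (\<Phi> (rep (?q ` e)) x) = ?q (\<Phi> e x)" if e: "e \<in> E n" and x: "x \<in> ?D" for e x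
  proof -
    have o: "?q ` e \<in> ?C n" using e by (simp add: orbit_cells_def)
    have ne: "e \<noteq> {}" using im(1)[OF e] by (auto simp: open_disc_set_eq intro!: exI[of _ "\<lambda>i. 0"])
    then obtain g where g: "g \<in> carrier G" "rep (?q ` e) = \<phi> g ` e"
      using orbit_cell_eqD[OF e rep(1)[OF o]] rep(2)[OF o] by auto
    then have "\<Phi> (rep (?q ` e)) x = \<phi> g (\<Phi> e x)" using \<Phi> e x by (simp add: equivariant_family_def)
    then show ?thesis using orbit_act[OF g(1) \<Phi>T[OF e x]] by simp
  qed
  have cl: "closedin ?Q (skeleton ?C z)" for z
  proof -
    have "{x \<in> topspace X. ?q x \<in> skeleton ?C z} = skeleton E z"
      using orbit_in_skeleton skeleton_subset_topspace[OF cw, of z] by auto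
    then show ?thesis
      unfolding closedin_orbit_space
      using closedin_skeleton[OF cw, of z] skeleton_subset_topspace[OF cw, of z] by (simp add: skeleton_orbit_cells image_mono)
  qed
  have sub: "?S \<subseteq> skeleton ?C (int n)" by (rule skeleton_mono) simp
  have into: "\<Phi> e ` ?D \<subseteq> skeleton E (int n)" if "e \<in> E n" for e
    by (rule parametrization_into_skeleton(1)[OF cw that par[OF that]])
  have 1: "closedin ?Y ?S" by (rule closedin_subset_topspace[OF cl sub])
  have img: "(?q \<circ> \<Phi> (rep o')) ` open_disc_set n = o'" if "o' \<in> ?C n" for o'
    unfolding image_comp[symmetric] im(1)[OF rep(1)[OF that]] by (rule rep(2)[OF that])
  have oS: "o' \<inter> ?S = {}" if o': "o' \<in> ?C n" for o'
  proof -
    obtain e where e: "e \<in> E n" "o' = ?q ` e" using o' unfolding orbit_cells_def by blast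
    have "?q x \<notin> ?S" if "x \<in> e" for x
      using orbit_in_skeleton[of x "int n - 1"] that cell_subset[OF e(1)]
        cell_disjoint_skeleton[OF cw e(1), of "int n - 1"] by auto
    then show ?thesis using e by auto
  qed
  have 3: "continuous_map (closed_disc n) ?Y (?q \<circ> \<Phi> (rep o')) \<and> (?q \<circ> \<Phi> (rep o')) ` boundary_sphere_set n \<subseteq> ?S \<and>
      inj_on (?q \<circ> \<Phi> (rep o')) (open_disc_set n) \<and> (?q \<circ> \<Phi> (rep o')) ` open_disc_set n \<inter> ?S = {}"
    if o': "o' \<in> ?C n" for o'
  proof (intro conjI)
    note e = rep(1)[OF o']
    have "(?q \<circ> \<Phi> (rep o')) ` ?D \<subseteq> skeleton ?C (int n)"
      unfolding skeleton_orbit_cells image_comp[symmetric] by (rule image_mono[OF into[OF e]])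
    then have "?q \<circ> \<Phi> (rep o') \<in> ?D \<rightarrow> skeleton ?C (int n)" by (simp only: image_subset_iff_funcset)
    then show "continuous_map (closed_disc n) ?Y (?q \<circ> \<Phi> (rep o'))"
      by (rule continuous_map_into_subtopology[OF continuous_map_compose[OF im(3)[OF e] continuous_map_orbit]])
    show "(?q \<circ> \<Phi> (rep o')) ` boundary_sphere_set n \<subseteq> ?S"
      unfolding skeleton_orbit_cells image_comp[symmetric]
      by (rule image_mono[OF parametrization_boundary[OF cw par[OF e]]])
    show "inj_on (?q \<circ> \<Phi> (rep o')) (open_disc_set n)"
    proof (rule inj_onI)
      fix x y assume xy: "x \<in> open_disc_set n" "y \<in> open_disc_set n" "(?q \<circ> \<Phi> (rep o')) x = (?q \<circ> \<Phi> (rep o')) y"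
      have xe: "\<Phi> (rep o') x \<in> rep o'" "\<Phi> (rep o') y \<in> rep o'" using im(1)[OF e] xy by auto
      then obtain g where g: "g \<in> carrier G" "\<Phi> (rep o') y = \<phi> g (\<Phi> (rep o') x)"
        using orbit_eq_iff[of "\<Phi> (rep o') x" "\<Phi> (rep o') y"] cell_subset[OF e] xy(3) by auto
      then have "\<Phi> (rep o') y = \<Phi> (rep o') x" using act_cell_meet(2)[OF g(1) e xe(1)] xe(2) by simp
      then show "x = y" using im(2)[OF e] xy by (auto dest: inj_onD)
    qed
    show "(?q \<circ> \<Phi> (rep o')) ` open_disc_set n \<inter> ?S = {}" unfolding img[OF o'] by (rule oS[OF o'])
  qed
  have 4: "(?q \<circ> \<Phi> (rep o1)) ` open_disc_set n \<inter> (?q \<circ> \<Phi> (rep o2)) ` open_disc_set n = {}"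
    if o: "o1 \<in> ?C n" "o2 \<in> ?C n" "o1 \<noteq> o2" for o1 o2
  proof (rule ccontr)
    assume "\<not> ?thesis"
    then have "?q ` rep o1 \<inter> ?q ` rep o2 \<noteq> {}" unfolding img[OF o(1)] img[OF o(2)] rep(2)[OF o(1)] rep(2)[OF o(2)] .
    then obtain g where "g \<in> carrier G" "rep o2 = \<phi> g ` rep o1"
      using orbit_cell_eqD[OF rep(1)[OF o(1)] rep(1)[OF o(2)]] by blast
    then have "?q ` rep o2 = ?q ` rep o1" using orbit_image_act cell_subset[OF rep(1)[OF o(1)]] by simp
    then show False using rep(2) o by simp
  qed
  have "(\<Union>o'\<in>?C n. (?q \<circ> \<Phi> (rep o')) ` open_disc_set n) = \<Union>(?C n)" using img by simp
  moreover have "topspace ?Y = skeleton ?C (int n)"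
    using closedin_subset[OF cl] by auto
  ultimately have 5: "topspace ?Y = ?S \<union> (\<Union>o'\<in>?C n. (?q \<circ> \<Phi> (rep o')) ` open_disc_set n)"
    using skeleton_step[of ?C n] by simp
  have 6: "closedin ?Y A" if A: "A \<subseteq> topspace ?Y" "closedin ?Y (A \<inter> ?S)"
      "\<forall>o'\<in>?C n. closedin (closed_disc n) {x \<in> ?D. (?q \<circ> \<Phi> (rep o')) x \<in> A}" for A
  proof -
    let ?A = "{x \<in> topspace X. ?q x \<in> A}"
    have AS: "closedin ?Q (A \<inter> ?S)" by (rule closedin_trans_full[OF A(2) cl])
    have Asub: "A \<subseteq> skeleton ?C (int n)" using A(1) by simp
    \<comment> \<open>A set is closed in the quotient exactly if its preimage is closed in
      \<open>X\<close>, so the criterion for the skeleta of \<open>X\<close> can be used.\<close>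
    have "closedin X ?A"
    proof (rule closedin_skeleton_step[OF cw par])
      show "?A \<subseteq> skeleton E (int n)" using Asub orbit_in_skeleton by blast
      have "?A \<inter> skeleton E (int n - 1) = {x \<in> topspace X. ?q x \<in> A \<inter> ?S}"
        using orbit_in_skeleton by auto
      then show "closedin X (?A \<inter> skeleton E (int n - 1))"
        using AS unfolding closedin_orbit_space by simp
      fix e assume e: "e \<in> E n"
      have o': "?q ` e \<in> ?C n" using e by (simp add: orbit_cells_def)
      \<comment> \<open>Membership in a preimage depends on the orbit only, so the disc of an
        arbitrary cell may be replaced by that of its representative, where the hypothesis
        applies.\<close>
      have "{x \<in> ?D. \<Phi> e x \<in> ?A} = {x \<in> ?D. (?q \<circ> \<Phi> (rep (?q ` e))) x \<in> A}"
        using 2[OF e] \<Phi>T[OF e] by auto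
      then show "closedin (closed_disc n) {x \<in> ?D. \<Phi> e x \<in> ?A}" using A(3) o' by simp
    qed
    then have "closedin ?Q A"
      unfolding closedin_orbit_space using Asub closedin_subset[OF cl[of "int n"]] unfolding topspace_orbit_space by auto
    then show ?thesis by (rule closedin_subset_topspace[OF _ Asub])
  qed
  show "attaching ?Y ?S n (?C n) (\<lambda>c. ?q \<circ> \<Phi> (rep c))"
    unfolding attaching_def using 1 3 4 5 6 by simp
qed

section \<open>The fixed point set as a subcomplex\<close>

lemma cell_fixed_iff:
  assumes e: "e \<in> E n" and x: "x \<in> e"
  shows "x \<in> fixed_points G \<phi> X \<longleftrightarrow> e \<subseteq> fixed_points G \<phi> X"
proof
  assume "x \<in> fixed_points G \<phi> X"
  \<comment> \<open>A single fixed point makes every group element meet the cell with its translate,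
    so the cell is preserved and then fixed pointwise.\<close>
  then have "\<phi> g ` e = e" if "g \<in> carrier G" for g
    using act_cell_meet(1)[OF that e x] x that by (simp add: fixed_points_def)
  then show "e \<subseteq> fixed_points G \<phi> X"
    using act_cell_fix[OF _ e] cell_subset[OF e] by (auto simp: fixed_points_def)
qed (use x in blast)

lemma skeleton_fixed_cells:
  "skeleton (fixed_cells G \<phi> X E) z = skeleton E z \<inter> fixed_points G \<phi> X"
proof (intro equalityI subsetI)
  fix x assume "x \<in> skeleton E z \<inter> fixed_points G \<phi> X"
  then obtain k e where "int k \<le> z" "e \<in> E k" "x \<in> e" "x \<in> fixed_points G \<phi> X"
    by (auto simp: in_skeleton)
  then show "x \<in> skeleton (fixed_cells G \<phi> X E) z"
    unfolding in_skeleton fixed_cells_def using cell_fixed_iff by blast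
qed (auto simp: in_skeleton fixed_cells_def)

lemma closedin_fixed_points: "closedin X (fixed_points G \<phi> X)"
proof -
  have "closedin X {x \<in> topspace X. \<phi> g x = x}" if "g \<in> carrier G" for g
    by (rule closedin_continuous_maps_eq[OF cw_Hausdorff[OF cw] continuous_act[OF that]]) simp
  then have "closedin X (\<Inter>g\<in>carrier G. {x \<in> topspace X. \<phi> g x = x})"
    by (intro closedin_Inter) (use G_closed(2) in auto)
  moreover have "(\<Inter>g\<in>carrier G. {x \<in> topspace X. \<phi> g x = x}) = fixed_points G \<phi> X"
    using G_closed(2) by (auto simp: fixed_points_def)
  ultimately show ?thesis by simp
qed

text \<open>The parametrizations of \<open>X\<close> are reused for the fixed cells. The weak
  topology is that of \<open>X\<close>: a cell that is not fixed meets a subset of the fixed point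
  set only along its boundary.\<close>

lemma fixed_attaching:
  assumes \<Phi>: "equivariant_family n \<Phi>"
  shows "attaching (subtopology (fixed_space G \<phi> X) (skeleton (fixed_cells G \<phi> X E) (int n)))
           (skeleton (fixed_cells G \<phi> X E) (int n - 1)) n (fixed_cells G \<phi> X E n) \<Phi>"
proof -
  let ?P = "fixed_points G \<phi> X" and ?C = "fixed_cells G \<phi> X E" and ?D = "topspace (closed_disc n)"
  let ?Y = "subtopology (fixed_space G \<phi> X) (skeleton ?C (int n))" and ?S = "skeleton ?C (int n - 1)"
  have Y: "?Y = subtopology X (skeleton ?C (int n))"
    unfolding fixed_space_def subtopology_subtopology skeleton_fixed_cells by (simp add: Int_commute Int_left_absorb)
  have par: "cell_parametrization X E n e (\<Phi> e)" if "e \<in> E n" for e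
    using \<Phi> that by (simp add: equivariant_family_def)
  have im: "\<Phi> e ` open_disc_set n = e" "inj_on (\<Phi> e) (open_disc_set n)" "continuous_map (closed_disc n) X (\<Phi> e)"
    if "e \<in> E n" for e
    using par[OF that] by (simp_all add: cell_parametrization_def)
  have cl: "closedin X (skeleton ?C z)" for z
    unfolding skeleton_fixed_cells by (intro closedin_Int closedin_skeleton[OF cw] closedin_fixed_points)
  have sub: "?S \<subseteq> skeleton ?C (int n)" by (rule skeleton_mono) simp
  have CE: "e \<in> E n" "e \<subseteq> ?P" if "e \<in> ?C n" for e using that by (auto simp: fixed_cells_def)
  \<comment> \<open>Equivariance on the closed disc puts the attaching sphere of a fixed cell into
    the fixed point set as well.\<close>
  have into_fixed: "\<Phi> e x \<in> ?P" if e: "e \<in> ?C n" and x: "x \<in> ?D" for e x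
  proof -
    have "\<Phi> e x = \<phi> g (\<Phi> e x)" if g: "g \<in> carrier G" for g
    proof -
      have "\<phi> g ` e = e" using CE[OF e] g by (force simp: fixed_points_def image_iff)
      then show ?thesis using \<Phi> g CE(1)[OF e] x unfolding equivariant_family_def by metis
    qed
    moreover have "\<Phi> e x \<in> topspace X"
      using continuous_map_image_subset_topspace[OF im(3)[OF CE(1)[OF e]]] x by auto
    ultimately show ?thesis by (simp add: fixed_points_def)
  qed
  have 1: "closedin ?Y ?S" unfolding Y by (rule closedin_subset_topspace[OF cl sub])
  have 2: "continuous_map (closed_disc n) ?Y (\<Phi> e) \<and> \<Phi> e ` boundary_sphere_set n \<subseteq> ?S \<and>
      inj_on (\<Phi> e) (open_disc_set n) \<and> \<Phi> e ` open_disc_set n \<inter> ?S = {}" if e: "e \<in> ?C n" for e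
  proof (intro conjI)
    have "\<Phi> e ` ?D \<subseteq> skeleton ?C (int n)"
      unfolding skeleton_fixed_cells
      using parametrization_into_skeleton(1)[OF cw CE(1)[OF e] par[OF CE(1)[OF e]]] into_fixed[OF e] by auto
    then show "continuous_map (closed_disc n) ?Y (\<Phi> e)"
      unfolding Y using im(3)[OF CE(1)[OF e]] by (simp add: continuous_map_in_subtopology image_subset_iff_funcset)
    show "\<Phi> e ` boundary_sphere_set n \<subseteq> ?S"
      unfolding skeleton_fixed_cells
      using parametrization_boundary[OF cw par[OF CE(1)[OF e]]] into_fixed[OF e] open_disc_Un_boundary[of n] by auto
    show "inj_on (\<Phi> e) (open_disc_set n)" by (rule im(2)[OF CE(1)[OF e]])
    show "\<Phi> e ` open_disc_set n \<inter> ?S = {}"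
      unfolding im(1)[OF CE(1)[OF e]] skeleton_fixed_cells
      using cell_disjoint_skeleton[OF cw CE(1)[OF e], of "int n - 1"] by auto
  qed
  have 3: "\<Phi> e ` open_disc_set n \<inter> \<Phi> f ` open_disc_set n = {}" if "e \<in> ?C n" "f \<in> ?C n" "e \<noteq> f" for e f
    unfolding im(1)[OF CE(1)[OF that(1)]] im(1)[OF CE(1)[OF that(2)]]
    using cw_cell_unique[OF cw CE(1)[OF that(1)] CE(1)[OF that(2)]] that(3) by auto
  have "(\<Union>e\<in>?C n. \<Phi> e ` open_disc_set n) = \<Union>(?C n)" using im(1) CE(1) by simp
  moreover have "topspace ?Y = skeleton ?C (int n)" unfolding Y using closedin_subset[OF cl] by auto
  ultimately have 4: "topspace ?Y = ?S \<union> (\<Union>e\<in>?C n. \<Phi> e ` open_disc_set n)"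
    using skeleton_step[of ?C n] by simp
  have 5: "closedin ?Y A" if A: "A \<subseteq> topspace ?Y" "closedin ?Y (A \<inter> ?S)"
      "\<forall>e\<in>?C n. closedin (closed_disc n) {x \<in> ?D. \<Phi> e x \<in> A}" for A
  proof -
    have AS: "closedin X (A \<inter> ?S)"
      using A(2) unfolding Y by (rule closedin_trans_full[OF _ cl])
    have Asub: "A \<subseteq> skeleton ?C (int n)" using A(1) by simp
    have "closedin X A"
    proof (rule closedin_skeleton_step[OF cw par])
      show "A \<subseteq> skeleton E (int n)" using Asub unfolding skeleton_fixed_cells by simp
      have AP: "A \<inter> skeleton E (int n - 1) = A \<inter> ?S" using Asub unfolding skeleton_fixed_cells by auto
      then show "closedin X (A \<inter> skeleton E (int n - 1))" using AS by simp
      fix e assume e: "e \<in> E n"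
      show "closedin (closed_disc n) {x \<in> ?D. \<Phi> e x \<in> A}"
      proof (cases "e \<in> ?C n")
        case False
        \<comment> \<open>A fixed point in the open cell would make the whole cell fixed, so
          \<open>x\<close> lies on the sphere and its image in the previous skeleton.\<close>
        have "\<Phi> e x \<in> ?S" if x: "x \<in> ?D" "\<Phi> e x \<in> A" for x
        proof -
          have P: "\<Phi> e x \<in> ?P" using Asub x unfolding skeleton_fixed_cells by auto
          have "x \<notin> open_disc_set n"
          proof
            assume "x \<in> open_disc_set n"
            then have "\<Phi> e x \<in> e" using im(1)[OF e] by blast
            then show False using cell_fixed_iff[OF e] P False e by (simp add: fixed_cells_def)
          qed
          then have "\<Phi> e x \<in> skeleton E (int n - 1)"
            using x(1) parametrization_boundary[OF cw par[OF e]] open_disc_Un_boundary[of n] by auto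
          then show ?thesis using P unfolding skeleton_fixed_cells by simp
        qed
        then have "{x \<in> ?D. \<Phi> e x \<in> A} = {x \<in> ?D. \<Phi> e x \<in> A \<inter> ?S}" by auto
        then show ?thesis using closedin_continuous_map_preimage[OF im(3)[OF e] AS] by simp
      qed (use A(3) in simp)
    qed
    then show ?thesis unfolding Y by (rule closedin_subset_topspace[OF _ Asub])
  qed
  show ?thesis unfolding attaching_def using 1 2 3 4 5 by simp
qed

end

section \<open>Long exact homology sequence\<close>

text \<open>\<open>H\<close> is any group onto which \<open>\<pi>\<close> maps, not literally a
  quotient. The same lemma therefore yields the maps out of homology groups, out of tensor products,
  and the two chain maps of the short exact sequence.\<close>

lemma hom_factor:
  assumes grp: "group P" "group K" and \<pi>: "\<pi> \<in> hom P H" "\<pi> ` carrier P = carrier H" and \<theta>: "\<theta> \<in> hom P K"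
    and "group H"
    and ker: "\<And>x. \<lbrakk>x \<in> carrier P; \<pi> x = \<one>\<^bsub>H\<^esub>\<rbrakk> \<Longrightarrow> \<theta> x = \<one>\<^bsub>K\<^esub>"
  shows "\<exists>\<psi>\<in>hom H K. \<forall>x\<in>carrier P. \<psi> (\<pi> x) = \<theta> x"
proof -
  interpret p: group_hom P H \<pi> by (intro group_hom.intro group_hom_axioms.intro assms)
  interpret t: group_hom P K \<theta> by (intro group_hom.intro group_hom_axioms.intro assms)
  have eq: "\<theta> x = \<theta> y" if "x \<in> carrier P" "y \<in> carrier P" "\<pi> x = \<pi> y" for x y
  proof -
    have "\<theta> (x \<otimes>\<^bsub>P\<^esub> inv\<^bsub>P\<^esub> y) = \<one>\<^bsub>K\<^esub>" by (rule ker) (use that in auto)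
    then have "\<theta> x \<otimes>\<^bsub>K\<^esub> inv\<^bsub>K\<^esub> \<theta> y = \<one>\<^bsub>K\<^esub>" using that by simp
    then show ?thesis using that t.H.inv_solve_right'[of "\<one>\<^bsub>K\<^esub>" "\<theta> x" "\<theta> y"] by simp
  qed
  define \<psi> where "\<psi> y = \<theta> (inv_into (carrier P) \<pi> y)" for y
  have inv: "inv_into (carrier P) \<pi> y \<in> carrier P" "\<pi> (inv_into (carrier P) \<pi> y) = y" if "y \<in> carrier H" for y
    using that \<pi>(2) by (auto simp: inv_into_into f_inv_into_f)
  have fac: "\<psi> (\<pi> x) = \<theta> x" if "x \<in> carrier P" for x
    unfolding \<psi>_def by (rule eq) (use that inv in auto)
  have "\<psi> \<in> hom H K"
  proof (rule homI)
    fix y assume "y \<in> carrier H"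
    then show "\<psi> y \<in> carrier K" unfolding \<psi>_def using inv by simp
  next
    fix y z assume yz: "y \<in> carrier H" "z \<in> carrier H"
    obtain x w where xw: "x \<in> carrier P" "w \<in> carrier P" "y = \<pi> x" "z = \<pi> w" using yz inv by metis
    then show "\<psi> (y \<otimes>\<^bsub>H\<^esub> z) = \<psi> y \<otimes>\<^bsub>K\<^esub> \<psi> z"
      using fac[of "x \<otimes>\<^bsub>P\<^esub> w"] fac by simp
  qed
  then show ?thesis using fac by blast
qed

locale chain_complex =
  fixes C :: "int \<Rightarrow> 'c monoid" and d :: "int \<Rightarrow> 'c \<Rightarrow> 'c"
  assumes comm: "comm_group (C n)"
    and boundary_hom: "d n \<in> hom (C n) (C (n - 1))"
    and boundary_boundary: "x \<in> carrier (C n) \<Longrightarrow> d (n - 1) (d n x) = \<one>\<^bsub>C (n - 1 - 1)\<^esub>"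
begin

sublocale comm_group "C n" for n by (rule comm)

sublocale d: group_hom "C n" "C (n - 1)" "d n" for n
  by (intro group_hom.intro group_hom_axioms.intro boundary_hom) (rule group_axioms)+

definition cycles :: "int \<Rightarrow> 'c set" where
  "cycles n = kernel (C n) (C (n - 1)) (d n)"

abbreviation boundaries :: "int \<Rightarrow> 'c set" where
  "boundaries n \<equiv> d (n + 1) ` carrier (C (n + 1))"

abbreviation cycle_group :: "int \<Rightarrow> 'c monoid" where
  "cycle_group n \<equiv> (C n)\<lparr>carrier := cycles n\<rparr>"

definition cls :: "int \<Rightarrow> 'c \<Rightarrow> 'c set" where
  "cls n z = boundaries n #>\<^bsub>cycle_group n\<^esub> z"

lemma in_cycles: "z \<in> cycles n \<longleftrightarrow> z \<in> carrier (C n) \<and> d n z = \<one>\<^bsub>C (n - 1)\<^esub>"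
  by (auto simp: cycles_def kernel_def)

lemma subgroup_cycles: "subgroup (cycles n) (C n)"
  unfolding cycles_def by (rule d.subgroup_kernel)

lemma boundary_in_carrier: "y \<in> carrier (C n) \<Longrightarrow> d n y \<in> carrier (C (n - 1))"
  by (rule d.hom_closed)

lemma comm_group_cycle_group: "comm_group (cycle_group n)"
  by (rule group.group_comm_groupI[OF subgroup.subgroup_is_group[OF subgroup_cycles is_group]])
    (simp add: in_cycles m_comm)

lemma boundaries_subset: "boundaries n \<subseteq> cycles n"
  using boundary_boundary[of _ "n + 1"] boundary_in_carrier[of _ "n + 1"] by (auto simp: in_cycles)

lemma subgroup_boundaries: "subgroup (boundaries n) (cycle_group n)"
proof -
  have "subgroup (boundaries n) (C n)"
    using d.img_is_subgroup[of "n + 1"] by simp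
  then show ?thesis
    using boundaries_subset[of n] subgroup_cycles[of n] subgroup_incl by blast
qed

lemma normal_boundaries: "boundaries n \<lhd> cycle_group n"
  using comm_group.normal_iff_subgroup[OF comm_group_cycle_group] subgroup_boundaries by blast

lemma cls_hom: "group_hom (cycle_group n) (complex_homology C d n) (cls n)"
  unfolding complex_homology_def cls_def cycles_def[symmetric]
  by (intro group_hom.intro group_hom_axioms.intro normal.r_coset_hom_Mod normal.factorgroup_is_group normal_boundaries
      comm_group.axioms(2) comm_group_cycle_group)

lemma cls_surj: "cls n ` cycles n = carrier (complex_homology C d n)"
  unfolding complex_homology_def carrier_FactGroup cycles_def[symmetric] by (auto simp: cls_def image_iff)

lemma cls_closed: "z \<in> cycles n \<Longrightarrow> cls n z \<in> carrier (complex_homology C d n)"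
  using cls_surj[of n] by blast

lemma cls_eq_one: assumes "z \<in> cycles n" shows "cls n z = \<one>\<^bsub>complex_homology C d n\<^esub> \<longleftrightarrow> z \<in> boundaries n"
proof -
  interpret Z: comm_group "cycle_group n" by (rule comm_group_cycle_group)
  have "cls n z = \<one>\<^bsub>complex_homology C d n\<^esub> \<longleftrightarrow> boundaries n #>\<^bsub>cycle_group n\<^esub> z = boundaries n"
    by (simp add: complex_homology_def FactGroup_def cls_def cycles_def)
  also have "\<dots> \<longleftrightarrow> z \<in> boundaries n"
    using Z.rcos_self[OF _ subgroup_boundaries, of z] Z.coset_join2[OF _ subgroup_boundaries, of z] assms by auto
  finally show ?thesis .
qed

lemma cls_mult:
  "\<lbrakk>z \<in> cycles n; w \<in> cycles n\<rbrakk> \<Longrightarrow> cls n (z \<otimes>\<^bsub>C n\<^esub> w) = cls n z \<otimes>\<^bsub>complex_homology C d n\<^esub> cls n w"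
  using group_hom.hom_mult[OF cls_hom, of z n w] by simp

lemma group_homology: "group (complex_homology C d n)"
  using cls_hom group_hom.axioms(2) by blast

lemma cycle_mult: "\<lbrakk>z \<in> cycles n; w \<in> cycles n\<rbrakk> \<Longrightarrow> z \<otimes>\<^bsub>C n\<^esub> w \<in> cycles n"
  by (simp add: in_cycles)

lemma boundary_in_cycles: "y \<in> carrier (C n) \<Longrightarrow> d n y \<in> cycles (n - 1)"
  using boundary_boundary[of y n] boundary_in_carrier by (simp add: in_cycles)

lemma cls_boundary: "y \<in> carrier (C n) \<Longrightarrow> cls (n - 1) (d n y) = \<one>\<^bsub>complex_homology C d (n - 1)\<^esub>"
  using cls_eq_one[OF boundary_in_cycles] by simp

lemma homology_hom_exists:
  assumes "group K" "\<theta> \<in> hom (cycle_group n) K"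
    and "\<And>y. y \<in> carrier (C (n + 1)) \<Longrightarrow> \<theta> (d (n + 1) y) = \<one>\<^bsub>K\<^esub>"
  shows "\<exists>\<psi>. \<psi> \<in> hom (complex_homology C d n) K \<and> (\<forall>z\<in>cycles n. \<psi> (cls n z) = \<theta> z)"
proof -
  interpret cls: group_hom "cycle_group n" "complex_homology C d n" "cls n" by (rule cls_hom)
  have "\<exists>\<psi>\<in>hom (complex_homology C d n) K. \<forall>z\<in>carrier (cycle_group n). \<psi> (cls n z) = \<theta> z"
    by (rule hom_factor)
       (use assms cls_surj cls_eq_one group_homology cls.homh cls.G.is_group in auto)
  then show ?thesis by auto
qed

end

locale short_exact_complexes =
  A: chain_complex A dA + B: chain_complex B dB + D: chain_complex D dD
  for A :: "int \<Rightarrow> 'a monoid" and dA and B :: "int \<Rightarrow> 'b monoid" and dB and D :: "int \<Rightarrow> 'c monoid" and dD +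
  fixes f :: "int \<Rightarrow> 'a \<Rightarrow> 'b" and g :: "int \<Rightarrow> 'b \<Rightarrow> 'c"
  assumes f_hom: "f n \<in> hom (A n) (B n)" and g_hom: "g n \<in> hom (B n) (D n)"
    and f_inj: "inj_on (f n) (carrier (A n))"
    and g_surj: "g n ` carrier (B n) = carrier (D n)"
    and middle: "f n ` carrier (A n) = kernel (B n) (D n) (g n)"
    and f_chain: "x \<in> carrier (A n) \<Longrightarrow> f (n - 1) (dA n x) = dB n (f n x)"
    and g_chain: "y \<in> carrier (B n) \<Longrightarrow> g (n - 1) (dB n y) = dD n (g n y)"
begin

sublocale f: group_hom "A n" "B n" "f n" for n
  by (intro group_hom.intro group_hom_axioms.intro f_hom) (rule A.group_axioms B.group_axioms)+

sublocale g: group_hom "B n" "D n" "g n" for n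
  by (intro group_hom.intro group_hom_axioms.intro g_hom) (rule B.group_axioms D.group_axioms)+

abbreviation "HA \<equiv> complex_homology A dA"
abbreviation "HB \<equiv> complex_homology B dB"
abbreviation "HD \<equiv> complex_homology D dD"

lemma gf: "x \<in> carrier (A n) \<Longrightarrow> g n (f n x) = \<one>\<^bsub>D n\<^esub>"
  using middle[of n] by (auto simp: kernel_def)

lemma g_eq_one: "\<lbrakk>y \<in> carrier (B n); g n y = \<one>\<^bsub>D n\<^esub>\<rbrakk> \<Longrightarrow> \<exists>x\<in>carrier (A n). y = f n x"
  using middle[of n] by (auto simp: kernel_def)

lemma f_eq_one: "\<lbrakk>x \<in> carrier (A n); f n x = \<one>\<^bsub>B n\<^esub>\<rbrakk> \<Longrightarrow> x = \<one>\<^bsub>A n\<^esub>"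
  using f_inj[of n] by (metis A.one_closed f.hom_one inj_onD)

lemma g_preimage: "z \<in> carrier (D n) \<Longrightarrow> \<exists>b\<in>carrier (B n). g n b = z"
  using g_surj[of n] by (metis imageE)

lemma f_cycle: "z \<in> A.cycles n \<Longrightarrow> f n z \<in> B.cycles n"
  using f_chain[of z n] by (simp add: A.in_cycles B.in_cycles)

lemma g_cycle: "z \<in> B.cycles n \<Longrightarrow> g n z \<in> D.cycles n"
  using g_chain[of z n] by (simp add: B.in_cycles D.in_cycles)

lemma \<alpha>_exists: "\<exists>\<psi>. \<psi> \<in> hom (HA n) (HB n) \<and> (\<forall>z\<in>A.cycles n. \<psi> (A.cls n z) = B.cls n (f n z))"
proof (rule A.homology_hom_exists[OF B.group_homology])
  show "(\<lambda>z. B.cls n (f n z)) \<in> hom (A.cycle_group n) (HB n)"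
  proof (rule homI)
    show "B.cls n (f n x) \<in> carrier (HB n)" if "x \<in> carrier (A.cycle_group n)" for x
      using that by (simp add: B.cls_closed f_cycle)
    show "B.cls n (f n (x \<otimes>\<^bsub>A.cycle_group n\<^esub> y)) = B.cls n (f n x) \<otimes>\<^bsub>HB n\<^esub> B.cls n (f n y)"
      if "x \<in> carrier (A.cycle_group n)" "y \<in> carrier (A.cycle_group n)" for x y
      using that B.cls_mult[OF f_cycle f_cycle, of x n y] by (simp add: A.in_cycles)
  qed
  show "B.cls n (f n (dA (n + 1) y)) = \<one>\<^bsub>HB n\<^esub>" if "y \<in> carrier (A (n + 1))" for y
    using that f_chain[OF that] B.cls_boundary[of "f (n + 1) y" "n + 1"] by simp
qed

lemma \<beta>_exists: "\<exists>\<psi>. \<psi> \<in> hom (HB n) (HD n) \<and> (\<forall>z\<in>B.cycles n. \<psi> (B.cls n z) = D.cls n (g n z))"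
proof (rule B.homology_hom_exists[OF D.group_homology])
  show "(\<lambda>z. D.cls n (g n z)) \<in> hom (B.cycle_group n) (HD n)"
  proof (rule homI)
    show "D.cls n (g n x) \<in> carrier (HD n)" if "x \<in> carrier (B.cycle_group n)" for x
      using that by (simp add: D.cls_closed g_cycle)
    show "D.cls n (g n (x \<otimes>\<^bsub>B.cycle_group n\<^esub> y)) = D.cls n (g n x) \<otimes>\<^bsub>HD n\<^esub> D.cls n (g n y)"
      if "x \<in> carrier (B.cycle_group n)" "y \<in> carrier (B.cycle_group n)" for x y
      using that D.cls_mult[OF g_cycle g_cycle, of x n y] by (simp add: B.in_cycles)
  qed
  show "D.cls n (g n (dB (n + 1) y)) = \<one>\<^bsub>HD n\<^esub>" if "y \<in> carrier (B (n + 1))" for y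
    using that g_chain[OF that] D.cls_boundary[of "g (n + 1) y" "n + 1"] by simp
qed

text \<open>The snake construction as a relation, which postpones the choice of the lift
  \<open>b\<close>. The relation respects products and inverses, so its ambiguity can be studied
  over the trivial element alone.\<close>

definition zigzag :: "int \<Rightarrow> 'c \<Rightarrow> 'a \<Rightarrow> bool" where
  "zigzag n z a \<longleftrightarrow> a \<in> carrier (A (n - 1)) \<and> (\<exists>b\<in>carrier (B n). g n b = z \<and> f (n - 1) a = dB n b)"

lemma zigzag_exists: assumes "z \<in> D.cycles n" shows "\<exists>a. zigzag n z a"
proof -
  obtain b where b: "b \<in> carrier (B n)" "g n b = z"
    using g_preimage assms D.in_cycles by blast
  have "g (n - 1) (dB n b) = \<one>\<^bsub>D (n - 1)\<^esub>" using g_chain[OF b(1)] b assms by (simp add: D.in_cycles)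
  then obtain a where "a \<in> carrier (A (n - 1))" "dB n b = f (n - 1) a"
    using g_eq_one[OF B.boundary_in_carrier[OF b(1)]] by blast
  then show ?thesis using b unfolding zigzag_def by metis
qed

lemma zigzag_cycle: assumes "zigzag n z a" shows "a \<in> A.cycles (n - 1)"
proof -
  obtain b where a: "a \<in> carrier (A (n - 1))" and b: "b \<in> carrier (B n)" "f (n - 1) a = dB n b"
    using assms by (auto simp: zigzag_def)
  have "f (n - 1 - 1) (dA (n - 1) a) = \<one>\<^bsub>B (n - 1 - 1)\<^esub>"
    using f_chain[OF a] b B.boundary_boundary[OF b(1)] by simp
  then show ?thesis using a f_eq_one[OF A.boundary_in_carrier[OF a]] by (simp add: A.in_cycles)
qed

lemma zigzag_mult: "\<lbrakk>zigzag n z a; zigzag n w c\<rbrakk> \<Longrightarrow> zigzag n (z \<otimes>\<^bsub>D n\<^esub> w) (a \<otimes>\<^bsub>A (n - 1)\<^esub> c)"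
  unfolding zigzag_def
proof (elim conjE bexE, intro conjI)
  fix b b' assume "b \<in> carrier (B n)" "b' \<in> carrier (B n)" "g n b = z" "g n b' = w"
    "f (n - 1) a = dB n b" "f (n - 1) c = dB n b'" "a \<in> carrier (A (n - 1))" "c \<in> carrier (A (n - 1))"
  then show "a \<otimes>\<^bsub>A (n - 1)\<^esub> c \<in> carrier (A (n - 1))"
    "\<exists>b\<in>carrier (B n). g n b = z \<otimes>\<^bsub>D n\<^esub> w \<and> f (n - 1) (a \<otimes>\<^bsub>A (n - 1)\<^esub> c) = dB n b"
    by (auto intro!: bexI[of _ "b \<otimes>\<^bsub>B n\<^esub> b'"])
qed

lemma zigzag_inv: "zigzag n z a \<Longrightarrow> zigzag n (inv\<^bsub>D n\<^esub> z) (inv\<^bsub>A (n - 1)\<^esub> a)"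
  unfolding zigzag_def by (auto intro!: bexI[of _ "inv\<^bsub>B n\<^esub> _"])

text \<open>A lift of the trivial element comes from \<open>A\<close>, and its preimage there has
  boundary \<open>a\<close> because \<open>f\<close> is injective.\<close>

lemma zigzag_one: assumes "zigzag n \<one>\<^bsub>D n\<^esub> a" shows "A.cls (n - 1) a = \<one>\<^bsub>HA (n - 1)\<^esub>"
proof -
  obtain b where a: "a \<in> carrier (A (n - 1))" and b: "b \<in> carrier (B n)" "g n b = \<one>\<^bsub>D n\<^esub>" "f (n - 1) a = dB n b"
    using assms by (auto simp: zigzag_def)
  obtain x where x: "x \<in> carrier (A n)" "b = f n x" using g_eq_one b by blast
  then have "f (n - 1) a = f (n - 1) (dA n x)" using b f_chain by simp
  then have "a = dA n x" using a x f_inj[of "n - 1"] A.boundary_in_carrier by (auto dest: inj_onD)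
  then show ?thesis using A.cls_boundary x by simp
qed

text \<open>Dividing one zigzag by the other gives a zigzag over the trivial element, so
  \<open>a\<close> and \<open>c\<close> differ by a trivial homology class.\<close>

lemma zigzag_unique:
  assumes "zigzag n z a" "zigzag n z c" "z \<in> carrier (D n)" shows "A.cls (n - 1) a = A.cls (n - 1) c"
proof -
  interpret H: group "HA (n - 1)" by (rule A.group_homology)
  interpret cls: group_hom "A.cycle_group (n - 1)" "HA (n - 1)" "A.cls (n - 1)" by (rule A.cls_hom)
  have ac: "a \<in> A.cycles (n - 1)" "c \<in> A.cycles (n - 1)" using assms zigzag_cycle by auto
  have "zigzag n (z \<otimes>\<^bsub>D n\<^esub> inv\<^bsub>D n\<^esub> z) (a \<otimes>\<^bsub>A (n - 1)\<^esub> inv\<^bsub>A (n - 1)\<^esub> c)"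
    by (rule zigzag_mult[OF assms(1) zigzag_inv[OF assms(2)]])
  then have 1: "A.cls (n - 1) (a \<otimes>\<^bsub>A (n - 1)\<^esub> inv\<^bsub>A (n - 1)\<^esub> c) = \<one>\<^bsub>HA (n - 1)\<^esub>"
    using zigzag_one assms(3) by simp
  have ic: "inv\<^bsub>A (n - 1)\<^esub> c \<in> A.cycles (n - 1)"
    using ac by (simp add: A.in_cycles)
  have "a = (a \<otimes>\<^bsub>A (n - 1)\<^esub> inv\<^bsub>A (n - 1)\<^esub> c) \<otimes>\<^bsub>A (n - 1)\<^esub> c"
    using ac by (simp add: A.in_cycles A.m_assoc)
  then have "A.cls (n - 1) a = A.cls (n - 1) (a \<otimes>\<^bsub>A (n - 1)\<^esub> inv\<^bsub>A (n - 1)\<^esub> c) \<otimes>\<^bsub>HA (n - 1)\<^esub> A.cls (n - 1) c"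
    using A.cls_mult[OF A.cycle_mult[OF ac(1) ic] ac(2)] by simp
  moreover have "A.cls (n - 1) c \<in> carrier (HA (n - 1))" by (rule A.cls_closed[OF ac(2)])
  ultimately show ?thesis using 1 by simp
qed

lemma \<delta>_exists:
  "\<exists>\<psi>. \<psi> \<in> hom (HD n) (HA (n - 1)) \<and> (\<forall>z a. z \<in> D.cycles n \<longrightarrow> zigzag n z a \<longrightarrow> \<psi> (D.cls n z) = A.cls (n - 1) a)"
proof -
  define \<theta> where "\<theta> z = A.cls (n - 1) (SOME a. zigzag n z a)" for z
  have \<theta>: "\<theta> z = A.cls (n - 1) a" if "z \<in> D.cycles n" "zigzag n z a" for z a
    unfolding \<theta>_def
    by (rule zigzag_unique[OF someI[of "zigzag n z", OF that(2)] that(2)]) (use that(1) in \<open>simp add: D.in_cycles\<close>)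
  have "\<exists>\<psi>. \<psi> \<in> hom (HD n) (HA (n - 1)) \<and> (\<forall>z\<in>D.cycles n. \<psi> (D.cls n z) = \<theta> z)"
  proof (rule D.homology_hom_exists[OF A.group_homology])
    show "\<theta> \<in> hom (D.cycle_group n) (HA (n - 1))"
    proof (rule homI)
      fix x assume "x \<in> carrier (D.cycle_group n)"
      then have x: "x \<in> D.cycles n" by simp
      then obtain a where a: "zigzag n x a" using zigzag_exists by blast
      then show "\<theta> x \<in> carrier (HA (n - 1))" using \<theta>[OF x a] A.cls_closed[OF zigzag_cycle[OF a]] by simp
    next
      fix x y assume "x \<in> carrier (D.cycle_group n)" "y \<in> carrier (D.cycle_group n)"
      then have xy: "x \<in> D.cycles n" "y \<in> D.cycles n" by simp_all
      obtain a c where a: "zigzag n x a" and c: "zigzag n y c" using zigzag_exists xy by meson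
      have "\<theta> (x \<otimes>\<^bsub>D n\<^esub> y) = A.cls (n - 1) (a \<otimes>\<^bsub>A (n - 1)\<^esub> c)"
        by (rule \<theta>[OF D.cycle_mult[OF xy] zigzag_mult[OF a c]])
      then show "\<theta> (x \<otimes>\<^bsub>D.cycle_group n\<^esub> y) = \<theta> x \<otimes>\<^bsub>HA (n - 1)\<^esub> \<theta> y"
        using \<theta>[OF xy(1) a] \<theta>[OF xy(2) c] A.cls_mult[OF zigzag_cycle[OF a] zigzag_cycle[OF c]] by simp
    qed
    fix y assume y: "y \<in> carrier (D (n + 1))"
    obtain b where b: "b \<in> carrier (B (n + 1))" "g (n + 1) b = y" using g_preimage[OF y] by blast
    \<comment> \<open>A boundary in \<open>D\<close> can be lifted to the boundary of a lift of
      \<open>y\<close>. The boundary of that lift is trivial, so the trivial element is a zigzag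
      partner.\<close>
    have "dD (n + 1) y = g n (dB (n + 1) b)" using g_chain[OF b(1)] b by simp
    moreover have "dB (n + 1) b \<in> carrier (B n)" using B.boundary_in_carrier[OF b(1)] by simp
    moreover have "dB n (dB (n + 1) b) = \<one>\<^bsub>B (n - 1)\<^esub>" using B.boundary_boundary[OF b(1)] by simp
    ultimately have z: "zigzag n (dD (n + 1) y) \<one>\<^bsub>A (n - 1)\<^esub>" unfolding zigzag_def by auto
    have "\<theta> (dD (n + 1) y) = A.cls (n - 1) \<one>\<^bsub>A (n - 1)\<^esub>"
      by (rule \<theta>[OF _ z]) (use D.boundary_in_cycles[OF y] in simp)
    then show "\<theta> (dD (n + 1) y) = \<one>\<^bsub>HA (n - 1)\<^esub>"
      using group_hom.hom_one[OF A.cls_hom[of "n - 1"]] by simp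
  qed
  then show ?thesis using \<theta> by metis
qed

theorem long_exact_sequence:
  "\<exists>\<alpha> \<beta> \<delta>. \<forall>n. exact_at (HA n) (HB n) (HD n) (\<alpha> n) (\<beta> n) \<and>
     exact_at (HB n) (HD n) (HA (n - 1)) (\<beta> n) (\<delta> n) \<and>
     exact_at (HD n) (HA (n - 1)) (HB (n - 1)) (\<delta> n) (\<alpha> (n - 1))"
proof -
  obtain \<alpha> where \<alpha>: "\<And>n. \<alpha> n \<in> hom (HA n) (HB n)" "\<And>n z. z \<in> A.cycles n \<Longrightarrow> \<alpha> n (A.cls n z) = B.cls n (f n z)"
    using \<alpha>_exists by metis
  obtain \<beta> where \<beta>: "\<And>n. \<beta> n \<in> hom (HB n) (HD n)" "\<And>n z. z \<in> B.cycles n \<Longrightarrow> \<beta> n (B.cls n z) = D.cls n (g n z)"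
    using \<beta>_exists by metis
  obtain \<delta> where \<delta>: "\<And>n. \<delta> n \<in> hom (HD n) (HA (n - 1))"
    "\<And>n z a. \<lbrakk>z \<in> D.cycles n; zigzag n z a\<rbrakk> \<Longrightarrow> \<delta> n (D.cls n z) = A.cls (n - 1) a"
    using \<delta>_exists by metis
  have gh: "group_hom (HA n) (HB n) (\<alpha> n)" "group_hom (HB n) (HD n) (\<beta> n)" "group_hom (HD n) (HA (n - 1)) (\<delta> n)" for n
    using \<alpha>(1) \<beta>(1) \<delta>(1) A.group_homology B.group_homology D.group_homology
    by (auto intro!: group_hom.intro group_hom_axioms.intro)
  have clsA: "A.cls n z \<in> carrier (HA n)" if "z \<in> A.cycles n" for n z using that by (rule A.cls_closed)
  have clsB: "B.cls n z \<in> carrier (HB n)" if "z \<in> B.cycles n" for n z using that by (rule B.cls_closed)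
  have clsD: "D.cls n z \<in> carrier (HD n)" if "z \<in> D.cycles n" for n z using that by (rule D.cls_closed)
  have oneA: "A.cls n \<one>\<^bsub>A n\<^esub> = \<one>\<^bsub>HA n\<^esub>" for n using group_hom.hom_one[OF A.cls_hom[of n]] by simp
  have oneD: "D.cls n \<one>\<^bsub>D n\<^esub> = \<one>\<^bsub>HD n\<^esub>" for n using group_hom.hom_one[OF D.cls_hom[of n]] by simp
  have 1: "\<alpha> n ` carrier (HA n) = kernel (HB n) (HD n) (\<beta> n)" for n
  proof (intro equalityI subsetI)
    fix y assume "y \<in> \<alpha> n ` carrier (HA n)"
    then obtain z where z: "z \<in> A.cycles n" "y = B.cls n (f n z)"
      unfolding A.cls_surj[symmetric] using \<alpha>(2) by auto
    have "g n (f n z) = \<one>\<^bsub>D n\<^esub>" using z gf by (simp add: A.in_cycles)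
    then show "y \<in> kernel (HB n) (HD n) (\<beta> n)"
      using z \<beta>(2)[OF f_cycle[OF z(1)]] clsB[OF f_cycle[OF z(1)]] oneD by (simp add: kernel_def)
  next
    fix y assume y: "y \<in> kernel (HB n) (HD n) (\<beta> n)"
    then obtain z where z: "z \<in> B.cycles n" "y = B.cls n z"
      unfolding kernel_def B.cls_surj[symmetric] by auto
    have "D.cls n (g n z) = \<one>\<^bsub>HD n\<^esub>" using y z \<beta>(2) by (simp add: kernel_def)
    then obtain w where w: "w \<in> carrier (D (n + 1))" "g n z = dD (n + 1) w"
      using D.cls_eq_one[OF g_cycle[OF z(1)]] by auto
    obtain b where b: "b \<in> carrier (B (n + 1))" "g (n + 1) b = w" using g_preimage[OF w(1)] by blast
    let ?db = "dB (n + 1) b"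
    have db: "?db \<in> B.cycles n" using B.boundary_in_cycles[OF b(1)] by simp
    have idb: "inv\<^bsub>B n\<^esub> ?db \<in> B.cycles n" using db by (simp add: B.in_cycles)
    have gdb: "g n ?db = g n z" using g_chain[OF b(1)] b w by simp
    have zc: "z \<in> carrier (B n)" "?db \<in> carrier (B n)" using z db by (simp_all add: B.in_cycles)
    \<comment> \<open>Since \<open>z\<close> and \<open>?db\<close> have the same image under
      \<open>g\<close>, their quotient comes from \<open>A\<close>; dividing by a boundary does not
      change the class of \<open>z\<close>.\<close>
    have "g n (z \<otimes>\<^bsub>B n\<^esub> inv\<^bsub>B n\<^esub> ?db) = \<one>\<^bsub>D n\<^esub>" using gdb zc by simp
    then obtain a where a: "a \<in> carrier (A n)" "z \<otimes>\<^bsub>B n\<^esub> inv\<^bsub>B n\<^esub> ?db = f n a"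
      using g_eq_one[of "z \<otimes>\<^bsub>B n\<^esub> inv\<^bsub>B n\<^esub> ?db" n] zc by auto
    have "f (n - 1) (dA n a) = \<one>\<^bsub>B (n - 1)\<^esub>"
      using f_chain[OF a(1)] a(2) B.cycle_mult[OF z(1) idb] by (simp add: B.in_cycles)
    then have ac: "a \<in> A.cycles n" using f_eq_one[OF A.boundary_in_carrier[OF a(1)]] a by (simp add: A.in_cycles)
    have "z = f n a \<otimes>\<^bsub>B n\<^esub> ?db" using zc by (simp add: a(2)[symmetric] B.m_assoc)
    then have "B.cls n z = B.cls n (f n a) \<otimes>\<^bsub>HB n\<^esub> B.cls n ?db" using B.cls_mult[OF f_cycle[OF ac] db] by simp
    also have "B.cls n ?db = \<one>\<^bsub>HB n\<^esub>" using B.cls_boundary[OF b(1)] by simp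
    finally have "y = \<alpha> n (A.cls n a)"
      using z(2) \<alpha>(2)[OF ac] clsB[OF f_cycle[OF ac]] by (simp add: B.group_homology group.is_monoid monoid.r_one)
    then show "y \<in> \<alpha> n ` carrier (HA n)" using clsA[OF ac] by blast
  qed
  have 2: "\<beta> n ` carrier (HB n) = kernel (HD n) (HA (n - 1)) (\<delta> n)" for n
  proof (intro equalityI subsetI)
    fix y assume "y \<in> \<beta> n ` carrier (HB n)"
    then obtain z where z: "z \<in> B.cycles n" "y = D.cls n (g n z)"
      unfolding B.cls_surj[symmetric] using \<beta>(2) by auto
    have "zigzag n (g n z) \<one>\<^bsub>A (n - 1)\<^esub>" unfolding zigzag_def using z by (auto simp: B.in_cycles)
    then show "y \<in> kernel (HD n) (HA (n - 1)) (\<delta> n)"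
      using z \<delta>(2)[OF g_cycle[OF z(1)]] clsD[OF g_cycle[OF z(1)]] oneA by (simp add: kernel_def)
  next
    fix y assume y: "y \<in> kernel (HD n) (HA (n - 1)) (\<delta> n)"
    then obtain z where z: "z \<in> D.cycles n" "y = D.cls n z"
      unfolding kernel_def D.cls_surj[symmetric] by auto
    obtain a where a: "zigzag n z a" using zigzag_exists[OF z(1)] by blast
    have "A.cls (n - 1) a = \<one>\<^bsub>HA (n - 1)\<^esub>" using y z \<delta>(2)[OF z(1) a] by (simp add: kernel_def)
    then obtain w where w: "w \<in> carrier (A n)" "a = dA n w"
      using A.cls_eq_one[OF zigzag_cycle[OF a]] by auto
    obtain b where b: "b \<in> carrier (B n)" "g n b = z" "f (n - 1) a = dB n b" using a by (auto simp: zigzag_def)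
    \<comment> \<open>The lift \<open>b\<close> is corrected by \<open>f n w\<close>. This cancels
      its boundary and leaves its image under \<open>g\<close> unchanged.\<close>
    let ?b = "b \<otimes>\<^bsub>B n\<^esub> inv\<^bsub>B n\<^esub> f n w"
    have "dB n (f n w) = dB n b" using f_chain[OF w(1)] w b by simp
    then have bc: "?b \<in> B.cycles n" using b w by (simp add: B.in_cycles)
    moreover have "g n ?b = z" using b w gf[OF w(1)] z(1) by (simp add: D.in_cycles)
    ultimately have "y = \<beta> n (B.cls n ?b)" using \<beta>(2)[OF bc] z by simp
    then show "y \<in> \<beta> n ` carrier (HB n)" using clsB[OF bc] by blast
  qed
  have 3: "\<delta> n ` carrier (HD n) = kernel (HA (n - 1)) (HB (n - 1)) (\<alpha> (n - 1))" for n
  proof (intro equalityI subsetI)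
    fix y assume "y \<in> \<delta> n ` carrier (HD n)"
    then obtain z where z: "z \<in> D.cycles n" "y = \<delta> n (D.cls n z)"
      unfolding D.cls_surj[symmetric] by auto
    obtain a where a: "zigzag n z a" using zigzag_exists[OF z(1)] by blast
    obtain b where b: "b \<in> carrier (B n)" "f (n - 1) a = dB n b" using a by (auto simp: zigzag_def)
    have "\<alpha> (n - 1) y = B.cls (n - 1) (dB n b)"
      using z(2) \<delta>(2)[OF z(1) a] \<alpha>(2)[OF zigzag_cycle[OF a]] b by simp
    then show "y \<in> kernel (HA (n - 1)) (HB (n - 1)) (\<alpha> (n - 1))"
      using z(2) \<delta>(2)[OF z(1) a] clsA[OF zigzag_cycle[OF a]] B.cls_boundary[OF b(1)] by (simp add: kernel_def)
  next
    fix y assume y: "y \<in> kernel (HA (n - 1)) (HB (n - 1)) (\<alpha> (n - 1))"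
    then obtain a where a: "a \<in> A.cycles (n - 1)" "y = A.cls (n - 1) a"
      unfolding kernel_def A.cls_surj[symmetric] by auto
    have "B.cls (n - 1) (f (n - 1) a) = \<one>\<^bsub>HB (n - 1)\<^esub>" using y a \<alpha>(2) by (simp add: kernel_def)
    then obtain b where b: "b \<in> carrier (B n)" "f (n - 1) a = dB n b"
      using B.cls_eq_one[OF f_cycle[OF a(1)]] by auto
    have "dD n (g n b) = \<one>\<^bsub>D (n - 1)\<^esub>"
      using g_chain[OF b(1)] b(2) gf[of a "n - 1"] a(1) by (simp add: A.in_cycles)
    then have gb: "g n b \<in> D.cycles n" using b by (simp add: D.in_cycles)
    moreover have "zigzag n (g n b) a" using a b by (auto simp: zigzag_def A.in_cycles)
    ultimately have "y = \<delta> n (D.cls n (g n b))" using \<delta>(2) a by simp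
    then show "y \<in> \<delta> n ` carrier (HD n)" using clsD[OF gb] by blast
  qed
  show ?thesis
    by (intro exI[of _ \<alpha>] exI[of _ \<beta>] exI[of _ \<delta>] allI) (simp add: exact_at_def gh 1 2 3)
qed

end

section \<open>Tensor products with cyclic groups\<close>

abbreviation tensor_free :: "'m monoid \<Rightarrow> 'b monoid \<Rightarrow> ('m \<times> 'b \<Rightarrow>\<^sub>0 int) monoid" where
  "tensor_free M A \<equiv> free_Abelian_group (carrier M \<times> carrier A)"

definition tensor_class :: "'m monoid \<Rightarrow> 'b monoid \<Rightarrow> ('m \<times> 'b \<Rightarrow>\<^sub>0 int) \<Rightarrow> ('m \<times> 'b \<Rightarrow>\<^sub>0 int) set" where
  "tensor_class M A z = tensor_kernel M A #>\<^bsub>tensor_free M A\<^esub> z"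

locale tensor = M: comm_group M + A: comm_group A for M :: "'m monoid" and A :: "'b monoid"
begin

sublocale F: comm_group "tensor_free M A" by (rule abelian_free_Abelian_group)

lemma relations_subset: "tensor_relations M A \<subseteq> carrier (tensor_free M A)"
proof -
  have "frag_of u - frag_of v - frag_of w \<in> carrier (tensor_free M A)"
    if "u \<in> carrier M \<times> carrier A" "v \<in> carrier M \<times> carrier A" "w \<in> carrier M \<times> carrier A" for u v w
  proof -
    have "Poly_Mapping.keys (frag_of u - frag_of v - frag_of w) \<subseteq> {u} \<union> {v} \<union> {w}"
      using keys_diff[of "frag_of u - frag_of v" "frag_of w"] keys_diff[of "frag_of u" "frag_of v"]
      by (auto simp: keys_frag_of)
    then show ?thesis using that by auto
  qed
  then show ?thesis unfolding tensor_relations_def by auto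
qed

lemma relationI:
  "\<lbrakk>x \<in> carrier M; y \<in> carrier M; a \<in> carrier A\<rbrakk>
    \<Longrightarrow> frag_of (x \<otimes>\<^bsub>M\<^esub> y, a) - frag_of (x, a) - frag_of (y, a) \<in> tensor_relations M A"
  "\<lbrakk>x \<in> carrier M; a \<in> carrier A; b \<in> carrier A\<rbrakk>
    \<Longrightarrow> frag_of (x, a \<otimes>\<^bsub>A\<^esub> b) - frag_of (x, a) - frag_of (x, b) \<in> tensor_relations M A"
  unfolding tensor_relations_def by blast+

lemma relation_cases:
  assumes "r \<in> tensor_relations M A"
  obtains x y a where "r = frag_of (x \<otimes>\<^bsub>M\<^esub> y, a) - frag_of (x, a) - frag_of (y, a)"
      "x \<in> carrier M" "y \<in> carrier M" "a \<in> carrier A"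
    | x a b where "r = frag_of (x, a \<otimes>\<^bsub>A\<^esub> b) - frag_of (x, a) - frag_of (x, b)"
      "x \<in> carrier M" "a \<in> carrier A" "b \<in> carrier A"
  using assms unfolding tensor_relations_def by blast

lemma subgroup_tensor_kernel: "subgroup (tensor_kernel M A) (tensor_free M A)"
  unfolding tensor_kernel_def by (rule F.generate_is_subgroup[OF relations_subset])

lemma normal_tensor_kernel: "tensor_kernel M A \<lhd> tensor_free M A"
  using F.normal_iff_subgroup subgroup_tensor_kernel by blast

lemma comm_group_tensor: "comm_group (tensor_product M A)"
  unfolding tensor_product_def by (rule F.abelian_FactGroup[OF subgroup_tensor_kernel])

sublocale T: comm_group "tensor_product M A" by (rule comm_group_tensor)

sublocale c: group_hom "tensor_free M A" "tensor_product M A" "tensor_class M A"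
  unfolding tensor_class_def[abs_def]
  by (intro group_hom.intro group_hom_axioms.intro F.is_group T.is_group,
      unfold tensor_product_def, rule normal.r_coset_hom_Mod[OF normal_tensor_kernel])

lemma tensor_class_surj: "tensor_class M A ` carrier (tensor_free M A) = carrier (tensor_product M A)"
  unfolding tensor_product_def carrier_FactGroup tensor_class_def[abs_def] ..

lemma tensor_class_cases:
  assumes "c \<in> carrier (tensor_product M A)"
  obtains z where "z \<in> carrier (tensor_free M A)" "c = tensor_class M A z"
  using assms unfolding tensor_class_surj[symmetric] by (rule imageE) (rule that)

lemma tensor_class_eq_one:
  assumes "z \<in> carrier (tensor_free M A)"
  shows "tensor_class M A z = \<one>\<^bsub>tensor_product M A\<^esub> \<longleftrightarrow> z \<in> tensor_kernel M A"
proof -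
  have "tensor_class M A z = \<one>\<^bsub>tensor_product M A\<^esub> \<longleftrightarrow> tensor_kernel M A #>\<^bsub>tensor_free M A\<^esub> z = tensor_kernel M A"
    by (simp add: tensor_product_def FactGroup_def tensor_class_def)
  also have "\<dots> \<longleftrightarrow> z \<in> tensor_kernel M A"
    using F.rcos_self[OF assms subgroup_tensor_kernel] F.coset_join2[OF assms subgroup_tensor_kernel] by auto
  finally show ?thesis .
qed

lemma relation_trivial: "r \<in> tensor_relations M A \<Longrightarrow> tensor_class M A r = \<one>\<^bsub>tensor_product M A\<^esub>"
  using tensor_class_eq_one relations_subset unfolding tensor_kernel_def
  by (meson generate.incl subsetD)

definition pure :: "'m \<Rightarrow> 'b \<Rightarrow> ('m \<times> 'b \<Rightarrow>\<^sub>0 int) set" where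
  "pure x a = tensor_class M A (frag_of (x, a))"

lemma pure_closed: "\<lbrakk>x \<in> carrier M; a \<in> carrier A\<rbrakk> \<Longrightarrow> pure x a \<in> carrier (tensor_product M A)"
  unfolding pure_def by (rule c.hom_closed) simp

lemma tensor_class_diff:
  assumes "u \<in> carrier (tensor_free M A)" "v \<in> carrier (tensor_free M A)"
  shows "tensor_class M A (u - v) = tensor_class M A u \<otimes>\<^bsub>tensor_product M A\<^esub> inv\<^bsub>tensor_product M A\<^esub> tensor_class M A v"
proof -
  have "- v \<in> carrier (tensor_free M A)" using assms by simp
  moreover have "tensor_class M A (- v) = inv\<^bsub>tensor_product M A\<^esub> tensor_class M A v"
    using c.hom_inv[OF assms(2)] assms(2) by simp
  ultimately show ?thesis using c.hom_mult[OF assms(1), of "- v"] by simp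
qed

lemma split_relation:
  assumes r: "frag_of u - frag_of v - frag_of w \<in> tensor_relations M A"
    and uvw: "u \<in> carrier M \<times> carrier A" "v \<in> carrier M \<times> carrier A" "w \<in> carrier M \<times> carrier A"
  shows "tensor_class M A (frag_of u) = tensor_class M A (frag_of v) \<otimes>\<^bsub>tensor_product M A\<^esub> tensor_class M A (frag_of w)"
proof -
  let ?c = "\<lambda>u. tensor_class M A (frag_of u)"
  have F: "frag_of x \<in> carrier (tensor_free M A)" if "x \<in> carrier M \<times> carrier A" for x using that by simp
  have vw: "frag_of v + frag_of w \<in> carrier (tensor_free M A)"
    using F.m_closed[OF F[OF uvw(2)] F[OF uvw(3)]] by simp
  have "tensor_class M A (frag_of u - (frag_of v + frag_of w)) = \<one>\<^bsub>tensor_product M A\<^esub>"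
    using relation_trivial[OF r] by (simp add: diff_diff_eq)
  then have "?c u \<otimes>\<^bsub>tensor_product M A\<^esub> inv\<^bsub>tensor_product M A\<^esub> tensor_class M A (frag_of v + frag_of w) = \<one>\<^bsub>tensor_product M A\<^esub>"
    using tensor_class_diff[OF F[OF uvw(1)] vw] by simp
  then have "?c u = tensor_class M A (frag_of v + frag_of w)"
    using T.inv_solve_right'[of "\<one>\<^bsub>tensor_product M A\<^esub>" "?c u" "tensor_class M A (frag_of v + frag_of w)"]
      c.hom_closed[OF F[OF uvw(1)]] c.hom_closed[OF vw] by simp
  then show ?thesis using c.hom_mult[OF F[OF uvw(2)] F[OF uvw(3)]] by simp
qed

lemma pure_mult_left:
  assumes "x \<in> carrier M" "y \<in> carrier M" "a \<in> carrier A"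
  shows "pure (x \<otimes>\<^bsub>M\<^esub> y) a = pure x a \<otimes>\<^bsub>tensor_product M A\<^esub> pure y a"
  unfolding pure_def by (rule split_relation) (use assms in \<open>auto simp: tensor_relations_def\<close>)

lemma pure_mult_right:
  assumes "x \<in> carrier M" "a \<in> carrier A" "b \<in> carrier A"
  shows "pure x (a \<otimes>\<^bsub>A\<^esub> b) = pure x a \<otimes>\<^bsub>tensor_product M A\<^esub> pure x b"
  unfolding pure_def by (rule split_relation) (use assms in \<open>auto simp: tensor_relations_def\<close>)

lemma pure_hom_left: "a \<in> carrier A \<Longrightarrow> group_hom M (tensor_product M A) (\<lambda>x. pure x a)"
  by (intro group_hom.intro group_hom_axioms.intro M.is_group T.is_group homI) (simp_all add: pure_closed pure_mult_left)

lemma pure_hom_right: "x \<in> carrier M \<Longrightarrow> group_hom A (tensor_product M A) (pure x)"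
  by (intro group_hom.intro group_hom_axioms.intro A.is_group T.is_group homI) (simp_all add: pure_closed pure_mult_right)

text \<open>The universal property: \<open>k\<close> extends to the free group on pairs, and
  bilinearity makes the extension vanish on the generating relations and hence on
  \<open>tensor_kernel\<close>.\<close>

lemma tensor_hom_exists:
  assumes K: "comm_group K"
    and k: "\<And>x a. \<lbrakk>x \<in> carrier M; a \<in> carrier A\<rbrakk> \<Longrightarrow> k x a \<in> carrier K"
    and l: "\<And>x y a. \<lbrakk>x \<in> carrier M; y \<in> carrier M; a \<in> carrier A\<rbrakk> \<Longrightarrow> k (x \<otimes>\<^bsub>M\<^esub> y) a = k x a \<otimes>\<^bsub>K\<^esub> k y a"
    and r: "\<And>x a b. \<lbrakk>x \<in> carrier M; a \<in> carrier A; b \<in> carrier A\<rbrakk> \<Longrightarrow> k x (a \<otimes>\<^bsub>A\<^esub> b) = k x a \<otimes>\<^bsub>K\<^esub> k x b"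
  obtains \<psi> where "\<psi> \<in> hom (tensor_product M A) K"
    "\<And>x a. \<lbrakk>x \<in> carrier M; a \<in> carrier A\<rbrakk> \<Longrightarrow> \<psi> (pure x a) = k x a"
proof -
  interpret K: comm_group K by (rule K)
  have im: "(\<lambda>(x, a). k x a) ` (carrier M \<times> carrier A) \<subseteq> carrier K" using k by auto
  obtain h where h: "h \<in> hom (tensor_free M A) K"
    and hk: "\<And>u. u \<in> carrier M \<times> carrier A \<Longrightarrow> h (frag_of u) = (\<lambda>(x, a). k x a) u"
    using K.free_Abelian_group_universal[OF im] by blast
  interpret h: group_hom "tensor_free M A" K h
    by (intro group_hom.intro group_hom_axioms.intro F.is_group K.is_group h)
  have hdiff: "h (frag_of u - frag_of v - frag_of w) = \<one>\<^bsub>K\<^esub>"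
    if "u \<in> carrier M \<times> carrier A" "v \<in> carrier M \<times> carrier A" "w \<in> carrier M \<times> carrier A"
      "h (frag_of u) = h (frag_of v) \<otimes>\<^bsub>K\<^esub> h (frag_of w)" for u v w
  proof -
    have F: "frag_of x \<in> carrier (tensor_free M A)" "- frag_of x \<in> carrier (tensor_free M A)"
      if "x \<in> carrier M \<times> carrier A" for x using that by simp_all
    have inv: "h (- frag_of x) = inv\<^bsub>K\<^esub> h (frag_of x)" if "x \<in> carrier M \<times> carrier A" for x
      using h.hom_inv[OF F(1)[OF that]] that by simp
    have uv: "frag_of u + - frag_of v \<in> carrier (tensor_free M A)"
      using F.m_closed[OF F(1)[OF that(1)] F(2)[OF that(2)]] by simp
    have "h (frag_of u + - frag_of v + - frag_of w) = h (frag_of u) \<otimes>\<^bsub>K\<^esub> inv\<^bsub>K\<^esub> h (frag_of v) \<otimes>\<^bsub>K\<^esub> inv\<^bsub>K\<^esub> h (frag_of w)"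
      using h.hom_mult[OF uv F(2)[OF that(3)]] h.hom_mult[OF F(1)[OF that(1)] F(2)[OF that(2)]] inv that by simp
    also have "\<dots> = \<one>\<^bsub>K\<^esub>"
      using h.hom_closed[OF F(1)[OF that(2)]] h.hom_closed[OF F(1)[OF that(3)]] unfolding that(4)
      by (metis K.inv_mult K.m_assoc K.inv_closed K.m_closed K.r_inv)
    finally show ?thesis by simp
  qed
  have rel: "h r = \<one>\<^bsub>K\<^esub>" if r': "r \<in> tensor_relations M A" for r
  proof -
    show ?thesis
      using r'
    proof (cases rule: relation_cases)
      case 1
      then show ?thesis unfolding 1(1) by (intro hdiff) (simp_all add: hk l)
    next
      case 2
      then show ?thesis unfolding 2(1) by (intro hdiff) (simp_all add: hk r)
    qed
  qed
  have "tensor_kernel M A \<subseteq> kernel (tensor_free M A) K h"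
    unfolding tensor_kernel_def
    by (rule F.generate_subgroup_incl[OF _ h.subgroup_kernel])
       (intro subsetI, simp only: kernel_def mem_Collect_eq rel subsetD[OF relations_subset] simp_thms)
  then have kerh: "h z = \<one>\<^bsub>K\<^esub>" if "z \<in> carrier (tensor_free M A)" "tensor_class M A z = \<one>\<^bsub>tensor_product M A\<^esub>" for z
    using that tensor_class_eq_one by (auto simp: kernel_def)
  have "\<exists>\<psi>\<in>hom (tensor_product M A) K. \<forall>z\<in>carrier (tensor_free M A). \<psi> (tensor_class M A z) = h z"
    by (rule hom_factor[OF F.is_group K.is_group c.homh tensor_class_surj h T.is_group kerh])
  then obtain \<psi> where \<psi>: "\<psi> \<in> hom (tensor_product M A) K"
      "\<And>z. z \<in> carrier (tensor_free M A) \<Longrightarrow> \<psi> (tensor_class M A z) = h z"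
    by blast
  show thesis
  proof (rule that[OF \<psi>(1)])
    fix x a assume xa: "x \<in> carrier M" "a \<in> carrier A"
    then show "\<psi> (pure x a) = k x a" unfolding pure_def using \<psi>(2)[of "frag_of (x, a)"] hk[of "(x, a)"] by simp
  qed
qed

end

text \<open>The extension of \<open>f\<close> to free groups sends relations to relations. All
  members of the coset thus contribute the same class, and the union in \<open>tensor_map\<close>
  collapses to that class.\<close>

lemma tensor_map_class:
  assumes M: "comm_group M" and N: "comm_group N" and A: "comm_group A" and f: "f \<in> hom M N"
    and z: "z \<in> carrier (tensor_free M A)"
  shows "tensor_map N A f (tensor_class M A z) = tensor_class N A (frag_extend (\<lambda>(x, a). frag_of (f x, a)) z)"
proof -
  interpret M: tensor M A by (intro tensor.intro M A)
  interpret N: tensor N A by (intro tensor.intro N A)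
  interpret f: group_hom M N f by (intro group_hom.intro group_hom_axioms.intro M.M.is_group N.M.is_group f)
  let ?e = "frag_extend (\<lambda>(x, a). frag_of (f x, a))"
  have e_closed: "?e z \<in> carrier (tensor_free N A)" if "z \<in> carrier (tensor_free M A)" for z
  proof -
    have "Poly_Mapping.keys (?e z) \<subseteq> (\<Union>u\<in>Poly_Mapping.keys z. Poly_Mapping.keys ((\<lambda>(x, a). frag_of (f x, a)) u))"
      by (rule keys_frag_extend)
    also have "\<dots> \<subseteq> carrier N \<times> carrier A" using that by (auto simp: keys_frag_of)
    finally show ?thesis by simp
  qed
  have "?e \<in> hom (tensor_free M A) (tensor_free N A)"
    by (rule homI[OF e_closed]) (simp_all add: frag_extend_add)
  then have h: "tensor_class N A \<circ> ?e \<in> hom (tensor_free M A) (tensor_product N A)"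
    using N.c.homh by (rule hom_compose)
  interpret h: group_hom "tensor_free M A" "tensor_product N A" "tensor_class N A \<circ> ?e"
    by (intro group_hom.intro group_hom_axioms.intro M.F.is_group N.T.is_group h)
  have ker: "tensor_kernel M A \<subseteq> kernel (tensor_free M A) (tensor_product N A) (tensor_class N A \<circ> ?e)"
    unfolding tensor_kernel_def
  proof (rule M.F.generate_subgroup_incl[OF _ h.subgroup_kernel], rule subsetI)
    fix r assume r: "r \<in> tensor_relations M A"
    then have "?e r \<in> tensor_relations N A"
    proof (cases rule: M.relation_cases)
      case (1 x y a)
      then show ?thesis using N.relationI(1)[of "f x" "f y" a] by (simp add: frag_extend_diff)
    next
      case (2 x a b)
      then show ?thesis using N.relationI(2)[of "f x" a b] by (simp add: frag_extend_diff)
    qed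
    then show "r \<in> kernel (tensor_free M A) (tensor_product N A) (tensor_class N A \<circ> ?e)"
      using subsetD[OF M.relations_subset r] N.relation_trivial[of "?e r"]
      by (simp only: kernel_def mem_Collect_eq o_apply simp_thms)
  qed
  have const: "tensor_class N A (?e w) = tensor_class N A (?e z)" if w: "w \<in> tensor_class M A z" for w
  proof -
    obtain k where k: "k \<in> tensor_kernel M A" "w = k + z"
      using w unfolding tensor_class_def r_coset_def by auto
    have "k \<in> carrier (tensor_free M A)" "(tensor_class N A \<circ> ?e) k = \<one>\<^bsub>tensor_product N A\<^esub>"
      using k ker by (auto simp: kernel_def)
    then have "(tensor_class N A \<circ> ?e) (k \<otimes>\<^bsub>tensor_free M A\<^esub> z) = (tensor_class N A \<circ> ?e) z"
      using h.hom_mult[OF _ z] h.hom_closed[OF z] by simp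
    then show ?thesis using k by simp
  qed
  have "z \<in> tensor_class M A z"
    unfolding tensor_class_def by (rule M.F.rcos_self[OF z M.subgroup_tensor_kernel])
  then show ?thesis
    unfolding tensor_map_def tensor_class_def[of N A, symmetric] using const by blast
qed

lemma tensor_map_pure:
  assumes "comm_group M" "comm_group N" "comm_group A" "f \<in> hom M N" "x \<in> carrier M" "a \<in> carrier A"
  shows "tensor_map N A f (tensor.pure M A x a) = tensor.pure N A (f x) a"
  using tensor_map_class[OF assms(1-4), of "frag_of (x, a)"] assms
  by (simp add: tensor.pure_def[OF tensor.intro])

lemma tensor_map_hom:
  assumes M: "comm_group M" and N: "comm_group N" and A: "comm_group A" and f: "f \<in> hom M N"
  shows "tensor_map N A f \<in> hom (tensor_product M A) (tensor_product N A)"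
proof -
  interpret M: tensor M A by (intro tensor.intro M A)
  interpret N: tensor N A by (intro tensor.intro N A)
  let ?e = "frag_extend (\<lambda>(x, a). frag_of (f x, a))"
  have e_closed: "?e z \<in> carrier (tensor_free N A)" if "z \<in> carrier (tensor_free M A)" for z
  proof -
    have "Poly_Mapping.keys (?e z) \<subseteq> (\<Union>u\<in>Poly_Mapping.keys z. Poly_Mapping.keys ((\<lambda>(x, a). frag_of (f x, a)) u))"
      by (rule keys_frag_extend)
    also have "\<dots> \<subseteq> carrier N \<times> carrier A"
    proof (rule UN_least)
      fix u assume "u \<in> Poly_Mapping.keys z"
      then have "u \<in> carrier M \<times> carrier A" using that by auto
      then show "Poly_Mapping.keys ((\<lambda>(x, a). frag_of (f x, a)) u) \<subseteq> carrier N \<times> carrier A"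
        using hom_in_carrier[OF f] by (auto simp: keys_frag_of)
    qed
    finally show ?thesis by simp
  qed
  note cl = tensor_map_class[OF M N A f]
  show ?thesis
  proof (rule homI)
    fix c assume "c \<in> carrier (tensor_product M A)"
    then obtain z where "z \<in> carrier (tensor_free M A)" "c = tensor_class M A z"
      by (rule M.tensor_class_cases)
    then show "tensor_map N A f c \<in> carrier (tensor_product N A)"
      using cl N.c.hom_closed[OF e_closed] by simp
  next
    fix c c' assume c: "c \<in> carrier (tensor_product M A)" "c' \<in> carrier (tensor_product M A)"
    obtain z where z1: "z \<in> carrier (tensor_free M A)" "c = tensor_class M A z"
      by (rule M.tensor_class_cases[OF c(1)])
    obtain z' where z2: "z' \<in> carrier (tensor_free M A)" "c' = tensor_class M A z'"
      by (rule M.tensor_class_cases[OF c(2)])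
    note z = z1 z2
    have "c \<otimes>\<^bsub>tensor_product M A\<^esub> c' = tensor_class M A (z + z')"
      using M.c.hom_mult[OF z(1,3)] z by simp
    then show "tensor_map N A f (c \<otimes>\<^bsub>tensor_product M A\<^esub> c') = tensor_map N A f c \<otimes>\<^bsub>tensor_product N A\<^esub> tensor_map N A f c'"
      using cl[OF M.F.m_closed[OF z(1,3)]] cl[OF z(1)] cl[OF z(3)] z(2,4)
        N.c.hom_mult[OF e_closed[OF z(1)] e_closed[OF z(3)]] by (simp add: frag_extend_add)
  qed
qed

text \<open>\<open>m = 0\<close> is the case of integer coefficients.\<close>

definition tens :: "nat \<Rightarrow> 'm monoid \<Rightarrow> 'm \<Rightarrow> ('m \<times> int \<Rightarrow>\<^sub>0 int) set" where
  "tens m M x = tensor.pure M (integer_mod_group m) x 1"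

context
  fixes m :: nat and M :: "'m monoid"
  assumes m: "m \<noteq> 1" and M: "comm_group M"
begin

interpretation tensor M "integer_mod_group m"
  by (intro tensor.intro M abelian_integer_mod_group)

text \<open>For \<open>m = 1\<close> the carrier is \<open>{0}\<close>; excluding this value keeps
  the representative 1 available as a generator of the coefficient group.\<close>

lemma one_mem: "1 \<in> carrier (integer_mod_group m)"
  using m by simp

lemma tens_hom: "group_hom M (tensor_product M (integer_mod_group m)) (tens m M)"
  unfolding tens_def[abs_def] by (rule pure_hom_left[OF one_mem])

text \<open>The coefficient \<open>k\<close> is the \<open>k\<close>-th power of the generator 1,
  and bilinearity moves the exponent to the left factor.\<close>

lemma pure_eq_tens:
  assumes "x \<in> carrier M" "k \<in> carrier (integer_mod_group m)"
  shows "pure x k = tens m M (x [^]\<^bsub>M\<^esub> k)"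
proof -
  interpret l: group_hom M "tensor_product M (integer_mod_group m)" "tens m M" by (rule tens_hom)
  interpret r: group_hom "integer_mod_group m" "tensor_product M (integer_mod_group m)" "pure x"
    by (rule pure_hom_right[OF assms(1)])
  \<comment> \<open>Powers are reduced modulo \<open>m\<close>, which changes nothing for
    \<open>k\<close> in the carrier.\<close>
  have "1 [^]\<^bsub>integer_mod_group m\<^esub> k = k"
    using assms(2) by (auto simp: int_pow_integer_mod_group carrier_integer_mod_group split: if_splits)
  then have "pure x k = pure x 1 [^]\<^bsub>tensor_product M (integer_mod_group m)\<^esub> k"
    using r.hom_int_pow[OF one_mem, of k] by simp
  also have "\<dots> = tens m M (x [^]\<^bsub>M\<^esub> k)"
    using l.hom_int_pow[OF assms(1), of k] by (simp add: tens_def)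
  finally show ?thesis .
qed

text \<open>Each pure tensor has the form \<open>tens m M x\<close>, and the image of a homomorphism
  is closed under quotients. Statements about a tensor product with a cyclic group can thus be
  checked on elements of \<open>M\<close>.\<close>

lemma tens_surj: "tens m M ` carrier M = carrier (tensor_product M (integer_mod_group m))"
proof -
  interpret l: group_hom M "tensor_product M (integer_mod_group m)" "tens m M" by (rule tens_hom)
  have "tensor_class M (integer_mod_group m) z \<in> tens m M ` carrier M"
    if "z \<in> carrier (tensor_free M (integer_mod_group m))" for z
  proof -
    have "Poly_Mapping.keys z \<subseteq> carrier M \<times> carrier (integer_mod_group m)" using that by simp
    then show ?thesis
    proof (induction z rule: free_Abelian_group_induct[consumes 1])
      case 1
      have "tensor_class M (integer_mod_group m) 0 = tens m M \<one>\<^bsub>M\<^esub>" using l.hom_one c.hom_one by simp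
      then show ?case by (rule image_eqI[OF _ M.one_closed])
    next
      case (2 u v)
      obtain x where x: "tensor_class M (integer_mod_group m) u = tens m M x" "x \<in> carrier M"
        using 2(3) by (rule imageE)
      obtain y where y: "tensor_class M (integer_mod_group m) v = tens m M y" "y \<in> carrier M"
        using 2(4) by (rule imageE)
      note xy = x y
      have "tensor_class M (integer_mod_group m) (u - v) = tens m M (x \<otimes>\<^bsub>M\<^esub> inv\<^bsub>M\<^esub> y)"
        using tensor_class_diff[of u v] 2(1,2) xy by simp
      then show ?case by (rule image_eqI) (use xy in simp)
    next
      case (3 u)
      then have "tensor_class M (integer_mod_group m) (frag_of u) = tens m M (fst u [^]\<^bsub>M\<^esub> snd u)"
        using pure_eq_tens[of "fst u" "snd u"] by (auto simp: pure_def)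
      moreover have "fst u [^]\<^bsub>M\<^esub> snd u \<in> carrier M" using 3 by (auto intro: M.int_pow_closed)
      ultimately show ?case by (rule image_eqI)
    qed
  qed
  then have "carrier (tensor_product M (integer_mod_group m)) \<subseteq> tens m M ` carrier M"
    unfolding tensor_class_surj[symmetric] by (rule image_subsetI)
  then show ?thesis using l.hom_closed by (intro equalityI image_subsetI)
qed

text \<open>The isomorphism of the tensor product with \<open>M\<close> modulo its
  \<open>m\<close>-th powers. An \<open>m\<close>-th power dies because the exponent moves to the
  coefficient. Conversely, sending a pair of \<open>y\<close> and \<open>k\<close> to the class of
  \<open>y [^] k\<close> is bilinear, and the induced map recovers the class of \<open>x\<close>
  from \<open>tens m M x\<close>.\<close>

lemma tens_eq_one_iff:
  assumes x: "x \<in> carrier M"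
  shows "tens m M x = \<one>\<^bsub>tensor_product M (integer_mod_group m)\<^esub> \<longleftrightarrow> (\<exists>y\<in>carrier M. x = y [^]\<^bsub>M\<^esub> m)"
proof
  interpret l: group_hom M "tensor_product M (integer_mod_group m)" "tens m M" by (rule tens_hom)
  assume "\<exists>y\<in>carrier M. x = y [^]\<^bsub>M\<^esub> m"
  then obtain y where y: "y \<in> carrier M" "x = y [^]\<^bsub>M\<^esub> m" by blast
  interpret r: group_hom "integer_mod_group m" "tensor_product M (integer_mod_group m)" "pure y"
    by (rule pure_hom_right[OF y(1)])
  have "tens m M x = pure y 1 [^]\<^bsub>tensor_product M (integer_mod_group m)\<^esub> m"
    using l.hom_nat_pow[OF y(1)] y by (simp add: tens_def)
  also have "\<dots> = pure y (1 [^]\<^bsub>integer_mod_group m\<^esub> m)" using r.hom_nat_pow[OF one_mem, of m] by simp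
  also have "1 [^]\<^bsub>integer_mod_group m\<^esub> m = \<one>\<^bsub>integer_mod_group m\<^esub>" by simp
  finally show "tens m M x = \<one>\<^bsub>tensor_product M (integer_mod_group m)\<^esub>" unfolding r.hom_one .
next
  assume one: "tens m M x = \<one>\<^bsub>tensor_product M (integer_mod_group m)\<^esub>"
  let ?P = "(\<lambda>y. y [^]\<^bsub>M\<^esub> m) ` carrier M"
  have "(\<lambda>y. y [^]\<^bsub>M\<^esub> m) \<in> hom M M"
    by (rule homI) (simp_all add: M.nat_pow_distrib)
  then interpret pw: group_hom M M "\<lambda>y. y [^]\<^bsub>M\<^esub> m"
    by (intro group_hom.intro group_hom_axioms.intro M.is_group)
  have P: "subgroup ?P M" by (rule pw.img_is_subgroup)
  have nP: "?P \<lhd> M" using M.normal_iff_subgroup P by blast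
  interpret Q: comm_group "M Mod ?P" by (rule M.abelian_FactGroup[OF P])
  let ?c = "\<lambda>y. ?P #>\<^bsub>M\<^esub> y"
  interpret cl: group_hom M "M Mod ?P" ?c
    by (intro group_hom.intro group_hom_axioms.intro M.is_group Q.is_group normal.r_coset_hom_Mod[OF nP])
  have c1: "?c y = \<one>\<^bsub>M Mod ?P\<^esub> \<longleftrightarrow> y \<in> ?P" if "y \<in> carrier M" for y
    using M.rcos_self[OF that P] M.coset_join2[OF that P] by (auto simp: FactGroup_def)
  \<comment> \<open>Addition of coefficients reduces modulo \<open>m\<close>; the exponents lost are
    multiples of \<open>m\<close>, so they vanish in the quotient.\<close>
  have powP: "?c (y [^]\<^bsub>M\<^esub> (k mod int m)) = ?c (y [^]\<^bsub>M\<^esub> k)" if y: "y \<in> carrier M" for y and k :: int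
  proof -
    have "k = k mod int m + int m * (k div int m)" by simp
    then have "y [^]\<^bsub>M\<^esub> k = y [^]\<^bsub>M\<^esub> (k mod int m) \<otimes>\<^bsub>M\<^esub> y [^]\<^bsub>M\<^esub> (int m * (k div int m))"
      using M.int_pow_mult[OF y] by metis
    also have "y [^]\<^bsub>M\<^esub> (int m * (k div int m)) = (y [^]\<^bsub>M\<^esub> (k div int m)) [^]\<^bsub>M\<^esub> m"
      using y by (simp add: M.int_pow_pow int_pow_int[symmetric] mult.commute)
    finally have "?c (y [^]\<^bsub>M\<^esub> k) = ?c (y [^]\<^bsub>M\<^esub> (k mod int m)) \<otimes>\<^bsub>M Mod ?P\<^esub> ?c ((y [^]\<^bsub>M\<^esub> (k div int m)) [^]\<^bsub>M\<^esub> m)"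
      using y cl.hom_mult by simp
    moreover have "?c ((y [^]\<^bsub>M\<^esub> (k div int m)) [^]\<^bsub>M\<^esub> m) = \<one>\<^bsub>M Mod ?P\<^esub>"
      using c1 y by simp
    moreover have "?c (y [^]\<^bsub>M\<^esub> (k mod int m)) \<in> carrier (M Mod ?P)"
      by (rule cl.hom_closed) (use y in simp)
    ultimately show ?thesis by (simp only: Q.r_one)
  qed
  obtain \<psi> where \<psi>: "\<psi> \<in> hom (tensor_product M (integer_mod_group m)) (M Mod ?P)"
    "\<And>y k. \<lbrakk>y \<in> carrier M; k \<in> carrier (integer_mod_group m)\<rbrakk> \<Longrightarrow> \<psi> (pure y k) = ?c (y [^]\<^bsub>M\<^esub> k)"
  proof (rule tensor_hom_exists[OF Q.comm_group_axioms, of "\<lambda>y k. ?c (y [^]\<^bsub>M\<^esub> k)"])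
    show "?c (y [^]\<^bsub>M\<^esub> k) \<in> carrier (M Mod ?P)" if "y \<in> carrier M" for y and k :: int
      by (rule cl.hom_closed) (use that in simp)
    show "?c ((y \<otimes>\<^bsub>M\<^esub> z) [^]\<^bsub>M\<^esub> k) = ?c (y [^]\<^bsub>M\<^esub> k) \<otimes>\<^bsub>M Mod ?P\<^esub> ?c (z [^]\<^bsub>M\<^esub> k)"
      if "y \<in> carrier M" "z \<in> carrier M" for y z and k :: int
      using that by (simp add: M.int_pow_distrib cl.hom_mult)
    show "?c (y [^]\<^bsub>M\<^esub> (k \<otimes>\<^bsub>integer_mod_group m\<^esub> l)) = ?c (y [^]\<^bsub>M\<^esub> k) \<otimes>\<^bsub>M Mod ?P\<^esub> ?c (y [^]\<^bsub>M\<^esub> l)"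
      if "y \<in> carrier M" for y k l
      using that powP[OF that, of "k + l"] M.int_pow_mult[OF that, of k l] by (simp add: cl.hom_mult)
  qed auto
  have "?c x = \<psi> (tens m M x)" using \<psi>(2)[OF x one_mem] x by (simp add: tens_def)
  also have "\<dots> = \<one>\<^bsub>M Mod ?P\<^esub>" unfolding one by (rule hom_one[OF \<psi>(1) T.is_group Q.is_group])
  finally show "\<exists>y\<in>carrier M. x = y [^]\<^bsub>M\<^esub> m" using c1[OF x] by auto
qed

end

lemma tensor_map_tens:
  assumes "m \<noteq> 1" "comm_group M" "comm_group N" "f \<in> hom M N" "x \<in> carrier M"
  shows "tensor_map N (integer_mod_group m) f (tens m M x) = tens m N (f x)"
  unfolding tens_def using tensor_map_pure[OF assms(2,3) abelian_integer_mod_group assms(4,5), of 1 m] assms(1) by simp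

section \<open>The exact sequence of invariant chains\<close>

text \<open>Every element of the tensor product comes from an element of \<open>C n\<close>, and the
  boundary maps correspond under \<open>tens\<close>, so the composite of two boundaries is
  trivial.\<close>

lemma chain_complex_tensor:
  assumes "chain_complex C d" and m: "m \<noteq> 1"
  shows "chain_complex (\<lambda>n. tensor_product (C n) (integer_mod_group m))
           (\<lambda>n. tensor_map (C (n - 1)) (integer_mod_group m) (d n))"
proof -
  interpret C: chain_complex C d by (rule assms)
  show ?thesis
  proof (rule chain_complex.intro)
    show "comm_group (tensor_product (C n) (integer_mod_group m))" for n
      by (rule tensor.comm_group_tensor[OF tensor.intro[OF C.comm abelian_integer_mod_group]])
    show "tensor_map (C (n - 1)) (integer_mod_group m) (d n)
        \<in> hom (tensor_product (C n) (integer_mod_group m)) (tensor_product (C (n - 1)) (integer_mod_group m))" for n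
      by (rule tensor_map_hom[OF C.comm C.comm abelian_integer_mod_group C.boundary_hom])
    fix c n assume "c \<in> carrier (tensor_product (C n) (integer_mod_group m))"
    then obtain x where x: "c = tens m (C n) x" "x \<in> carrier (C n)"
      unfolding tens_surj[OF m C.comm, symmetric] by (rule imageE)
    show "tensor_map (C (n - 1 - 1)) (integer_mod_group m) (d (n - 1)) (tensor_map (C (n - 1)) (integer_mod_group m) (d n) c)
       = \<one>\<^bsub>tensor_product (C (n - 1 - 1)) (integer_mod_group m)\<^esub>"
      unfolding x(1) tensor_map_tens[OF m C.comm C.comm C.boundary_hom x(2)]
        tensor_map_tens[OF m C.comm C.comm C.boundary_hom C.boundary_in_carrier[OF x(2)]] C.boundary_boundary[OF x(2)]
      by (rule group_hom.hom_one[OF tens_hom[OF m C.comm]])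
  qed
qed

text \<open>The case \<open>m = 0\<close> of the kernel description: the only zeroth power is the
  unit.\<close>

lemma tens_0_inj:
  assumes M: "comm_group M" and xy: "x \<in> carrier M" "y \<in> carrier M" "tens 0 M x = tens 0 M y"
  shows "x = y"
proof -
  interpret M: comm_group M by (rule M)
  interpret t: group_hom M "tensor_product M (integer_mod_group 0)" "tens 0 M"
    by (rule tens_hom[OF _ M]) simp
  have "tens 0 M (x \<otimes>\<^bsub>M\<^esub> inv\<^bsub>M\<^esub> y) = \<one>\<^bsub>tensor_product M (integer_mod_group 0)\<^esub>"
    using xy by simp
  then have "x \<otimes>\<^bsub>M\<^esub> inv\<^bsub>M\<^esub> y = \<one>\<^bsub>M\<^esub>" using tens_eq_one_iff[OF _ M, of 0 "x \<otimes>\<^bsub>M\<^esub> inv\<^bsub>M\<^esub> y"] xy by simp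
  then show ?thesis using xy M.inv_solve_right'[of "\<one>\<^bsub>M\<^esub>" x y] by simp
qed

text \<open>\<open>C\<close>, \<open>Q\<close> and \<open>F\<close> stand for the integral chains of
  \<open>X\<close>, of the orbit space and of the fixed point set, with \<open>q\<close> and
  \<open>i\<close> induced by projection and inclusion. All conditions precede the introduction of
  coefficients. The equality of the kernels of \<open>q\<close> and \<open>N\<close> gives the
  injection of the orbit chains, \<open>invariant_decomp\<close> describes the invariant chains, and
  \<open>i_eq_N\<close> with \<open>N_i\<close> identifies the cokernel.\<close>

locale smith_complexes =
  C: chain_complex C dC + Q: chain_complex Q dQ + F: chain_complex F dF
  for C :: "int \<Rightarrow> 'c monoid" and dC and Q :: "int \<Rightarrow> 'q monoid" and dQ and F :: "int \<Rightarrow> 'f monoid" and dF +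
  fixes S :: "'g set" and act :: "int \<Rightarrow> 'g \<Rightarrow> 'c \<Rightarrow> 'c" and N q i and p :: nat
  assumes p: "p \<noteq> 1"
    and act_hom: "s \<in> S \<Longrightarrow> act n s \<in> hom (C n) (C n)"
    and act_chain: "\<lbrakk>s \<in> S; c \<in> carrier (C n)\<rbrakk> \<Longrightarrow> act (n - 1) s (dC n c) = dC n (act n s c)"
    and N_hom: "N n \<in> hom (C n) (C n)"
    and N_chain: "c \<in> carrier (C n) \<Longrightarrow> N (n - 1) (dC n c) = dC n (N n c)"
    and act_N: "\<lbrakk>s \<in> S; c \<in> carrier (C n)\<rbrakk> \<Longrightarrow> act n s (N n c) = N n c"
    and q_hom: "q n \<in> hom (C n) (Q n)"
    and q_chain: "c \<in> carrier (C n) \<Longrightarrow> q (n - 1) (dC n c) = dQ n (q n c)"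
    and q_surj: "q n ` carrier (C n) = carrier (Q n)"
    and q_one_iff: "c \<in> carrier (C n) \<Longrightarrow> q n c = \<one>\<^bsub>Q n\<^esub> \<longleftrightarrow> N n c = \<one>\<^bsub>C n\<^esub>"
    and i_hom: "i n \<in> hom (F n) (C n)"
    and i_chain: "x \<in> carrier (F n) \<Longrightarrow> i (n - 1) (dF n x) = dC n (i n x)"
    and act_i: "\<lbrakk>s \<in> S; x \<in> carrier (F n)\<rbrakk> \<Longrightarrow> act n s (i n x) = i n x"
    and invariant_decomp: "\<lbrakk>c \<in> carrier (C n); \<And>s. s \<in> S \<Longrightarrow> act n s c = c\<rbrakk>
       \<Longrightarrow> \<exists>x\<in>carrier (F n). \<exists>y\<in>carrier (C n). c = i n x \<otimes>\<^bsub>C n\<^esub> N n y"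
    and i_eq_N: "\<lbrakk>x \<in> carrier (F n); y \<in> carrier (C n); i n x = N n y\<rbrakk> \<Longrightarrow> \<exists>x'\<in>carrier (F n). x = x' [^]\<^bsub>F n\<^esub> p"
    and N_i: "x \<in> carrier (F n) \<Longrightarrow> N n (i n x) = i n x [^]\<^bsub>C n\<^esub> p"
begin

lemma act_group_hom: "s \<in> S \<Longrightarrow> group_hom (C n) (C n) (act n s)"
  by (intro group_hom.intro group_hom_axioms.intro act_hom C.is_group)

lemmas act_closed = group_hom.hom_closed[OF act_group_hom]
  and act_mult = group_hom.hom_mult[OF act_group_hom]
  and act_one = group_hom.hom_one[OF act_group_hom]
  and act_inv = group_hom.hom_inv[OF act_group_hom]

sublocale N: group_hom "C n" "C n" "N n" for n
  by (intro group_hom.intro group_hom_axioms.intro N_hom C.is_group)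

sublocale q: group_hom "C n" "Q n" "q n" for n
  by (intro group_hom.intro group_hom_axioms.intro q_hom C.is_group Q.is_group)

sublocale i: group_hom "F n" "C n" "i n" for n
  by (intro group_hom.intro group_hom_axioms.intro i_hom C.is_group F.is_group)

abbreviation "Z \<equiv> integer_mod_group 0"
abbreviation "CZ n \<equiv> tensor_product (C n) Z"
abbreviation "A n \<equiv> tensor_product (Q n) Z"
abbreviation "dA n \<equiv> tensor_map (Q (n - 1)) Z (dQ n)"
abbreviation "dB n \<equiv> tensor_map (C (n - 1)) Z (dC n)"
abbreviation "D n \<equiv> tensor_product (F n) (integer_mod_group p)"
abbreviation "dD n \<equiv> tensor_map (F (n - 1)) (integer_mod_group p) (dF n)"

text \<open>Invariance is imposed after tensoring with the integers, in exact agreement with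
  \<open>invariant_cell_chain\<close>; \<open>carrier_B\<close> leads back to invariants of
  \<open>C\<close>.\<close>

definition B :: "int \<Rightarrow> ('c \<times> int \<Rightarrow>\<^sub>0 int) set monoid" where
  "B n = (CZ n)\<lparr>carrier := {c \<in> carrier (CZ n). \<forall>s\<in>S. tensor_map (C n) Z (act n s) c = c}\<rparr>"

lemma B_simps [simp]: "x \<otimes>\<^bsub>B n\<^esub> y = x \<otimes>\<^bsub>CZ n\<^esub> y" "\<one>\<^bsub>B n\<^esub> = \<one>\<^bsub>CZ n\<^esub>"
  by (simp_all add: B_def)

definition invariant :: "int \<Rightarrow> 'c set" where
  "invariant n = {c \<in> carrier (C n). \<forall>s\<in>S. act n s c = c}"

lemma tC: "group_hom (C n) (CZ n) (tens 0 (C n))" and tQ: "group_hom (Q n) (A n) (tens 0 (Q n))"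
  and tF: "group_hom (F n) (D n) (tens p (F n))"
  by (rule tens_hom, use p in simp, rule C.comm Q.comm F.comm)+

sublocale CZ: chain_complex CZ dB by (rule chain_complex_tensor[OF C.chain_complex_axioms]) simp
sublocale A: chain_complex A dA by (rule chain_complex_tensor[OF Q.chain_complex_axioms]) simp
sublocale D: chain_complex D dD by (rule chain_complex_tensor[OF F.chain_complex_axioms p])

sublocale tC: group_hom "C n" "CZ n" "tens 0 (C n)" for n by (rule tC)
sublocale tQ: group_hom "Q n" "A n" "tens 0 (Q n)" for n by (rule tQ)
sublocale tF: group_hom "F n" "D n" "tens p (F n)" for n by (rule tF)

lemma subgroup_invariant: "subgroup (invariant n) (C n)"
  by (rule C.subgroupI) (auto simp: invariant_def act_mult act_inv intro!: exI[of _ "\<one>\<^bsub>C n\<^esub>"] act_one)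

text \<open>With integer coefficients \<open>tens\<close> is bijective and intertwines the actions,
  so an element is invariant exactly if its preimage is.\<close>

lemma carrier_B: "carrier (B n) = tens 0 (C n) ` invariant n"
proof -
  have fixed: "tensor_map (C n) Z (act n s) (tens 0 (C n) x) = tens 0 (C n) x \<longleftrightarrow> act n s x = x"
    if s: "s \<in> S" and x: "x \<in> carrier (C n)" for s x
  proof -
    have "tensor_map (C n) Z (act n s) (tens 0 (C n) x) = tens 0 (C n) (act n s x)"
      by (rule tensor_map_tens[OF _ C.comm C.comm act_hom[OF s] x]) simp
    then have "tensor_map (C n) Z (act n s) (tens 0 (C n) x) = tens 0 (C n) x
        \<longleftrightarrow> tens 0 (C n) (act n s x) = tens 0 (C n) x" by (simp only:)
    also have "\<dots> \<longleftrightarrow> act n s x = x"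
    proof
      assume "tens 0 (C n) (act n s x) = tens 0 (C n) x"
      then show "act n s x = x" by (rule tens_0_inj[OF C.comm act_closed[OF s x] x])
    qed (simp only:)
    finally show ?thesis .
  qed
  have surj: "carrier (CZ n) = tens 0 (C n) ` carrier (C n)"
    by (rule tens_surj[symmetric, OF _ C.comm]) simp
  show ?thesis
  proof (intro equalityI subsetI)
    fix b assume "b \<in> carrier (B n)"
    then have b: "b \<in> tens 0 (C n) ` carrier (C n)" "\<forall>s\<in>S. tensor_map (C n) Z (act n s) b = b"
      unfolding surj[symmetric] by (simp_all add: B_def)
    obtain x where x: "b = tens 0 (C n) x" "x \<in> carrier (C n)" using b(1) by (rule imageE)
    have "x \<in> invariant n" unfolding invariant_def using b(2) fixed[OF _ x(2)] x by simp
    then show "b \<in> tens 0 (C n) ` invariant n" unfolding x(1) by (rule imageI)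
  next
    fix b assume "b \<in> tens 0 (C n) ` invariant n"
    then obtain x where x: "b = tens 0 (C n) x" "x \<in> invariant n" by (rule imageE)
    then have "x \<in> carrier (C n)" "\<forall>s\<in>S. act n s x = x" by (simp_all add: invariant_def)
    then show "b \<in> carrier (B n)" using fixed x(1) by (simp add: B_def)
  qed
qed

lemma subgroup_B: "subgroup (carrier (B n)) (CZ n)"
  unfolding carrier_B by (rule tC.subgroup_img_is_subgroup[OF subgroup_invariant])

lemma boundary_invariant: "c \<in> invariant n \<Longrightarrow> dC n c \<in> invariant (n - 1)"
  unfolding invariant_def using act_chain C.boundary_in_carrier by auto

lemma dB_tens: "c \<in> carrier (C n) \<Longrightarrow> dB n (tens 0 (C n) c) = tens 0 (C (n - 1)) (dC n c)"
  by (rule tensor_map_tens[OF _ C.comm C.comm C.boundary_hom]) simp_all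

lemma dA_tens: "c \<in> carrier (Q n) \<Longrightarrow> dA n (tens 0 (Q n) c) = tens 0 (Q (n - 1)) (dQ n c)"
  by (rule tensor_map_tens[OF _ Q.comm Q.comm Q.boundary_hom]) simp_all

lemma dD_tens: "c \<in> carrier (F n) \<Longrightarrow> dD n (tens p (F n) c) = tens p (F (n - 1)) (dF n c)"
  by (rule tensor_map_tens[OF p F.comm F.comm F.boundary_hom])

lemma B_sub: "c \<in> carrier (B n) \<Longrightarrow> c \<in> carrier (CZ n)" by (simp add: B_def)

lemma dB_B: assumes "c \<in> carrier (B n)" shows "dB n c \<in> carrier (B (n - 1))"
proof -
  obtain x where x: "c = tens 0 (C n) x" "x \<in> invariant n"
    using assms unfolding carrier_B by (rule imageE)
  then have "x \<in> carrier (C n)" by (simp add: invariant_def)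
  then show ?thesis
    unfolding carrier_B x(1) by (subst dB_tens) (simp_all only: imageI boundary_invariant[OF x(2)])
qed

lemma B_complex: "chain_complex B dB"
proof (rule chain_complex.intro)
  show "comm_group (B n)" for n
  proof (rule group.group_comm_groupI)
    have "(CZ n)\<lparr>carrier := carrier (B n)\<rparr> = B n" by (simp add: B_def)
    then show "group (B n)" using subgroup.subgroup_is_group[OF subgroup_B CZ.is_group, of n] by simp
    show "x \<otimes>\<^bsub>B n\<^esub> y = y \<otimes>\<^bsub>B n\<^esub> x" if "x \<in> carrier (B n)" "y \<in> carrier (B n)" for x y
      using CZ.m_comm[OF B_sub[OF that(1)] B_sub[OF that(2)]] by simp
  qed
  show "dB n \<in> hom (B n) (B (n - 1))" for n
  proof (rule homI)
    show "dB n c \<in> carrier (B (n - 1))" if "c \<in> carrier (B n)" for c using that by (rule dB_B)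
    show "dB n (c \<otimes>\<^bsub>B n\<^esub> c') = dB n c \<otimes>\<^bsub>B (n - 1)\<^esub> dB n c'"
      if "c \<in> carrier (B n)" "c' \<in> carrier (B n)" for c c'
      using CZ.d.hom_mult[OF B_sub[OF that(1)] B_sub[OF that(2)]] by simp
  qed
  show "dB (n - 1) (dB n c) = \<one>\<^bsub>B (n - 1 - 1)\<^esub>" if "c \<in> carrier (B n)" for c n
    using CZ.boundary_boundary[OF B_sub[OF that]] by simp
qed

sublocale B: chain_complex B dB by (rule B_complex)

lemma A_elt: "a \<in> carrier (A n) \<Longrightarrow> \<exists>c\<in>carrier (C n). a = tens 0 (Q n) (q n c)"
  using tens_surj[OF _ Q.comm, of 0 n] q_surj[of n] by (metis imageE zero_neq_one)

lemma invariant_elt: "\<lbrakk>x \<in> carrier (F n); y \<in> carrier (C n)\<rbrakk> \<Longrightarrow> i n x \<otimes>\<^bsub>C n\<^esub> N n y \<in> invariant n"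
  by (simp add: invariant_def act_i act_N act_mult)

lemma B_elt: assumes "b \<in> carrier (B n)"
  shows "\<exists>x\<in>carrier (F n). \<exists>y\<in>carrier (C n). b = tens 0 (C n) (i n x \<otimes>\<^bsub>C n\<^esub> N n y)"
proof -
  obtain c where c: "b = tens 0 (C n) c" "c \<in> invariant n" using assms unfolding carrier_B by (rule imageE)
  then show ?thesis using invariant_decomp[of c n] unfolding invariant_def by blast
qed

lemma B_elt_closed: "\<lbrakk>x \<in> carrier (F n); y \<in> carrier (C n)\<rbrakk> \<Longrightarrow> tens 0 (C n) (i n x \<otimes>\<^bsub>C n\<^esub> N n y) \<in> carrier (B n)"
  unfolding carrier_B by (rule imageI[OF invariant_elt])

lemma tens_N_closed: "c \<in> carrier (C n) \<Longrightarrow> tens 0 (C n) (N n c) \<in> carrier (B n)"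
  using B_elt_closed[of "\<one>\<^bsub>F n\<^esub>" n c] by simp

text \<open>The norm is trivial on the kernel of \<open>q\<close>, so it descends to the orbit
  chains. The opposite inclusion of kernels makes the descended map injective in
  \<open>smith_sequence\<close>.\<close>

lemma f_exists: "\<exists>f. f \<in> hom (A n) (B n) \<and> (\<forall>c\<in>carrier (C n). f (tens 0 (Q n) (q n c)) = tens 0 (C n) (N n c))"
proof -
  have "\<exists>f\<in>hom (A n) (B n). \<forall>c\<in>carrier (C n). f ((tens 0 (Q n) \<circ> q n) c) = (tens 0 (C n) \<circ> N n) c"
  proof (rule hom_factor[OF C.is_group B.is_group])
    show "tens 0 (Q n) \<circ> q n \<in> hom (C n) (A n)" by (rule hom_compose[OF q_hom tQ.homh])
    show "(tens 0 (Q n) \<circ> q n) ` carrier (C n) = carrier (A n)"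
      unfolding image_comp[symmetric] q_surj by (rule tens_surj[OF _ Q.comm]) simp
    show "tens 0 (C n) \<circ> N n \<in> hom (C n) (B n)"
    proof (rule homI)
      show "(tens 0 (C n) \<circ> N n) x \<in> carrier (B n)" if "x \<in> carrier (C n)" for x
        unfolding o_apply by (rule tens_N_closed[OF that])
    qed simp
    show "group (A n)" by (rule A.is_group)
    fix c assume c: "c \<in> carrier (C n)" "(tens 0 (Q n) \<circ> q n) c = \<one>\<^bsub>A n\<^esub>"
    then have "q n c = \<one>\<^bsub>Q n\<^esub>" using tens_0_inj[OF Q.comm, of "q n c" n "\<one>\<^bsub>Q n\<^esub>"] by simp
    then show "(tens 0 (C n) \<circ> N n) c = \<one>\<^bsub>B n\<^esub>" using q_one_iff[OF c(1)] by simp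
  qed
  then show ?thesis unfolding o_apply by blast
qed

text \<open>The direct product of \<open>F n\<close> and \<open>C n\<close> maps onto the invariant
  chains by \<open>invariant_decomp\<close>. The decomposition is not unique, but its ambiguity
  changes \<open>x\<close> by a \<open>p\<close>-th power only, which vanishes in
  \<open>D n\<close>.\<close>

lemma g_exists: "\<exists>g. g \<in> hom (B n) (D n) \<and> (\<forall>x\<in>carrier (F n). \<forall>y\<in>carrier (C n).
    g (tens 0 (C n) (i n x \<otimes>\<^bsub>C n\<^esub> N n y)) = tens p (F n) x)"
proof -
  let ?P = "F n \<times>\<times> C n"
  let ?\<pi> = "\<lambda>(x, y). tens 0 (C n) (i n x \<otimes>\<^bsub>C n\<^esub> N n y)"
  have "\<exists>g\<in>hom (B n) (D n). \<forall>z\<in>carrier ?P. g (?\<pi> z) = (\<lambda>(x, y). tens p (F n) x) z"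
  proof (rule hom_factor[OF DirProd_group[OF F.is_group C.is_group] D.is_group])
    show "?\<pi> \<in> hom ?P (B n)"
    proof (rule homI)
      show "?\<pi> z \<in> carrier (B n)" if "z \<in> carrier ?P" for z
        using that B_elt_closed by (cases z) simp
      fix z w assume "z \<in> carrier ?P" "w \<in> carrier ?P"
      then show "?\<pi> (z \<otimes>\<^bsub>?P\<^esub> w) = ?\<pi> z \<otimes>\<^bsub>B n\<^esub> ?\<pi> w"
        by (cases z; cases w) (simp add: CZ.m_ac)
    qed
    show "?\<pi> ` carrier ?P = carrier (B n)"
    proof (intro equalityI subsetI)
      fix b assume "b \<in> carrier (B n)"
      then obtain x y where "x \<in> carrier (F n)" "y \<in> carrier (C n)" "b = tens 0 (C n) (i n x \<otimes>\<^bsub>C n\<^esub> N n y)"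
        using B_elt by blast
      then show "b \<in> ?\<pi> ` carrier ?P" by (intro image_eqI[of _ _ "(x, y)"]) simp_all
    next
      fix b assume "b \<in> ?\<pi> ` carrier ?P"
      then obtain z where "b = ?\<pi> z" "z \<in> carrier ?P" by (rule imageE)
      then show "b \<in> carrier (B n)" using B_elt_closed by (cases z) simp
    qed
    show "(\<lambda>(x, y). tens p (F n) x) \<in> hom ?P (D n)"
      by (rule homI) auto
    show "group (B n)" by (rule B.is_group)
    fix z assume z: "z \<in> carrier ?P" "?\<pi> z = \<one>\<^bsub>B n\<^esub>"
    obtain x y where xy: "z = (x, y)" "x \<in> carrier (F n)" "y \<in> carrier (C n)" using z by (cases z) auto
    have "tens 0 (C n) (i n x \<otimes>\<^bsub>C n\<^esub> N n y) = tens 0 (C n) \<one>\<^bsub>C n\<^esub>" using z xy by simp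
    then have "i n x \<otimes>\<^bsub>C n\<^esub> N n y = \<one>\<^bsub>C n\<^esub>" using xy by (intro tens_0_inj[OF C.comm[of n]]) simp_all
    \<comment> \<open>A trivial product exhibits \<open>i n x\<close> as a norm, and
      \<open>i_eq_N\<close> then makes \<open>x\<close> a \<open>p\<close>-th power.\<close>
    then have "inv\<^bsub>C n\<^esub> (N n y) = i n x" by (rule C.inv_equality) (use xy in simp_all)
    then have "i n x = N n (inv\<^bsub>C n\<^esub> y)" using xy by simp
    then obtain x' where x': "x' \<in> carrier (F n)" "x = x' [^]\<^bsub>F n\<^esub> p"
      using i_eq_N[OF xy(2), of "inv\<^bsub>C n\<^esub> y"] xy by auto
    then show "(\<lambda>(x, y). tens p (F n) x) z = \<one>\<^bsub>D n\<^esub>"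
      using tens_eq_one_iff[OF p F.comm xy(2)] xy(1) by auto
  qed
  then obtain g where g: "g \<in> hom (B n) (D n)" "\<forall>z\<in>carrier ?P. g (?\<pi> z) = (\<lambda>(x, y). tens p (F n) x) z" by blast
  have "g (tens 0 (C n) (i n x \<otimes>\<^bsub>C n\<^esub> N n y)) = tens p (F n) x" if "x \<in> carrier (F n)" "y \<in> carrier (C n)" for x y
    using g(2)[rule_format, of "(x, y)"] that by simp
  then show ?thesis using g(1) by blast
qed

theorem smith_sequence:
  "\<exists>\<alpha> \<beta> \<delta>. \<forall>n.
     exact_at (complex_homology A dA n) (complex_homology B dB n) (complex_homology D dD n) (\<alpha> n) (\<beta> n) \<and>
     exact_at (complex_homology B dB n) (complex_homology D dD n) (complex_homology A dA (n - 1)) (\<beta> n) (\<delta> n) \<and>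
     exact_at (complex_homology D dD n) (complex_homology A dA (n - 1)) (complex_homology B dB (n - 1)) (\<delta> n) (\<alpha> (n - 1))"
proof -
  obtain f where f: "\<And>n. f n \<in> hom (A n) (B n)"
    "\<And>n c. c \<in> carrier (C n) \<Longrightarrow> f n (tens 0 (Q n) (q n c)) = tens 0 (C n) (N n c)"
    using f_exists by metis
  obtain g where g: "\<And>n. g n \<in> hom (B n) (D n)"
    "\<And>n x y. \<lbrakk>x \<in> carrier (F n); y \<in> carrier (C n)\<rbrakk> \<Longrightarrow> g n (tens 0 (C n) (i n x \<otimes>\<^bsub>C n\<^esub> N n y)) = tens p (F n) x"
    using g_exists by metis
  have fh: "group_hom (A n) (B n) (f n)" for n
    by (intro group_hom.intro group_hom_axioms.intro f A.is_group B.is_group)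
  have gN: "g n (tens 0 (C n) (N n c)) = \<one>\<^bsub>D n\<^esub>" if "c \<in> carrier (C n)" for n c
    using g(2)[of "\<one>\<^bsub>F n\<^esub>" n c] that by simp
  have "short_exact_complexes A dA B dB D dD f g"
  proof (intro short_exact_complexes.intro short_exact_complexes_axioms.intro A.chain_complex_axioms
      B.chain_complex_axioms D.chain_complex_axioms)
    show "f n \<in> hom (A n) (B n)" "g n \<in> hom (B n) (D n)" for n by (rule f g)+
    show "inj_on (f n) (carrier (A n))" for n
      unfolding group_hom.inj_on_one_iff[OF fh]
    proof (intro ballI impI allI)
      fix a assume a: "a \<in> carrier (A n)" "f n a = \<one>\<^bsub>B n\<^esub>"
      then obtain c where c: "c \<in> carrier (C n)" "a = tens 0 (Q n) (q n c)" using A_elt by blast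
      have "tens 0 (C n) (N n c) = tens 0 (C n) \<one>\<^bsub>C n\<^esub>" using a c f(2) by simp
      then have "N n c = \<one>\<^bsub>C n\<^esub>" using c by (intro tens_0_inj[OF C.comm[of n]]) simp_all
      then show "a = \<one>\<^bsub>A n\<^esub>" using q_one_iff[OF c(1)] c(2) by simp
    qed
    show "g n ` carrier (B n) = carrier (D n)" for n
    proof (intro equalityI subsetI)
      fix d assume "d \<in> carrier (D n)"
      then obtain x where x: "d = tens p (F n) x" "x \<in> carrier (F n)"
        unfolding tens_surj[OF p F.comm, symmetric] by (rule imageE)
      have "d = g n (tens 0 (C n) (i n x \<otimes>\<^bsub>C n\<^esub> N n \<one>\<^bsub>C n\<^esub>))"
        using g(2)[OF x(2), of "\<one>\<^bsub>C n\<^esub>"] x(1) by (simp only: C.one_closed)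
      then show "d \<in> g n ` carrier (B n)" by (rule image_eqI) (rule B_elt_closed[OF x(2) C.one_closed])
    qed (use hom_in_carrier[OF g(1)] in blast)
    show "f n ` carrier (A n) = kernel (B n) (D n) (g n)" for n
    proof (intro equalityI subsetI)
      fix b assume "b \<in> f n ` carrier (A n)"
      then obtain a where a: "b = f n a" "a \<in> carrier (A n)" by (rule imageE)
      then obtain c where c: "c \<in> carrier (C n)" "a = tens 0 (Q n) (q n c)" using A_elt by blast
      have b: "b = tens 0 (C n) (N n c)" using a c f(2) by simp
      show "b \<in> kernel (B n) (D n) (g n)"
        unfolding kernel_def b using tens_N_closed[OF c(1)] gN[OF c(1)] by blast
    next
      fix b assume "b \<in> kernel (B n) (D n) (g n)"
      then have b: "b \<in> carrier (B n)" "g n b = \<one>\<^bsub>D n\<^esub>" unfolding kernel_def by blast+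
      obtain x y where xy: "x \<in> carrier (F n)" "y \<in> carrier (C n)" "b = tens 0 (C n) (i n x \<otimes>\<^bsub>C n\<^esub> N n y)"
        using B_elt[OF b(1)] by blast
      have "tens p (F n) x = \<one>\<^bsub>D n\<^esub>" using b(2) xy g(2) by simp
      then obtain x' where x': "x' \<in> carrier (F n)" "x = x' [^]\<^bsub>F n\<^esub> p"
        using tens_eq_one_iff[OF p F.comm xy(1)] by blast
      \<comment> \<open>A \<open>p\<close>-th power on the fixed cells is itself a norm, because the
        norm acts there as the \<open>p\<close>-th power map. Hence the whole of \<open>b\<close> is
        a norm.\<close>
      have "i n x = N n (i n x')" using x' i.hom_nat_pow[OF x'(1)] N_i[OF x'(1)] by simp
      then have eq: "i n x \<otimes>\<^bsub>C n\<^esub> N n y = N n (i n x' \<otimes>\<^bsub>C n\<^esub> y)" using x' xy by simp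
      have "i n x' \<otimes>\<^bsub>C n\<^esub> y \<in> carrier (C n)" using x' xy by simp
      from f(2)[OF this] have "b = f n (tens 0 (Q n) (q n (i n x' \<otimes>\<^bsub>C n\<^esub> y)))"
        unfolding xy(3) eq by (rule sym)
      then show "b \<in> f n ` carrier (A n)" by (rule image_eqI) (use x' xy in simp)
    qed
    show "f (n - 1) (dA n a) = dB n (f n a)" if a: "a \<in> carrier (A n)" for a n
    proof -
      obtain c where c: "c \<in> carrier (C n)" "a = tens 0 (Q n) (q n c)" using A_elt[OF a] by blast
      have "f (n - 1) (dA n a) = f (n - 1) (tens 0 (Q (n - 1)) (q (n - 1) (dC n c)))"
        using c dA_tens[OF q.hom_closed[OF c(1)]] q_chain[OF c(1)] by simp
      also have "\<dots> = tens 0 (C (n - 1)) (N (n - 1) (dC n c))"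
        by (rule f(2)[OF C.boundary_in_carrier[OF c(1)]])
      also have "\<dots> = dB n (tens 0 (C n) (N n c))"
        using dB_tens[OF N.hom_closed[OF c(1)]] N_chain[OF c(1)] by simp
      finally show ?thesis using f(2)[OF c(1)] c(2) by simp
    qed
    show "g (n - 1) (dB n b) = dD n (g n b)" if b: "b \<in> carrier (B n)" for b n
    proof -
      obtain x y where xy: "x \<in> carrier (F n)" "y \<in> carrier (C n)" "b = tens 0 (C n) (i n x \<otimes>\<^bsub>C n\<^esub> N n y)"
        using B_elt[OF b] by blast
      have "dC n (i n x \<otimes>\<^bsub>C n\<^esub> N n y) = i (n - 1) (dF n x) \<otimes>\<^bsub>C (n - 1)\<^esub> N (n - 1) (dC n y)"
        using xy i_chain[OF xy(1)] N_chain[OF xy(2)] by simp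
      then have "g (n - 1) (dB n b) = g (n - 1) (tens 0 (C (n - 1)) (i (n - 1) (dF n x) \<otimes>\<^bsub>C (n - 1)\<^esub> N (n - 1) (dC n y)))"
        using dB_tens[of "i n x \<otimes>\<^bsub>C n\<^esub> N n y" n] xy by simp
      also have "\<dots> = tens p (F (n - 1)) (dF n x)"
        by (rule g(2)[OF F.boundary_in_carrier[OF xy(1)] C.boundary_in_carrier[OF xy(2)]])
      also have "\<dots> = dD n (tens p (F n) x)" by (rule dD_tens[OF xy(1), symmetric])
      also have "tens p (F n) x = g n b" using g(2)[OF xy(1,2)] xy(3) by simp
      finally show ?thesis .
    qed
  qed
  then show ?thesis by (rule short_exact_complexes.long_exact_sequence)
qed

end

section \<open>Permutation modules over a group acting freely or trivially\<close>

lemma hom_free_Abelian_group_eqI: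
  assumes "group K" and f: "f \<in> hom (free_Abelian_group I) K" and g: "g \<in> hom (free_Abelian_group I) K"
    and eq: "\<And>i. i \<in> I \<Longrightarrow> f (frag_of i) = g (frag_of i)" and x: "Poly_Mapping.keys x \<subseteq> I"
  shows "f x = g x"
proof -
  interpret f: group_hom "free_Abelian_group I" K f
    by (intro group_hom.intro group_hom_axioms.intro assms group_free_Abelian_group)
  interpret g: group_hom "free_Abelian_group I" K g
    by (intro group_hom.intro group_hom_axioms.intro assms group_free_Abelian_group)
  show ?thesis
    using x
  proof (induction x rule: free_Abelian_group_induct[consumes 1])
    case 1
    show ?case using f.hom_one g.hom_one by simp
  next
    case (2 x y)
    have "f (x - y) = f x \<otimes>\<^bsub>K\<^esub> inv\<^bsub>K\<^esub> f y" "g (x - y) = g x \<otimes>\<^bsub>K\<^esub> inv\<^bsub>K\<^esub> g y"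
      using f.hom_mult[of x "- y"] f.hom_inv[of y] g.hom_mult[of x "- y"] g.hom_inv[of y] 2(1,2) by simp_all
    then show ?case using 2 by simp
  next
    case (3 i)
    then show ?case by (rule eq)
  qed
qed

lemma frag_extend_hom:
  assumes "\<And>i. i \<in> I \<Longrightarrow> Poly_Mapping.keys (f i) \<subseteq> J"
  shows "frag_extend f \<in> hom (free_Abelian_group I) (free_Abelian_group J)"
proof (rule homI)
  fix x assume "x \<in> carrier (free_Abelian_group I)"
  then have "(\<Union>i\<in>Poly_Mapping.keys x. Poly_Mapping.keys (f i)) \<subseteq> J" using assms by auto
  from order_trans[OF keys_frag_extend this] show "frag_extend f x \<in> carrier (free_Abelian_group J)"
    by simp
qed (simp add: frag_extend_add)

lemma lookup_eq_zero: "\<lbrakk>Poly_Mapping.keys x \<subseteq> T; e \<notin> T\<rbrakk> \<Longrightarrow> Poly_Mapping.lookup x e = 0"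
  by (meson in_keys_iff subsetD)

lemma frag_cmul_diff: "frag_cmul k (x - y) = frag_cmul k x - frag_cmul k y"
  by (rule poly_mapping_eqI) (simp add: lookup_minus algebra_simps)

definition frag_restrict :: "'e set \<Rightarrow> ('e \<Rightarrow>\<^sub>0 int) \<Rightarrow> ('e \<Rightarrow>\<^sub>0 int)" where
  "frag_restrict T = frag_extend (\<lambda>e. if e \<in> T then frag_of e else 0)"

lemma lookup_frag_restrict:
  "Poly_Mapping.lookup (frag_restrict T x) e = (if e \<in> T then Poly_Mapping.lookup x e else 0)"
proof -
  have "Poly_Mapping.keys x \<subseteq> UNIV" by simp
  then show ?thesis
  proof (induction x rule: frag_induction)
    case zero
    show ?case by (simp add: frag_restrict_def)
  next
    case (one x)
    show ?case by (auto simp: frag_restrict_def)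
  next
    case (diff a b)
    then show ?case by (simp add: frag_restrict_def frag_extend_diff lookup_minus)
  qed
qed

lemma keys_frag_restrict: "Poly_Mapping.keys (frag_restrict T x) = Poly_Mapping.keys x \<inter> T"
  by (auto simp: in_keys_iff lookup_frag_restrict split: if_splits)

text \<open>\<open>alternative\<close> is the only trace of the prime order: an element with a
  nontrivial stabilizer is fixed by everything. The map \<open>r\<close> is an abstract name for
  orbits, later instantiated with the cells of the orbit space.\<close>

locale free_or_fixed =
  fixes G :: "'g monoid" (structure) and E :: "'e set" and a :: "'g \<Rightarrow> 'e \<Rightarrow> 'e" and r :: "'e \<Rightarrow> 'o"
  assumes G: "group G" and fin: "finite (carrier G)"
    and a_closed: "\<lbrakk>g \<in> carrier G; e \<in> E\<rbrakk> \<Longrightarrow> a g e \<in> E"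
    and a_mult: "\<lbrakk>g \<in> carrier G; h \<in> carrier G; e \<in> E\<rbrakk> \<Longrightarrow> a (g \<otimes>\<^bsub>G\<^esub> h) e = a g (a h e)"
    and a_one: "e \<in> E \<Longrightarrow> a \<one>\<^bsub>G\<^esub> e = e"
    and alternative: "\<lbrakk>e \<in> E; g \<in> carrier G; a g e = e; g \<noteq> \<one>\<^bsub>G\<^esub>; h \<in> carrier G\<rbrakk> \<Longrightarrow> a h e = e"
    and r_eq_iff: "\<lbrakk>e \<in> E; f \<in> E\<rbrakk> \<Longrightarrow> r e = r f \<longleftrightarrow> (\<exists>g\<in>carrier G. f = a g e)"
begin

sublocale group G by (rule G)

definition act :: "'g \<Rightarrow> ('e \<Rightarrow>\<^sub>0 int) \<Rightarrow> ('e \<Rightarrow>\<^sub>0 int)" where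
  "act g = frag_extend (\<lambda>e. frag_of (a g e))"

definition norm_frag :: "('e \<Rightarrow>\<^sub>0 int) \<Rightarrow> ('e \<Rightarrow>\<^sub>0 int)" where
  "norm_frag x = (\<Sum>g\<in>carrier G. act g x)"

definition quot :: "('e \<Rightarrow>\<^sub>0 int) \<Rightarrow> ('o \<Rightarrow>\<^sub>0 int)" where
  "quot = frag_extend (\<lambda>e. frag_of (r e))"

definition fixed :: "'e set" where
  "fixed = {e \<in> E. \<forall>g\<in>carrier G. a g e = e}"

lemma a_inv: "\<lbrakk>g \<in> carrier G; e \<in> E\<rbrakk> \<Longrightarrow> a (inv g) (a g e) = e" "\<lbrakk>g \<in> carrier G; e \<in> E\<rbrakk> \<Longrightarrow> a g (a (inv g) e) = e"
  using a_mult[of "inv g" g e] a_mult[of g "inv g" e] a_one by auto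

lemma act_hom: "g \<in> carrier G \<Longrightarrow> act g \<in> hom (free_Abelian_group E) (free_Abelian_group E)"
  unfolding act_def by (rule frag_extend_hom) (simp add: a_closed keys_frag_of)

lemma keys_act: "\<lbrakk>g \<in> carrier G; Poly_Mapping.keys x \<subseteq> E\<rbrakk> \<Longrightarrow> Poly_Mapping.keys (act g x) \<subseteq> E"
  using hom_in_carrier[OF act_hom, of g x] by simp

lemma keys_norm: assumes "Poly_Mapping.keys x \<subseteq> E" shows "Poly_Mapping.keys (norm_frag x) \<subseteq> E"
  using sum_closed_free_Abelian_group[of "carrier G" "\<lambda>g. act g x" E] keys_act assms by (simp add: norm_frag_def)

lemma lookup_act:
  assumes g: "g \<in> carrier G" and x: "Poly_Mapping.keys x \<subseteq> E" and e: "e \<in> E"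
  shows "Poly_Mapping.lookup (act g x) e = Poly_Mapping.lookup x (a (inv g) e)"
  using x
proof (induction x rule: frag_induction)
  case zero
  show ?case by (simp add: act_def)
next
  case (one f)
  have "a g f = e \<longleftrightarrow> f = a (inv g) e" using a_inv[OF g] one e by auto
  then show ?case by (auto simp: act_def)
next
  case (diff x y)
  then show ?case by (simp add: act_def frag_extend_diff lookup_minus)
qed

lemma lookup_norm:
  assumes x: "Poly_Mapping.keys x \<subseteq> E" and e: "e \<in> E"
  shows "Poly_Mapping.lookup (norm_frag x) e = (\<Sum>g\<in>carrier G. Poly_Mapping.lookup x (a (inv g) e))"
  unfolding norm_frag_def lookup_sum using lookup_act[OF _ x e] by simp

lemma frag_eqI:
  assumes "Poly_Mapping.keys x \<subseteq> E" "Poly_Mapping.keys y \<subseteq> E"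
    and "\<And>e. e \<in> E \<Longrightarrow> Poly_Mapping.lookup x e = Poly_Mapping.lookup y e"
  shows "x = (y :: 'e \<Rightarrow>\<^sub>0 int)"
proof (rule poly_mapping_eqI)
  fix e
  show "Poly_Mapping.lookup x e = Poly_Mapping.lookup y e"
    using assms by (cases "e \<in> E") (simp_all add: lookup_eq_zero[of _ E])
qed

lemma fixed_subset: "fixed \<subseteq> E"
  by (auto simp: fixed_def)

lemma norm_on_fixed:
  assumes "Poly_Mapping.keys x \<subseteq> fixed"
  shows "norm_frag x = frag_cmul (int (card (carrier G))) x"
proof -
  have x: "Poly_Mapping.keys x \<subseteq> E" using assms fixed_subset by blast
  show ?thesis
  proof (rule frag_eqI[OF keys_norm[OF x]])
    show "Poly_Mapping.keys (frag_cmul (int (card (carrier G))) x) \<subseteq> E" using x keys_cmul by blast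
    fix e assume e: "e \<in> E"
    have "Poly_Mapping.lookup x (a (inv g) e) = Poly_Mapping.lookup x e" if g: "g \<in> carrier G" for g
    proof (cases "e \<in> fixed")
      case True
      then show ?thesis using g by (simp add: fixed_def)
    next
      case False
      \<comment> \<open>Being fixed is constant along orbits, so off the fixed part both
        coefficients vanish.\<close>
      have "a (inv g) e \<notin> fixed"
      proof
        assume "a (inv g) e \<in> fixed"
        then have "a g (a (inv g) e) = a (inv g) e" using g by (simp add: fixed_def)
        then show False using a_inv(2)[OF g e] False \<open>a (inv g) e \<in> fixed\<close> by simp
      qed
      then show ?thesis using False lookup_eq_zero[OF assms] by simp
    qed
    then show "Poly_Mapping.lookup (norm_frag x) e = Poly_Mapping.lookup (frag_cmul (int (card (carrier G))) x) e"
      using lookup_norm[OF x e] by simp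
  qed
qed

text \<open>At a fixed basis element the norm multiplies the coefficient of \<open>y\<close> by the
  order of the group. The witness is therefore \<open>y\<close> restricted to \<open>fixed\<close>,
  since \<open>x\<close> has no other coefficients.\<close>

lemma norm_image_in_fixed:
  assumes x: "Poly_Mapping.keys x \<subseteq> fixed" and y: "Poly_Mapping.keys y \<subseteq> E" and eq: "x = norm_frag y"
  shows "\<exists>z. Poly_Mapping.keys z \<subseteq> fixed \<and> x = frag_cmul (int (card (carrier G))) z"
proof (intro exI conjI)
  show "Poly_Mapping.keys (frag_restrict fixed y) \<subseteq> fixed" by (simp add: keys_frag_restrict)
  show "x = frag_cmul (int (card (carrier G))) (frag_restrict fixed y)"
  proof (rule frag_eqI)
    show "Poly_Mapping.keys x \<subseteq> E" using x fixed_subset by blast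
    show "Poly_Mapping.keys (frag_cmul (int (card (carrier G))) (frag_restrict fixed y)) \<subseteq> E"
      using keys_cmul[of _ "frag_restrict fixed y"] fixed_subset by (auto simp: keys_frag_restrict)
    fix e assume e: "e \<in> E"
    show "Poly_Mapping.lookup x e = Poly_Mapping.lookup (frag_cmul (int (card (carrier G))) (frag_restrict fixed y)) e"
    proof (cases "e \<in> fixed")
      case True
      then have "a (inv g) e = e" if "g \<in> carrier G" for g using that by (simp add: fixed_def)
      then show ?thesis using lookup_norm[OF y e] eq True by (simp add: lookup_frag_restrict)
    next
      case False
      then show ?thesis using lookup_eq_zero[OF x] by (simp add: lookup_frag_restrict)
    qed
  qed
qed

definition rep :: "'o \<Rightarrow> 'e" where "rep = inv_into E r"

lemma rep: "e \<in> E \<Longrightarrow> rep (r e) \<in> E \<and> r (rep (r e)) = r e"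
  unfolding rep_def by (simp add: inv_into_into f_inv_into_f)

text \<open>In one direction the norm factors through \<open>quot\<close>, as basis elements of one
  orbit have equal norms. In the other, applying \<open>quot\<close> to a norm multiplies
  \<open>quot x\<close> by the order of the group, and a free Abelian group has no torsion.\<close>

lemma quot_zero_iff:
  assumes x: "Poly_Mapping.keys x \<subseteq> E"
  shows "quot x = 0 \<longleftrightarrow> norm_frag x = 0"
proof
  let ?s = "frag_extend (\<lambda>c. frag_of (rep c))"
  have "norm_frag (?s (quot x)) = norm_frag x"
    using x
  proof (induction x rule: frag_induction)
    case zero
    show ?case by (simp add: quot_def)
  next
    case (one e)
    obtain h where h: "h \<in> carrier G" "rep (r e) = a h e"
      using rep[OF one] r_eq_iff[of e "rep (r e)"] one by auto
    have "(\<Sum>g\<in>carrier G. frag_of (a g (a h e))) = (\<Sum>g\<in>carrier G. frag_of (a (g \<otimes> h) e))"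
      using a_mult h one by (intro sum.cong) auto
    \<comment> \<open>Right translation by \<open>h\<close> permutes the group, so \<open>e\<close>
      and its chosen representative have the same norm.\<close>
    also have "\<dots> = (\<Sum>g\<in>carrier G. frag_of (a g e))"
      by (rule sum.reindex_bij_betw[OF bij_betwI[where g = "\<lambda>g. g \<otimes> inv h"]]) (use h in \<open>auto simp: m_assoc\<close>)
    finally show ?case using h by (simp add: quot_def norm_frag_def act_def)
  next
    case (diff x y)
    then show ?case by (simp add: quot_def norm_frag_def act_def frag_extend_diff sum_subtractf)
  qed
  then show "quot x = 0 \<Longrightarrow> norm_frag x = 0"
    by (simp add: norm_frag_def act_def)
next
  assume N: "norm_frag x = 0"
  have "quot (norm_frag x) = frag_cmul (int (card (carrier G))) (quot x)"
    using x
  proof (induction x rule: frag_induction)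
    case zero
    show ?case by (simp add: quot_def norm_frag_def act_def)
  next
    case (one e)
    have "r (a g e) = r e" if "g \<in> carrier G" for g
      using r_eq_iff[OF one, of "a g e"] a_closed[OF that one] that by auto
    then show ?case
      by (auto simp: quot_def norm_frag_def act_def frag_extend_sum[OF fin] intro!: poly_mapping_eqI simp: lookup_sum)
  next
    case (diff x y)
    then show ?case
      by (simp add: quot_def norm_frag_def act_def frag_extend_diff sum_subtractf frag_cmul_diff)
  qed
  then have "frag_cmul (int (card (carrier G))) (quot x) = 0" using N by (simp add: quot_def)
  moreover have "card (carrier G) \<noteq> 0" using fin one_closed by auto
  ultimately show "quot x = 0" by simp
qed

lemma quot_surj:
  assumes "Poly_Mapping.keys y \<subseteq> r ` E" shows "\<exists>x. Poly_Mapping.keys x \<subseteq> E \<and> quot x = y"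
proof (intro exI conjI)
  let ?s = "frag_extend (\<lambda>c. frag_of (rep c))"
  have "(\<Union>c\<in>Poly_Mapping.keys y. Poly_Mapping.keys (frag_of (rep c))) \<subseteq> E"
    using assms rep by (auto simp: keys_frag_of)
  then show "Poly_Mapping.keys (?s y) \<subseteq> E" by (rule order_trans[OF keys_frag_extend])
  show "quot (?s y) = y"
    using assms
  proof (induction y rule: frag_induction)
    case zero
    show ?case by (simp add: quot_def)
  next
    case (one c)
    then show ?case using rep by (auto simp: quot_def)
  next
    case (diff x y)
    then show ?case by (simp add: quot_def frag_extend_diff)
  qed
qed

text \<open>\<open>u\<close> is the part of \<open>x\<close> on fixed elements, and \<open>y\<close>
  keeps the coefficients of \<open>x\<close> at one representative of each free orbit. By
  invariance, the norm spreads these coefficients over the free orbits and reproduces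
  \<open>x\<close> there.\<close>

lemma invariant_decomposition:
  assumes x: "Poly_Mapping.keys x \<subseteq> E" and inv: "\<And>g. g \<in> carrier G \<Longrightarrow> act g x = x"
  shows "\<exists>u y. Poly_Mapping.keys u \<subseteq> fixed \<and> Poly_Mapping.keys y \<subseteq> E \<and> x = u + norm_frag y"
proof (intro exI conjI)
  define R where "R = {e \<in> E. e \<notin> fixed \<and> rep (r e) = e}"
  let ?u = "frag_restrict fixed x" and ?y = "frag_restrict R x"
  show "Poly_Mapping.keys ?u \<subseteq> fixed" by (simp add: keys_frag_restrict)
  show y: "Poly_Mapping.keys ?y \<subseteq> E" using x by (auto simp: keys_frag_restrict)
  show "x = ?u + norm_frag ?y"
  proof (rule frag_eqI[OF x])
    show "Poly_Mapping.keys (?u + norm_frag ?y) \<subseteq> E"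
      using keys_add[of ?u "norm_frag ?y"] keys_norm[OF y] x by (auto simp: keys_frag_restrict)
    fix e assume e: "e \<in> E"
    have N: "Poly_Mapping.lookup (norm_frag ?y) e = (\<Sum>g\<in>carrier G. if a (inv g) e \<in> R then Poly_Mapping.lookup x (a (inv g) e) else 0)"
      using lookup_norm[OF y e] by (simp add: lookup_frag_restrict)
    show "Poly_Mapping.lookup x e = Poly_Mapping.lookup (?u + norm_frag ?y) e"
    proof (cases "e \<in> fixed")
      case True
      then have "a (inv g) e \<notin> R" if "g \<in> carrier G" for g using that by (simp add: fixed_def R_def)
      then show ?thesis using True N by (simp add: lookup_add lookup_frag_restrict)
    next
      case False
      obtain k where k: "k \<in> carrier G" "rep (r e) = a k e"
        using rep[OF e] r_eq_iff[of e "rep (r e)"] e by auto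
      define h where "h = inv k"
      have h: "h \<in> carrier G" "a (inv h) e = rep (r e)" using k by (simp_all add: h_def)
      have nf: "a g e \<notin> fixed" if g: "g \<in> carrier G" for g
      proof
        assume *: "a g e \<in> fixed"
        then have "a (inv g) (a g e) = a g e" using g by (simp add: fixed_def)
        then show False using a_inv(1)[OF g e] * False by simp
      qed
      \<comment> \<open>In a free orbit exactly one group element carries \<open>e\<close> to the
        representative; uniqueness is \<open>alternative\<close>. Only one summand of the norm
        survives.\<close>
      have iff: "a (inv g) e \<in> R \<longleftrightarrow> g = h" if g: "g \<in> carrier G" for g
      proof
        assume "a (inv g) e \<in> R"
        moreover have "r (a (inv g) e) = r e"
          using r_eq_iff[OF e a_closed[OF inv_closed[OF g] e]] g by auto
        ultimately have "a (inv g) e = a (inv h) e" using h by (simp add: R_def)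
        then have "a (h \<otimes> inv g) e = e" using a_mult[OF h(1) inv_closed[OF g] e] a_inv(2)[OF h(1) e] by simp
        moreover have "h \<otimes> inv g \<in> carrier G" using h g by simp
        ultimately have "h \<otimes> inv g = \<one>" using alternative[OF e] False e unfolding fixed_def by blast
        then show "g = h" using h(1) g inv_solve_right'[of \<one> h g] by simp
      next
        assume "g = h"
        then show "a (inv g) e \<in> R"
          using h rep[OF e] nf[OF inv_closed[OF h(1)]] by (simp add: R_def)
      qed
      have "Poly_Mapping.lookup (norm_frag ?y) e = (\<Sum>g\<in>carrier G. if g = h then Poly_Mapping.lookup x (a (inv h) e) else 0)"
        unfolding N using iff by (intro sum.cong) auto
      also have "\<dots> = Poly_Mapping.lookup x (a (inv h) e)" using fin h(1) by simp
      also have "\<dots> = Poly_Mapping.lookup x e" using lookup_act[OF h(1) x e] inv[OF h(1)] by simp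
      finally show ?thesis using False by (simp add: lookup_add lookup_frag_restrict)
    qed
  qed
qed

end

section \<open>Norms on chain groups with equivariant bases\<close>

lemma hom_finprod:
  assumes "comm_group K" "comm_group L" and h: "h \<in> hom K L" and A: "finite A" and f: "f \<in> A \<rightarrow> carrier K"
  shows "h (finprod K f A) = finprod L (\<lambda>a. h (f a)) A"
proof -
  interpret K: comm_group K by fact
  interpret L: comm_group L by fact
  interpret h: group_hom K L h by (intro group_hom.intro group_hom_axioms.intro h K.is_group L.is_group)
  show ?thesis
    using A f
  proof (induction A rule: finite_induct)
    case (insert a A)
    then have "f a \<in> carrier K" "f \<in> A \<rightarrow> carrier K" by auto
    moreover have "(\<lambda>a. h (f a)) \<in> A \<rightarrow> carrier L"
      using \<open>f \<in> A \<rightarrow> carrier K\<close> by (auto intro: h.hom_closed)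
    ultimately show ?case using insert by simp
  qed simp
qed

lemma finprod_free_Abelian_group:
  assumes "finite A" "\<And>a. a \<in> A \<Longrightarrow> Poly_Mapping.keys (f a) \<subseteq> I"
  shows "finprod (free_Abelian_group I) f A = sum f A"
proof -
  interpret comm_group "free_Abelian_group I" by (rule abelian_free_Abelian_group)
  show ?thesis
    using assms
  proof (induction A rule: finite_induct)
    case (insert a A)
    then have "f \<in> A \<rightarrow> carrier (free_Abelian_group I)" by auto
    then show ?case using insert by simp
  qed simp
qed

lemma (in free_or_fixed) act_norm:
  assumes x: "Poly_Mapping.keys x \<subseteq> E" and g: "g \<in> carrier G"
  shows "act g (norm_frag x) = norm_frag x"
proof (rule frag_eqI[OF keys_act[OF g keys_norm[OF x]] keys_norm[OF x]])
  fix e assume e: "e \<in> E"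
  have "Poly_Mapping.lookup (act g (norm_frag x)) e
      = (\<Sum>h\<in>carrier G. Poly_Mapping.lookup x (a (inv h) (a (inv g) e)))"
    unfolding lookup_act[OF g keys_norm[OF x] e]
    by (rule lookup_norm[OF x a_closed[OF inv_closed[OF g] e]])
  also have "\<dots> = (\<Sum>h\<in>carrier G. Poly_Mapping.lookup x (a (inv (g \<otimes> h)) e))"
    using g e by (intro sum.cong) (simp_all add: a_mult inv_mult_group)
  \<comment> \<open>Left translation by \<open>g\<close> permutes the group, so the sum over
    \<open>g \<otimes> h\<close> is the sum over \<open>h\<close>.\<close>
  also have "\<dots> = (\<Sum>h\<in>carrier G. Poly_Mapping.lookup x (a (inv h) e))"
    by (rule sum.reindex_bij_betw[OF bij_betwI[where g = "\<lambda>h. inv g \<otimes> h"]]) (use g in \<open>auto simp: m_assoc[symmetric]\<close>)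
  finally show "Poly_Mapping.lookup (act g (norm_frag x)) e = Poly_Mapping.lookup (norm_frag x) e"
    using lookup_norm[OF x e] by simp
qed

text \<open>A dictionary between abstract chain groups and permutation modules. Homomorphisms from a
  free Abelian group are determined on the basis, so three conditions on basis elements translate
  action, projection and inclusion into \<open>act\<close>, \<open>quot\<close> and restriction of
  indices. The lemmas below transport the facts on permutation modules.\<close>

locale equivariant_bases = free_or_fixed G I a r
  for G :: "'g monoid" (structure) and I :: "'e set" and a and r :: "'e \<Rightarrow> 'o" +
  fixes C :: "'c monoid" and Q :: "'q monoid" and F :: "'f monoid" and hC hQ hF actC q i
  assumes C: "comm_group C" and Q: "comm_group Q" and F: "comm_group F"
    and hC: "hC \<in> iso (free_Abelian_group I) C" and hQ: "hQ \<in> iso (free_Abelian_group (r ` I)) Q"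
    and hF: "hF \<in> iso (free_Abelian_group fixed) F"
    and actC: "g \<in> carrier G \<Longrightarrow> actC g \<in> hom C C" and q: "q \<in> hom C Q" and i: "i \<in> hom F C"
    and actC_basis: "\<lbrakk>g \<in> carrier G; e \<in> I\<rbrakk> \<Longrightarrow> actC g (hC (frag_of e)) = hC (frag_of (a g e))"
    and q_basis: "e \<in> I \<Longrightarrow> q (hC (frag_of e)) = hQ (frag_of (r e))"
    and i_basis: "e \<in> fixed \<Longrightarrow> i (hF (frag_of e)) = hC (frag_of e)"
begin

sublocale C: comm_group C by (rule C)
sublocale Q: comm_group Q by (rule Q)
sublocale F: comm_group F by (rule F)

sublocale hC: group_hom "free_Abelian_group I" C hC
  using hC by (intro group_hom.intro group_hom_axioms.intro C.is_group group_free_Abelian_group) (simp add: iso_def)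
sublocale hQ: group_hom "free_Abelian_group (r ` I)" Q hQ
  using hQ by (intro group_hom.intro group_hom_axioms.intro Q.is_group group_free_Abelian_group) (simp add: iso_def)
sublocale hF: group_hom "free_Abelian_group fixed" F hF
  using hF by (intro group_hom.intro group_hom_axioms.intro F.is_group group_free_Abelian_group) (simp add: iso_def)

definition N :: "'c \<Rightarrow> 'c" where "N c = finprod C (\<lambda>g. actC g c) (carrier G)"

lemma C_cases: assumes "c \<in> carrier C" obtains x where "Poly_Mapping.keys x \<subseteq> I" "c = hC x"
proof -
  have "carrier C = hC ` carrier (free_Abelian_group I)" using hC by (simp add: iso_def bij_betw_def)
  then obtain x where "c = hC x" "x \<in> carrier (free_Abelian_group I)" using assms by blast
  then show thesis using that by simp
qed

lemma F_cases: assumes "c \<in> carrier F" obtains x where "Poly_Mapping.keys x \<subseteq> fixed" "c = hF x"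
proof -
  have "carrier F = hF ` carrier (free_Abelian_group fixed)" using hF by (simp add: iso_def bij_betw_def)
  then obtain x where "c = hF x" "x \<in> carrier (free_Abelian_group fixed)" using assms by blast
  then show thesis using that by simp
qed

lemma hC_closed: "Poly_Mapping.keys x \<subseteq> I \<Longrightarrow> hC x \<in> carrier C"
  by (rule hC.hom_closed) simp

lemma hF_closed: "Poly_Mapping.keys x \<subseteq> fixed \<Longrightarrow> hF x \<in> carrier F"
  by (rule hF.hom_closed) simp

lemma hC_inj: "\<lbrakk>Poly_Mapping.keys x \<subseteq> I; Poly_Mapping.keys y \<subseteq> I; hC x = hC y\<rbrakk> \<Longrightarrow> x = y"
  using hC by (simp add: iso_def bij_betw_def inj_on_def)

lemma hQ_inj: "\<lbrakk>Poly_Mapping.keys x \<subseteq> r ` I; Poly_Mapping.keys y \<subseteq> r ` I; hQ x = hQ y\<rbrakk> \<Longrightarrow> x = y"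
  using hQ by (simp add: iso_def bij_betw_def inj_on_def)

lemma actC_hC: assumes g: "g \<in> carrier G" and x: "Poly_Mapping.keys x \<subseteq> I" shows "actC g (hC x) = hC (act g x)"
proof -
  have "(actC g \<circ> hC) x = (hC \<circ> act g) x"
  proof (rule hom_free_Abelian_group_eqI[OF C.is_group _ _ _ x])
    show "actC g \<circ> hC \<in> hom (free_Abelian_group I) C" by (rule Group.hom_compose[OF hC.homh actC[OF g]])
    show "hC \<circ> act g \<in> hom (free_Abelian_group I) C" by (rule Group.hom_compose[OF act_hom[OF g] hC.homh])
    show "(actC g \<circ> hC) (frag_of e) = (hC \<circ> act g) (frag_of e)" if "e \<in> I" for e
      using actC_basis[OF g that] by (simp add: act_def)
  qed
  then show ?thesis by simp
qed

lemma quot_hom: "quot \<in> hom (free_Abelian_group I) (free_Abelian_group (r ` I))"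
  unfolding quot_def by (rule frag_extend_hom) (simp add: keys_frag_of)

lemma keys_quot: "Poly_Mapping.keys x \<subseteq> I \<Longrightarrow> Poly_Mapping.keys (quot x) \<subseteq> r ` I"
  using hom_in_carrier[OF quot_hom, of x] by simp

lemma q_hC: assumes x: "Poly_Mapping.keys x \<subseteq> I" shows "q (hC x) = hQ (quot x)"
proof -
  have "(q \<circ> hC) x = (hQ \<circ> quot) x"
  proof (rule hom_free_Abelian_group_eqI[OF Q.is_group _ _ _ x])
    show "q \<circ> hC \<in> hom (free_Abelian_group I) Q" by (rule Group.hom_compose[OF hC.homh q])
    show "hQ \<circ> quot \<in> hom (free_Abelian_group I) Q" by (rule Group.hom_compose[OF quot_hom hQ.homh])
    show "(q \<circ> hC) (frag_of e) = (hQ \<circ> quot) (frag_of e)" if "e \<in> I" for e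
      using q_basis[OF that] by (simp add: quot_def)
  qed
  then show ?thesis by simp
qed

lemma i_hF: assumes x: "Poly_Mapping.keys x \<subseteq> fixed" shows "i (hF x) = hC x"
proof -
  have "(i \<circ> hF) x = hC x"
  proof (rule hom_free_Abelian_group_eqI[OF C.is_group _ _ _ x])
    show "i \<circ> hF \<in> hom (free_Abelian_group fixed) C" by (rule Group.hom_compose[OF hF.homh i])
    show "hC \<in> hom (free_Abelian_group fixed) C"
      by (rule homI) (use fixed_subset hC_closed hC.hom_mult in auto)
    show "(i \<circ> hF) (frag_of e) = hC (frag_of e)" if "e \<in> fixed" for e
      using i_basis[OF that] by simp
  qed
  then show ?thesis by simp
qed

lemma N_hC: assumes x: "Poly_Mapping.keys x \<subseteq> I" shows "N (hC x) = hC (norm_frag x)"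
proof -
  have "N (hC x) = finprod C (\<lambda>g. hC (act g x)) (carrier G)"
    unfolding N_def by (rule C.finprod_cong') (use actC_hC x keys_act hC_closed in auto)
  also have "\<dots> = hC (finprod (free_Abelian_group I) (\<lambda>g. act g x) (carrier G))"
    by (rule hom_finprod[symmetric, OF abelian_free_Abelian_group C hC.homh fin]) (use keys_act x in auto)
  also have "finprod (free_Abelian_group I) (\<lambda>g. act g x) (carrier G) = norm_frag x"
    unfolding norm_frag_def by (rule finprod_free_Abelian_group[OF fin]) (rule keys_act[OF _ x])
  finally show ?thesis .
qed

lemma actC_closed: "\<lbrakk>g \<in> carrier G; c \<in> carrier C\<rbrakk> \<Longrightarrow> actC g c \<in> carrier C"
  by (rule hom_in_carrier[OF actC])

lemma N_hom: "N \<in> hom C C"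
proof (rule homI)
  show "N c \<in> carrier C" if "c \<in> carrier C" for c
    unfolding N_def by (rule C.finprod_closed) (use actC_closed that in auto)
  show "N (c \<otimes>\<^bsub>C\<^esub> d) = N c \<otimes>\<^bsub>C\<^esub> N d" if cd: "c \<in> carrier C" "d \<in> carrier C" for c d
  proof -
    have "finprod C (\<lambda>g. actC g (c \<otimes>\<^bsub>C\<^esub> d)) (carrier G) = finprod C (\<lambda>g. actC g c \<otimes>\<^bsub>C\<^esub> actC g d) (carrier G)"
      by (rule C.finprod_cong') (use cd actC_closed hom_mult[OF actC] in auto)
    then show ?thesis unfolding N_def using C.finprod_multf[of "\<lambda>g. actC g c" "carrier G" "\<lambda>g. actC g d"] cd actC_closed by auto
  qed
qed

lemma act_N: assumes "g \<in> carrier G" "c \<in> carrier C" shows "actC g (N c) = N c"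
  using assms(2) by (rule C_cases) (simp add: N_hC actC_hC[OF assms(1) keys_norm] act_norm[OF _ assms(1)])

lemma q_surj: "q ` carrier C = carrier Q"
proof (intro equalityI subsetI)
  fix y assume "y \<in> carrier Q"
  moreover have "carrier Q = hQ ` carrier (free_Abelian_group (r ` I))" using hQ by (simp add: iso_def bij_betw_def)
  ultimately obtain w where w: "Poly_Mapping.keys w \<subseteq> r ` I" "y = hQ w" by auto
  obtain x where x: "Poly_Mapping.keys x \<subseteq> I" "quot x = w" using quot_surj[OF w(1)] by blast
  have "y = q (hC x)" using q_hC[OF x(1)] x w by simp
  then show "y \<in> q ` carrier C" by (rule image_eqI[OF _ hC_closed[OF x(1)]])
next
  fix y assume "y \<in> q ` carrier C"
  then show "y \<in> carrier Q" using hom_in_carrier[OF q] by blast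
qed

lemma q_one_iff: assumes "c \<in> carrier C" shows "q c = \<one>\<^bsub>Q\<^esub> \<longleftrightarrow> N c = \<one>\<^bsub>C\<^esub>"
proof -
  obtain x where x: "Poly_Mapping.keys x \<subseteq> I" "c = hC x" by (rule C_cases[OF assms])
  have "q c = \<one>\<^bsub>Q\<^esub> \<longleftrightarrow> quot x = 0"
    using q_hC[OF x(1)] x(2) hQ_inj[OF keys_quot[OF x(1)], of 0] hQ.hom_one by auto
  also have "\<dots> \<longleftrightarrow> norm_frag x = 0" by (rule quot_zero_iff[OF x(1)])
  also have "\<dots> \<longleftrightarrow> N c = \<one>\<^bsub>C\<^esub>"
    using N_hC[OF x(1)] x(2) hC_inj[OF keys_norm[OF x(1)], of 0] hC.hom_one by auto
  finally show ?thesis .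
qed

lemma act_i: assumes g: "g \<in> carrier G" and "x \<in> carrier F" shows "actC g (i x) = i x"
proof -
  obtain y where y: "Poly_Mapping.keys y \<subseteq> fixed" "x = hF y" by (rule F_cases[OF assms(2)])
  have yI: "Poly_Mapping.keys y \<subseteq> I" using y(1) fixed_subset by (rule order_trans)
  have "actC g (hC y) = hC y"
  proof -
    have "act g y = y"
      using y(1)
    proof (induction y rule: frag_induction)
      case (one e)
      then show ?case using g by (simp add: act_def fixed_def)
    qed (simp_all add: act_def frag_extend_diff)
    then show ?thesis using actC_hC[OF g yI] by simp
  qed
  then show ?thesis using i_hF[OF y(1)] y(2) by simp
qed

lemma invariant_decomp:
  assumes c: "c \<in> carrier C" and inv: "\<And>g. g \<in> carrier G \<Longrightarrow> actC g c = c"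
  shows "\<exists>x\<in>carrier F. \<exists>y\<in>carrier C. c = i x \<otimes>\<^bsub>C\<^esub> N y"
proof -
  obtain x where x: "Poly_Mapping.keys x \<subseteq> I" "c = hC x" by (rule C_cases[OF c])
  have "act g x = x" if g: "g \<in> carrier G" for g
    by (rule hC_inj[OF keys_act[OF g x(1)] x(1)]) (use actC_hC[OF g x(1)] inv[OF g] x(2) in simp)
  then obtain u y where uy: "Poly_Mapping.keys u \<subseteq> fixed" "Poly_Mapping.keys y \<subseteq> I" "x = u + norm_frag y"
    using invariant_decomposition[OF x(1)] by blast
  have "hC x = hC u \<otimes>\<^bsub>C\<^esub> hC (norm_frag y)"
    using hC.hom_mult[of u "norm_frag y"] uy keys_norm[OF uy(2)] fixed_subset by auto
  then have "c = i (hF u) \<otimes>\<^bsub>C\<^esub> N (hC y)" using x(2) i_hF[OF uy(1)] N_hC[OF uy(2)] by simp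
  then show ?thesis using hF_closed[OF uy(1)] hC_closed[OF uy(2)] by blast
qed

lemma i_eq_N:
  assumes "x \<in> carrier F" "y \<in> carrier C" "i x = N y"
  shows "\<exists>x'\<in>carrier F. x = x' [^]\<^bsub>F\<^esub> card (carrier G)"
proof -
  obtain v where v: "Poly_Mapping.keys v \<subseteq> fixed" "x = hF v" by (rule F_cases[OF assms(1)])
  obtain w where w: "Poly_Mapping.keys w \<subseteq> I" "y = hC w" by (rule C_cases[OF assms(2)])
  have "v = norm_frag w"
    by (rule hC_inj[OF order_trans[OF v(1) fixed_subset] keys_norm[OF w(1)]])
       (use assms(3) v(2) w(2) i_hF[OF v(1)] N_hC[OF w(1)] in simp)
  then obtain z where z: "Poly_Mapping.keys z \<subseteq> fixed" "v = frag_cmul (int (card (carrier G))) z"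
    using norm_image_in_fixed[OF v(1) w(1)] by blast
  have "x = hF z [^]\<^bsub>F\<^esub> card (carrier G)"
    using hF.hom_nat_pow[of z "card (carrier G)"] z v(2) by simp
  then show ?thesis using hF_closed[OF z(1)] by blast
qed

lemma N_i: assumes "x \<in> carrier F" shows "N (i x) = i x [^]\<^bsub>C\<^esub> card (carrier G)"
proof -
  obtain v where v: "Poly_Mapping.keys v \<subseteq> fixed" "x = hF v" by (rule F_cases[OF assms])
  have vI: "Poly_Mapping.keys v \<subseteq> I" using v(1) fixed_subset by (rule order_trans)
  have "N (i x) = hC (frag_cmul (int (card (carrier G))) v)"
    using v(2) i_hF[OF v(1)] N_hC[OF vI] norm_on_fixed[OF v(1)] by simp
  also have "\<dots> = hC v [^]\<^bsub>C\<^esub> card (carrier G)"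
    using hC.hom_nat_pow[of v "card (carrier G)"] vI by simp
  finally show ?thesis using v(2) i_hF[OF v(1)] by simp
qed

end

section \<open>Cellular chains\<close>

lemma cell_boundary_hom: "cell_boundary X E n \<in> hom (cell_chain X E n) (cell_chain X E (n - 1))"
proof -
  have "skeleton E n \<inter> skeleton E (n - 1) = skeleton E (n - 1)"
    by (rule Int_absorb1[OF skeleton_mono]) simp
  then show ?thesis
    using group_homomorphism_hom_relboundary[of n "subtopology X (skeleton E n)" "skeleton E (n - 1)" "skeleton E (n - 2)"]
    by (simp add: cell_chain_def cell_boundary_def subtopology_subtopology)
qed

text \<open>The composite contains the map from the absolute homology of the skeleton to its
  relative homology, followed by the boundary map of that pair. Exactness makes these two
  cancel.\<close>

lemma cell_boundary_boundary: "cell_boundary X E (n - 1) (cell_boundary X E n x) = \<one>\<^bsub>cell_chain X E (n - 1 - 1)\<^esub>"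
proof -
  let ?Y = "subtopology X (skeleton E n)" and ?Z = "subtopology X (skeleton E (n - 1))"
  let ?S = "skeleton E (n - 1)" and ?T = "skeleton E (n - 2)" and ?W = "skeleton E (n - 1 - 2)"
  have Z: "subtopology ?Y ?S = ?Z"
    unfolding subtopology_subtopology by (rule arg_cong[OF Int_absorb1[OF skeleton_mono]]) simp
  have n2: "skeleton E (n - 1 - 1) = ?T" "n - 1 - 1 = n - 2" by simp_all
  define v where "v = hom_boundary n ?Y ?S x"
  have v: "v \<in> carrier (homology_group (n - 1) ?Z)"
    unfolding v_def using hom_boundary_carrier[of n ?Y ?S x] unfolding Z .
  have "cell_boundary X E n x = hom_induced (n - 1) ?Z {} ?Z ?T id v"
    unfolding cell_boundary_def hom_relboundary_def v_def Z o_apply ..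
  moreover have "hom_induced (n - 1) ?Z {} ?Z ?T id v
      \<in> kernel (relative_homology_group (n - 1) ?Z ?T) (homology_group (n - 1 - 1) (subtopology ?Z ?T)) (hom_boundary (n - 1) ?Z ?T)"
  proof -
    have "hom_induced (n - 1) ?Z {} ?Z ?T id ` carrier (homology_group (n - 1) ?Z)
      = kernel (relative_homology_group (n - 1) ?Z ?T) (homology_group (n - 1 - 1) (subtopology ?Z ?T)) (hom_boundary (n - 1) ?Z ?T)"
      using homology_exactness_axiom_1[of "n - 1" ?Z ?T] unfolding exact_seq_cons_iff by simp
    then show ?thesis using v by blast
  qed
  ultimately have "hom_boundary (n - 1) ?Z ?T (cell_boundary X E n x) = \<one>\<^bsub>homology_group (n - 1 - 1) (subtopology ?Z ?T)\<^esub>"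
    by (simp only: kernel_def mem_Collect_eq)
  then have "cell_boundary X E (n - 1) (cell_boundary X E n x)
    = hom_induced (n - 1 - 1) (subtopology ?Z ?T) {} (subtopology ?Z ?T) ?W id \<one>\<^bsub>homology_group (n - 1 - 1) (subtopology ?Z ?T)\<^esub>"
    unfolding cell_boundary_def[of X E "n - 1"] hom_relboundary_def o_apply n2(1) by (simp only:)
  also have "\<dots> = \<one>\<^bsub>relative_homology_group (n - 1 - 1) (subtopology ?Z ?T) ?W\<^esub>"
    by (rule hom_one[OF hom_induced_hom group_relative_homology_group group_relative_homology_group])
  also have "subtopology ?Z ?T = subtopology X (skeleton E (n - 1 - 1))"
    unfolding subtopology_subtopology n2(1) by (rule arg_cong[OF Int_absorb1[OF skeleton_mono]]) simp
  also have "?W = skeleton E (n - 1 - 1 - 1)" by simp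
  finally show ?thesis by (simp only: cell_chain_def)
qed

lemma cell_chain_complex: "chain_complex (cell_chain X E) (cell_boundary X E)"
proof (rule chain_complex.intro)
  show "comm_group (cell_chain X E n)" for n by (simp add: cell_chain_def)
qed (rule cell_boundary_hom cell_boundary_boundary)+

text \<open>\<open>cell_induced\<close> with possibly different source and target, as needed for the
  projection to the orbit space and the inclusion of the fixed point set.\<close>

definition cellular_induced ::
    "'a topology \<Rightarrow> (nat \<Rightarrow> 'a set set) \<Rightarrow> 'b topology \<Rightarrow> (nat \<Rightarrow> 'b set set) \<Rightarrow> int \<Rightarrow> ('a \<Rightarrow> 'b) \<Rightarrow> 'a chain set \<Rightarrow> 'b chain set" where
  "cellular_induced X E Y D n f =
     hom_induced n (subtopology X (skeleton E n)) (skeleton E (n - 1)) (subtopology Y (skeleton D n)) (skeleton D (n - 1)) f"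

lemma cell_induced_eq_cellular_induced: "cell_induced X E n f = cellular_induced X E X E n f"
  by (simp add: cell_induced_def cellular_induced_def)

lemma cellular_induced_hom: "cellular_induced X E Y D n f \<in> hom (cell_chain X E n) (cell_chain Y D n)"
  unfolding cellular_induced_def cell_chain_def by (rule hom_induced_hom)

text \<open>Naturality of the boundary map of a triple. Action, projection and inclusion respect all
  skeleta, so all three are chain maps without any reference to bases.\<close>

lemma cellular_induced_boundary:
  assumes f: "continuous_map X Y f" and sk: "\<And>z. f \<in> skeleton E z \<rightarrow> skeleton D z"
  shows "cellular_induced X E Y D (n - 1) f (cell_boundary X E n c) = cell_boundary Y D n (cellular_induced X E Y D n f c)"
proof -
  have X: "subtopology (subtopology X (skeleton E n)) (skeleton E (n - 1)) = subtopology X (skeleton E (n - 1))"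
    for X :: "'x topology" and E
    unfolding subtopology_subtopology by (rule arg_cong[OF Int_absorb1[OF skeleton_mono]]) simp
  have "continuous_map (subtopology X (skeleton E n)) (subtopology Y (skeleton D n)) f"
    using continuous_map_from_subtopology[OF f] sk[of n] by (auto simp: continuous_map_in_subtopology)
  from naturality_hom_induced_relboundary[OF this sk sk, of n "n - 1" "n - 2"]
  have "cell_boundary Y D n \<circ> cellular_induced X E Y D n f
     = hom_induced (n - 1) (subtopology X (skeleton E (n - 1))) (skeleton E (n - 2))
         (subtopology Y (skeleton D (n - 1))) (skeleton D (n - 2)) f \<circ> cell_boundary X E n"
    unfolding X cell_boundary_def cellular_induced_def .
  then have "cell_boundary Y D n (cellular_induced X E Y D n f c)
     = hom_induced (n - 1) (subtopology X (skeleton E (n - 1))) (skeleton E (n - 2))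
         (subtopology Y (skeleton D (n - 1))) (skeleton D (n - 2)) f (cell_boundary X E n c)"
    by (metis o_apply)
  then show ?thesis unfolding cellular_induced_def[of X E Y D "n - 1"] by simp
qed

section \<open>Compatible bases of the cellular chain groups\<close>

lemma disc_homology_generator:
  "\<exists>u. u \<in> carrier (relative_homology_group (int n) (closed_disc n) (boundary_sphere_set n)) \<and>
     pow (relative_homology_group (int n) (closed_disc n) (boundary_sphere_set n)) u
       \<in> iso integer_group (relative_homology_group (int n) (closed_disc n) (boundary_sphere_set n))"
proof -
  let ?D = "relative_homology_group (int n) (closed_disc n) (boundary_sphere_set n)"
  have "integer_group \<cong> ?D"
    by (rule group.iso_sym[OF group_relative_homology_group isomorphic_group_disc_integer])
  then obtain h where h: "h \<in> iso integer_group ?D" by (auto simp: is_iso_def)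
  interpret h: group_hom integer_group ?D h
    using h by (intro group_hom.intro group_hom_axioms.intro group_integer_group group_relative_homology_group) (simp add: iso_def)
  have u: "h 1 \<in> carrier ?D" by (rule h.hom_closed) simp
  \<comment> \<open>A homomorphism out of the integers is determined by the image of 1, so the
    chosen isomorphism is itself a power map.\<close>
  have "pow ?D (h 1) = h"
  proof
    fix z :: int
    have "h (1 [^]\<^bsub>integer_group\<^esub> z) = h 1 [^]\<^bsub>?D\<^esub> z" by (rule h.hom_int_pow) simp
    moreover have "1 [^]\<^bsub>integer_group\<^esub> z = z"
      using int_pow_integer_mod_group[of 0 1 z] by (simp add: integer_mod_group_def)
    ultimately show "h 1 [^]\<^bsub>?D\<^esub> z = h z" by simp
  qed
  then show ?thesis using u h by (intro exI[of _ "h 1"]) (simp only: simp_thms)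
qed

text \<open>The generator \<open>u\<close> is a parameter rather than chosen inside, so that one
  generator can serve several attachments and their bases can be compared.\<close>

lemma attaching_basis_exists:
  assumes att: "attaching Y S n I \<Phi>"
    and uD: "u \<in> carrier (relative_homology_group (int n) (closed_disc n) (boundary_sphere_set n))"
    and u: "pow (relative_homology_group (int n) (closed_disc n) (boundary_sphere_set n)) u
       \<in> iso integer_group (relative_homology_group (int n) (closed_disc n) (boundary_sphere_set n))"
  shows "\<exists>h\<in>iso (free_Abelian_group I) (relative_homology_group (int n) Y S).
    \<forall>i\<in>I. h (frag_of i) = hom_induced (int n) (closed_disc n) (boundary_sphere_set n) Y S (\<Phi> i) u"
proof -
  have "(\<lambda>i. hom_induced (int n) (closed_disc n) (boundary_sphere_set n) Y S (\<Phi> i) u) ` I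
      \<subseteq> carrier (relative_homology_group (int n) Y S)"
    by (rule image_subsetI) (rule hom_induced_carrier)
  then obtain h where h: "h \<in> hom (free_Abelian_group I) (relative_homology_group (int n) Y S)"
    "\<And>i. i \<in> I \<Longrightarrow> h (frag_of i) = hom_induced (int n) (closed_disc n) (boundary_sphere_set n) Y S (\<Phi> i) u"
    using comm_group.free_Abelian_group_universal[OF abelian_relative_homology_group] by metis
  show ?thesis
    using attaching_free_basis[OF att h(1) h(2) refl uD u] h(2) by blast
qed

lemma free_Abelian_group_empty_iso:
  assumes "trivial_group K" shows "(\<lambda>_. \<one>\<^bsub>K\<^esub>) \<in> iso (free_Abelian_group ({} :: 'x set)) K"
proof -
  have K: "carrier K = {\<one>\<^bsub>K\<^esub>}" "group K" using assms by (auto simp: trivial_group_def)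
  interpret group K by (rule K)
  show ?thesis
  proof (rule isoI[OF homI])
    have "x = 0" if "x \<in> carrier (free_Abelian_group {})" for x :: "'x \<Rightarrow>\<^sub>0 int"
      using that by simp
    then have "carrier (free_Abelian_group {}) = {0 :: 'x \<Rightarrow>\<^sub>0 int}" by (intro equalityI subsetI) simp_all
    then show "bij_betw (\<lambda>_. \<one>\<^bsub>K\<^esub>) (carrier (free_Abelian_group ({} :: 'x set))) (carrier K)"
      by (subst K(1)) (simp add: bij_betw_def)
  qed simp_all
qed

text \<open>Cells are indexed by natural numbers and chain groups by integers. In negative degrees
  the chain groups are trivial, which matches an empty basis.\<close>

definition cells_of_dim :: "(nat \<Rightarrow> 'a set set) \<Rightarrow> int \<Rightarrow> 'a set set" where
  "cells_of_dim E n = (if n < 0 then {} else E (nat n))"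

context G_CW
begin

lemma act_funcset_skeleton: "g \<in> carrier G \<Longrightarrow> \<phi> g \<in> skeleton E z \<rightarrow> skeleton E z"
  using act_in_skeleton by blast

lemma orbit_funcset_skeleton: "orbit G \<phi> \<in> skeleton E z \<rightarrow> skeleton (orbit_cells G \<phi> E) z"
  unfolding skeleton_orbit_cells by blast

lemma id_funcset_skeleton: "id \<in> skeleton (fixed_cells G \<phi> X E) z \<rightarrow> skeleton E z"
  unfolding skeleton_fixed_cells by simp

lemma continuous_map_fixed_inclusion: "continuous_map (fixed_space G \<phi> X) X id"
  unfolding fixed_space_def by (rule continuous_map_from_subtopology) simp

text \<open>All three bases use the same equivariant family and the same generator \<open>u\<close>,
  so the three formulas reduce to equalities between maps on the closed disc.\<close>

lemma cell_bases:
  "\<exists>hC hQ hF. hC \<in> iso (free_Abelian_group (cells_of_dim E n)) (cell_chain X E n) \<and>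
     hQ \<in> iso (free_Abelian_group (cells_of_dim (orbit_cells G \<phi> E) n)) (cell_chain (orbit_space G \<phi> X) (orbit_cells G \<phi> E) n) \<and>
     hF \<in> iso (free_Abelian_group (cells_of_dim (fixed_cells G \<phi> X E) n)) (cell_chain (fixed_space G \<phi> X) (fixed_cells G \<phi> X E) n) \<and>
     (\<forall>g\<in>carrier G. \<forall>e\<in>cells_of_dim E n. cell_induced X E n (\<phi> g) (hC (frag_of e)) = hC (frag_of (\<phi> g ` e))) \<and>
     (\<forall>e\<in>cells_of_dim E n. cellular_induced X E (orbit_space G \<phi> X) (orbit_cells G \<phi> E) n (orbit G \<phi>) (hC (frag_of e))
        = hQ (frag_of (orbit G \<phi> ` e))) \<and>
     (\<forall>e\<in>cells_of_dim (fixed_cells G \<phi> X E) n.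
        cellular_induced (fixed_space G \<phi> X) (fixed_cells G \<phi> X E) X E n id (hF (frag_of e)) = hC (frag_of e))"
proof (cases "n < 0")
  case True
  then have "trivial_group (cell_chain X E n)"
    "trivial_group (cell_chain (orbit_space G \<phi> X) (orbit_cells G \<phi> E) n)"
    "trivial_group (cell_chain (fixed_space G \<phi> X) (fixed_cells G \<phi> X E) n)"
    by (simp_all add: cell_chain_def)
  note iso = this[THEN free_Abelian_group_empty_iso]
  have cells: "cells_of_dim E n = {}" "cells_of_dim (orbit_cells G \<phi> E) n = {}"
    "cells_of_dim (fixed_cells G \<phi> X E) n = {}"
    using True by (simp_all add: cells_of_dim_def)
  show ?thesis
    unfolding cells by (rule exI, rule exI, rule exI, intro conjI, (rule iso)+, simp_all)
next
  case False
  then obtain m where n: "n = int m" by (metis linorder_not_less zero_le_imp_eq_int)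
  let ?EQ = "orbit_cells G \<phi> E" and ?EF = "fixed_cells G \<phi> X E"
  have cells: "cells_of_dim E n = E m" "cells_of_dim ?EQ n = ?EQ m" "cells_of_dim ?EF n = ?EF m"
    by (simp_all add: cells_of_dim_def n)
  obtain \<Phi> where \<Phi>: "equivariant_family m \<Phi>" using equivariant_family_exists by blast
  obtain u where uD: "u \<in> carrier (relative_homology_group (int m) (closed_disc m) (boundary_sphere_set m))"
    and u: "pow (relative_homology_group (int m) (closed_disc m) (boundary_sphere_set m)) u
       \<in> iso integer_group (relative_homology_group (int m) (closed_disc m) (boundary_sphere_set m))"
    using disc_homology_generator by blast
  have par: "cell_parametrization X E m e (\<Phi> e)" if "e \<in> E m" for e
    using \<Phi> that by (simp add: equivariant_family_def)
  note attC = cw_attaching[OF cw par]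
  note attQ = orbit_attaching(1)[OF \<Phi>]
  note attF = fixed_attaching[OF \<Phi>]
  let ?D = "closed_disc m" and ?B = "boundary_sphere_set m"
  let ?rep = "inv_into (E m) (\<lambda>e. orbit G \<phi> ` e)"
  let ?XC = "subtopology X (skeleton E (int m))" and ?SC = "skeleton E (int m - 1)"
  let ?XQ = "subtopology (orbit_space G \<phi> X) (skeleton ?EQ (int m))" and ?SQ = "skeleton ?EQ (int m - 1)"
  let ?XF = "subtopology (fixed_space G \<phi> X) (skeleton ?EF (int m))" and ?SF = "skeleton ?EF (int m - 1)"
  obtain hC where hC: "hC \<in> iso (free_Abelian_group (E m)) (cell_chain X E n)"
    and hCb: "\<And>e. e \<in> E m \<Longrightarrow> hC (frag_of e) = hom_induced (int m) ?D ?B ?XC ?SC (\<Phi> e) u"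
    using attaching_basis_exists[OF attC uD u] unfolding cell_chain_def n by blast
  obtain hQ where hQ: "hQ \<in> iso (free_Abelian_group (?EQ m)) (cell_chain (orbit_space G \<phi> X) ?EQ n)"
    and hQb: "\<And>c. c \<in> ?EQ m \<Longrightarrow> hQ (frag_of c) = hom_induced (int m) ?D ?B ?XQ ?SQ (orbit G \<phi> \<circ> \<Phi> (?rep c)) u"
    using attaching_basis_exists[OF attQ uD u] unfolding cell_chain_def n by blast
  obtain hF where hF: "hF \<in> iso (free_Abelian_group (?EF m)) (cell_chain (fixed_space G \<phi> X) ?EF n)"
    and hFb: "\<And>e. e \<in> ?EF m \<Longrightarrow> hF (frag_of e) = hom_induced (int m) ?D ?B ?XF ?SF (\<Phi> e) u"
    using attaching_basis_exists[OF attF uD u] unfolding cell_chain_def n by blast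
  have mapC: "continuous_map ?D ?XC (\<Phi> e)" "\<Phi> e \<in> ?B \<rightarrow> ?SC" if "e \<in> E m" for e
    using attaching_map(1,2)[OF attC that] by (simp_all add: image_subset_iff_funcset)
  have mapF: "continuous_map ?D ?XF (\<Phi> e)" "\<Phi> e \<in> ?B \<rightarrow> ?SF" if "e \<in> ?EF m" for e
    using attaching_map(1,2)[OF attF that] by (simp_all add: image_subset_iff_funcset)
  have 1: "cell_induced X E n (\<phi> g) (hC (frag_of e)) = hC (frag_of (\<phi> g ` e))" if g: "g \<in> carrier G" and e: "e \<in> E m" for g e
  proof -
    have "continuous_map ?XC ?XC (\<phi> g)"
      by (rule continuous_map_into_subtopology[OF continuous_map_from_subtopology[OF continuous_act[OF g]]])
         (use act_funcset_skeleton[OF g] in auto)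
    then have "cell_induced X E n (\<phi> g) (hC (frag_of e)) = hom_induced (int m) ?D ?B ?XC ?SC (\<phi> g \<circ> \<Phi> e) u"
      unfolding cell_induced_def n hCb[OF e] by (rule hom_induced_compose'[OF mapC[OF e] _ act_funcset_skeleton[OF g]])
    \<comment> \<open>By equivariance the two maps agree at each point of the disc. No homotopy is
      involved, and therefore no sign either.\<close>
    also have "\<dots> = hom_induced (int m) ?D ?B ?XC ?SC (\<Phi> (\<phi> g ` e)) u"
    proof (rule fun_cong[OF hom_induced_eq])
      show "(\<phi> g \<circ> \<Phi> e) x = \<Phi> (\<phi> g ` e) x" if "x \<in> topspace ?D" for x
        using \<Phi> g e that by (simp add: equivariant_family_def)
    qed
    finally show ?thesis unfolding hCb[OF act_cell[OF g e]] .
  qed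
  have 2: "cellular_induced X E (orbit_space G \<phi> X) ?EQ n (orbit G \<phi>) (hC (frag_of e)) = hQ (frag_of (orbit G \<phi> ` e))"
    if e: "e \<in> E m" for e
  proof -
    have o': "orbit G \<phi> ` e \<in> ?EQ m" using e by (simp add: orbit_cells_def)
    have "continuous_map ?XC ?XQ (orbit G \<phi>)"
      by (rule continuous_map_into_subtopology[OF continuous_map_from_subtopology[OF continuous_map_orbit]])
         (use orbit_funcset_skeleton in auto)
    then have "cellular_induced X E (orbit_space G \<phi> X) ?EQ n (orbit G \<phi>) (hC (frag_of e))
        = hom_induced (int m) ?D ?B ?XQ ?SQ (orbit G \<phi> \<circ> \<Phi> e) u"
      unfolding cellular_induced_def n hCb[OF e] by (rule hom_induced_compose'[OF mapC[OF e] _ orbit_funcset_skeleton])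
    \<comment> \<open>The basis element of the orbit space was built from a representative cell.
      After projection its parametrization agrees with that of \<open>e\<close>.\<close>
    also have "\<dots> = hom_induced (int m) ?D ?B ?XQ ?SQ (orbit G \<phi> \<circ> \<Phi> (?rep (orbit G \<phi> ` e))) u"
    proof (rule fun_cong[OF hom_induced_eq])
      show "(orbit G \<phi> \<circ> \<Phi> e) x = (orbit G \<phi> \<circ> \<Phi> (?rep (orbit G \<phi> ` e))) x" if "x \<in> topspace ?D" for x
        using orbit_attaching(2)[OF \<Phi> e that] by simp
    qed
    finally show ?thesis unfolding hQb[OF o'] .
  qed
  have 3: "cellular_induced (fixed_space G \<phi> X) ?EF X E n id (hF (frag_of e)) = hC (frag_of e)" if e: "e \<in> ?EF m" for e
  proof -
    have eE: "e \<in> E m" using e by (simp add: fixed_cells_def)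
    have "continuous_map ?XF ?XC id"
      by (rule continuous_map_into_subtopology[OF continuous_map_from_subtopology[OF continuous_map_fixed_inclusion]])
         (use id_funcset_skeleton in auto)
    then have "cellular_induced (fixed_space G \<phi> X) ?EF X E n id (hF (frag_of e))
        = hom_induced (int m) ?D ?B ?XC ?SC (id \<circ> \<Phi> e) u"
      unfolding cellular_induced_def n hFb[OF e] by (rule hom_induced_compose'[OF mapF[OF e] _ id_funcset_skeleton])
    then show ?thesis unfolding hCb[OF eE] id_comp .
  qed
  show ?thesis
    unfolding cells
    by (intro exI[of _ hC] exI[of _ hQ] exI[of _ hF] conjI ballI hC hQ hF 1 2 3)
qed

end

section \<open>The long exact sequence for a group of prime order\<close>

context G_CW
begin

lemma cell_nonempty: assumes "e \<in> E n" shows "e \<noteq> {}"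
proof -
  obtain \<Phi> where "cell_parametrization X E n e \<Phi>" using cw_parametrization[OF cw assms] by blast
  then have "\<Phi> ` open_disc_set n = e" by (simp add: cell_parametrization_def)
  moreover have "(\<lambda>i. 0) \<in> open_disc_set n" by (simp add: open_disc_set_eq)
  ultimately show ?thesis by blast
qed

text \<open>By Lagrange the order of the stabilizer of the cell divides a prime. The unit and
  \<open>g\<close> are two different members, so the stabilizer is the whole group.\<close>

lemma prime_order_stabilizer:
  assumes p: "prime (card (carrier G))" and e: "e \<in> E n" and g: "g \<in> carrier G" "\<phi> g ` e = e" "g \<noteq> \<one>\<^bsub>G\<^esub>"
    and h: "h \<in> carrier G"
  shows "\<phi> h ` e = e"
proof -
  interpret group G by (rule group_G)
  let ?H = "{h \<in> carrier G. \<phi> h ` e = e}"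
  have eT: "e \<subseteq> topspace X" by (rule cell_subset[OF e])
  have gH: "g \<in> ?H" using g by simp
  have H: "subgroup ?H G"
  proof (rule subgroupI)
    show "?H \<subseteq> carrier G" by (rule Collect_restrict)
    show "?H \<noteq> {}"
    proof
      assume "?H = {}"
      then show False using gH by (simp only: empty_iff)
    qed
    fix k assume k: "k \<in> ?H"
    then have "k \<in> carrier G" "\<phi> k ` e = e" by simp_all
    then show "inv\<^bsub>G\<^esub> k \<in> ?H"
      using act_image_inv[OF _ eT, of k] by simp
    fix l assume "l \<in> ?H"
    then show "k \<otimes>\<^bsub>G\<^esub> l \<in> ?H"
      using k act_image_mult[OF eT, of k l] by simp
  qed
  have "card ?H dvd card (carrier G)"
    using dvd_triv_right[of "card ?H" "card (rcosets\<^bsub>G\<^esub> ?H)"] unfolding lagrange[OF H] order_def .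
  then have "card ?H = 1 \<or> card ?H = card (carrier G)" using p by (simp add: prime_nat_iff)
  moreover have "card ?H \<noteq> 1"
  proof
    assume "card ?H = 1"
    then obtain z where z: "?H = {z}" by (rule card_1_singletonE)
    have "g \<in> ?H" "\<one>\<^bsub>G\<^esub> \<in> ?H" using gH act_image_one[OF eT] by simp_all
    then show False using g(3) unfolding z by simp
  qed
  ultimately have "?H = carrier G" using card_subset_eq[OF finite_G Collect_restrict] by simp
  then have "h \<in> ?H" using h by simp
  then show ?thesis by simp
qed

lemma free_or_fixed_cells:
  assumes p: "prime (card (carrier G))"
  shows "free_or_fixed G (cells_of_dim E n) (\<lambda>g e. \<phi> g ` e) (\<lambda>e. orbit G \<phi> ` e)"
proof (rule free_or_fixed.intro)
  have cell: "e \<in> E (nat n)" if "e \<in> cells_of_dim E n" for e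
    using that by (simp add: cells_of_dim_def split: if_splits)
  show "group G" "finite (carrier G)" by (rule group_G finite_G)+
  show "\<phi> g ` e \<in> cells_of_dim E n" if "g \<in> carrier G" "e \<in> cells_of_dim E n" for g e
    using that act_cell by (simp add: cells_of_dim_def split: if_splits)
  show "\<phi> (g \<otimes>\<^bsub>G\<^esub> h) ` e = \<phi> g ` \<phi> h ` e" if "g \<in> carrier G" "h \<in> carrier G" "e \<in> cells_of_dim E n" for g h e
    by (rule act_image_mult[OF cell_subset[OF cell[OF that(3)]] that(1,2)])
  show "\<phi> \<one>\<^bsub>G\<^esub> ` e = e" if "e \<in> cells_of_dim E n" for e
    by (rule act_image_one[OF cell_subset[OF cell[OF that]]])
  show "\<phi> h ` e = e" if "e \<in> cells_of_dim E n" "g \<in> carrier G" "\<phi> g ` e = e" "g \<noteq> \<one>\<^bsub>G\<^esub>" "h \<in> carrier G" for e g h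
    by (rule prime_order_stabilizer[OF p cell[OF that(1)] that(2-5)])
  show "orbit G \<phi> ` e = orbit G \<phi> ` f \<longleftrightarrow> (\<exists>g\<in>carrier G. f = \<phi> g ` e)"
    if "e \<in> cells_of_dim E n" "f \<in> cells_of_dim E n" for e f
  proof
    assume "orbit G \<phi> ` e = orbit G \<phi> ` f"
    then have "orbit G \<phi> ` e \<inter> orbit G \<phi> ` f = orbit G \<phi> ` e" by (simp only: Int_absorb)
    moreover have "orbit G \<phi> ` e \<noteq> {}" using cell_nonempty[OF cell[OF that(1)]] by simp
    ultimately have "orbit G \<phi> ` e \<inter> orbit G \<phi> ` f \<noteq> {}" by (simp only: not_False_eq_True)
    then show "\<exists>g\<in>carrier G. f = \<phi> g ` e" by (rule orbit_cell_eqD[OF cell[OF that(1)] cell[OF that(2)]])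
  next
    assume "\<exists>g\<in>carrier G. f = \<phi> g ` e"
    then obtain g where g: "g \<in> carrier G" "f = \<phi> g ` e" by blast
    show "orbit G \<phi> ` e = orbit G \<phi> ` f"
      unfolding g(2) by (rule orbit_image_act[symmetric, OF g(1) cell_subset[OF cell[OF that(1)]]])
  qed
qed

lemma orbit_cells_of_dim: "cells_of_dim (orbit_cells G \<phi> E) n = (\<lambda>e. orbit G \<phi> ` e) ` cells_of_dim E n"
  by (simp add: cells_of_dim_def orbit_cells_def)

text \<open>A cell that is preserved by an element is fixed pointwise by it, so the cells of the
  fixed point set are those that the permutation action on cells fixes.\<close>

lemma fixed_cells_of_dim:
  "cells_of_dim (fixed_cells G \<phi> X E) n = {e \<in> cells_of_dim E n. \<forall>g\<in>carrier G. \<phi> g ` e = e}"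
proof -
  have fixed: "e \<subseteq> fixed_points G \<phi> X \<longleftrightarrow> (\<forall>g\<in>carrier G. \<phi> g ` e = e)" if e: "e \<in> E m" for e m
  proof
    assume *: "e \<subseteq> fixed_points G \<phi> X"
    show "\<forall>g\<in>carrier G. \<phi> g ` e = e"
    proof
      fix g assume "g \<in> carrier G"
      then have "\<phi> g x = x" if "x \<in> e" for x using * that by (auto simp: fixed_points_def)
      then show "\<phi> g ` e = e" by simp
    qed
  next
    assume "\<forall>g\<in>carrier G. \<phi> g ` e = e"
    then show "e \<subseteq> fixed_points G \<phi> X"
      using act_cell_fix[OF _ e] cell_subset[OF e] by (auto simp: fixed_points_def)
  qed
  have "{e \<in> E (nat n). e \<subseteq> fixed_points G \<phi> X} = {e \<in> E (nat n). \<forall>g\<in>carrier G. \<phi> g ` e = e}"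
    by (rule Collect_cong) (rule conj_cong[OF refl fixed])
  then show ?thesis by (simp add: cells_of_dim_def fixed_cells_def)
qed

section \<open>Chain-level data of a complex with an action of prime order\<close>

abbreviation "XQ \<equiv> orbit_space G \<phi> X"
abbreviation "EQ \<equiv> orbit_cells G \<phi> E"
abbreviation "XF \<equiv> fixed_space G \<phi> X"
abbreviation "EF \<equiv> fixed_cells G \<phi> X E"
abbreviation "chain_act n g \<equiv> cell_induced X E n (\<phi> g)"
abbreviation "chain_quot n \<equiv> cellular_induced X E XQ EQ n (orbit G \<phi>)"
abbreviation "chain_incl n \<equiv> cellular_induced XF EF X E n id"

text \<open>Agrees with \<open>equivariant_bases.N\<close> in each degree, but does not mention
  bases, so that it forms one family of maps over all degrees.\<close>

definition chain_norm :: "int \<Rightarrow> 'a chain set \<Rightarrow> 'a chain set" where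
  "chain_norm n c = finprod (cell_chain X E n) (\<lambda>g. chain_act n g c) (carrier G)"

lemma equivariant_bases_exist:
  assumes p: "prime (card (carrier G))"
  shows "\<exists>hC hQ hF. equivariant_bases G (cells_of_dim E n) (\<lambda>g e. \<phi> g ` e) (\<lambda>e. orbit G \<phi> ` e)
    (cell_chain X E n) (cell_chain XQ EQ n) (cell_chain XF EF n) hC hQ hF (chain_act n) (chain_quot n) (chain_incl n)"
proof -
  interpret free_or_fixed G "cells_of_dim E n" "\<lambda>g e. \<phi> g ` e" "\<lambda>e. orbit G \<phi> ` e"
    by (rule free_or_fixed_cells[OF p])
  have fixed: "fixed = cells_of_dim EF n" unfolding fixed_def fixed_cells_of_dim ..
  obtain hC hQ hF where
    "hC \<in> iso (free_Abelian_group (cells_of_dim E n)) (cell_chain X E n)"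
    "hQ \<in> iso (free_Abelian_group (cells_of_dim EQ n)) (cell_chain XQ EQ n)"
    "hF \<in> iso (free_Abelian_group (cells_of_dim EF n)) (cell_chain XF EF n)"
    "\<forall>g\<in>carrier G. \<forall>e\<in>cells_of_dim E n. chain_act n g (hC (frag_of e)) = hC (frag_of (\<phi> g ` e))"
    "\<forall>e\<in>cells_of_dim E n. chain_quot n (hC (frag_of e)) = hQ (frag_of (orbit G \<phi> ` e))"
    "\<forall>e\<in>cells_of_dim EF n. chain_incl n (hF (frag_of e)) = hC (frag_of e)"
    using cell_bases[of n] by blast
  note h = this
  have "equivariant_bases G (cells_of_dim E n) (\<lambda>g e. \<phi> g ` e) (\<lambda>e. orbit G \<phi> ` e)
    (cell_chain X E n) (cell_chain XQ EQ n) (cell_chain XF EF n) hC hQ hF (chain_act n) (chain_quot n) (chain_incl n)"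
  proof (intro equivariant_bases.intro equivariant_bases_axioms.intro free_or_fixed_axioms)
    show "comm_group (cell_chain X E n)" "comm_group (cell_chain XQ EQ n)" "comm_group (cell_chain XF EF n)"
      by (simp_all add: cell_chain_def)
    show "hC \<in> iso (free_Abelian_group (cells_of_dim E n)) (cell_chain X E n)" by (rule h(1))
    show "hQ \<in> iso (free_Abelian_group ((\<lambda>e. orbit G \<phi> ` e) ` cells_of_dim E n)) (cell_chain XQ EQ n)"
      using h(2) unfolding orbit_cells_of_dim .
    show "hF \<in> iso (free_Abelian_group fixed) (cell_chain XF EF n)" unfolding fixed by (rule h(3))
    show "chain_act n g \<in> hom (cell_chain X E n) (cell_chain X E n)" for g
      unfolding cell_induced_eq_cellular_induced by (rule cellular_induced_hom)
    show "chain_quot n \<in> hom (cell_chain X E n) (cell_chain XQ EQ n)"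
      "chain_incl n \<in> hom (cell_chain XF EF n) (cell_chain X E n)" by (rule cellular_induced_hom)+
    show "chain_act n g (hC (frag_of e)) = hC (frag_of (\<phi> g ` e))" if "g \<in> carrier G" "e \<in> cells_of_dim E n" for g e
      using h(4) that by blast
    show "chain_quot n (hC (frag_of e)) = hQ (frag_of (orbit G \<phi> ` e))" if "e \<in> cells_of_dim E n" for e
      using h(5) that by blast
    show "chain_incl n (hF (frag_of e)) = hC (frag_of e)" if "e \<in> fixed" for e
      using h(6) that unfolding fixed by blast
  qed
  then show ?thesis by blast
qed

lemma chain_act_boundary:
  assumes "g \<in> carrier G"
  shows "chain_act (n - 1) g (cell_boundary X E n c) = cell_boundary X E n (chain_act n g c)"
  unfolding cell_induced_eq_cellular_induced
  by (rule cellular_induced_boundary[OF continuous_act[OF assms] act_funcset_skeleton[OF assms]])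

lemma smith_complexes_cells:
  assumes p: "prime (card (carrier G))"
  shows "smith_complexes (cell_chain X E) (cell_boundary X E) (cell_chain XQ EQ) (cell_boundary XQ EQ)
    (cell_chain XF EF) (cell_boundary XF EF) (carrier G) chain_act chain_norm chain_quot chain_incl (card (carrier G))"
proof -
  \<comment> \<open>Bases are chosen independently in each degree. Nothing relates them to the
    boundary maps, as compatibility with boundaries is supplied by naturality.\<close>
  obtain hC hQ hF where B: "\<And>n. equivariant_bases G (cells_of_dim E n) (\<lambda>g e. \<phi> g ` e) (\<lambda>e. orbit G \<phi> ` e)
    (cell_chain X E n) (cell_chain XQ EQ n) (cell_chain XF EF n) (hC n) (hQ n) (hF n) (chain_act n) (chain_quot n) (chain_incl n)"
    using equivariant_bases_exist[OF p] by metis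
  have N: "equivariant_bases.N G (cell_chain X E n) (chain_act n) = chain_norm n" for n
    unfolding chain_norm_def[abs_def] equivariant_bases.N_def[OF B, abs_def] ..
  show ?thesis
  proof (intro smith_complexes.intro smith_complexes_axioms.intro cell_chain_complex)
    show "card (carrier G) \<noteq> 1" using p prime_nat_iff by auto
    show "chain_act n g \<in> hom (cell_chain X E n) (cell_chain X E n)" for n g
      unfolding cell_induced_eq_cellular_induced by (rule cellular_induced_hom)
    show "chain_quot n \<in> hom (cell_chain X E n) (cell_chain XQ EQ n)"
      "chain_incl n \<in> hom (cell_chain XF EF n) (cell_chain X E n)" for n by (rule cellular_induced_hom)+
    show "chain_act (n - 1) g (cell_boundary X E n c) = cell_boundary X E n (chain_act n g c)" if "g \<in> carrier G" for n g c
      by (rule chain_act_boundary[OF that])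
    show "chain_quot (n - 1) (cell_boundary X E n c) = cell_boundary XQ EQ n (chain_quot n c)" for n c
      by (rule cellular_induced_boundary[OF continuous_map_orbit orbit_funcset_skeleton])
    show "chain_incl (n - 1) (cell_boundary XF EF n c) = cell_boundary X E n (chain_incl n c)" for n c
      by (rule cellular_induced_boundary[OF continuous_map_fixed_inclusion id_funcset_skeleton])
    show "chain_norm n \<in> hom (cell_chain X E n) (cell_chain X E n)" for n
      using equivariant_bases.N_hom[OF B[of n]] unfolding N .
    show "chain_norm (n - 1) (cell_boundary X E n c) = cell_boundary X E n (chain_norm n c)"
      if c: "c \<in> carrier (cell_chain X E n)" for n c
    proof -
      have cg: "comm_group (cell_chain X E k)" for k by (simp add: cell_chain_def)
      \<comment> \<open>The boundary is a homomorphism and passes through the product over the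
        group, after which it commutes with each factor of the norm.\<close>
      have "cell_boundary X E n (chain_norm n c)
        = finprod (cell_chain X E (n - 1)) (\<lambda>g. cell_boundary X E n (chain_act n g c)) (carrier G)"
        unfolding chain_norm_def
        by (rule hom_finprod[OF cg cg cell_boundary_hom finite_G])
           (use hom_in_carrier[OF cellular_induced_hom c] in \<open>auto simp: cell_induced_eq_cellular_induced\<close>)
      also have "\<dots> = finprod (cell_chain X E (n - 1)) (\<lambda>g. chain_act (n - 1) g (cell_boundary X E n c)) (carrier G)"
      proof (rule comm_monoid.finprod_cong'[OF comm_group.axioms(1)[OF cg] refl])
        show "(\<lambda>g. chain_act (n - 1) g (cell_boundary X E n c)) \<in> carrier G \<rightarrow> carrier (cell_chain X E (n - 1))"
          using hom_in_carrier[OF cellular_induced_hom hom_in_carrier[OF cell_boundary_hom c]]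
          by (auto simp: cell_induced_eq_cellular_induced)
        show "cell_boundary X E n (chain_act n g c) = chain_act (n - 1) g (cell_boundary X E n c)"
          if "g \<in> carrier G" for g by (rule chain_act_boundary[OF that, symmetric])
      qed
      finally show ?thesis unfolding chain_norm_def by (rule sym)
    qed
    show "chain_act n g (chain_norm n c) = chain_norm n c"
      if "g \<in> carrier G" "c \<in> carrier (cell_chain X E n)" for n g c
      using equivariant_bases.act_N[OF B[of n] that] unfolding N .
    show "chain_quot n ` carrier (cell_chain X E n) = carrier (cell_chain XQ EQ n)" for n
      by (rule equivariant_bases.q_surj[OF B])
    show "chain_quot n c = \<one>\<^bsub>cell_chain XQ EQ n\<^esub> \<longleftrightarrow> chain_norm n c = \<one>\<^bsub>cell_chain X E n\<^esub>"
      if "c \<in> carrier (cell_chain X E n)" for n c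
      using equivariant_bases.q_one_iff[OF B[of n] that] unfolding N .
    show "chain_act n g (chain_incl n x) = chain_incl n x"
      if "g \<in> carrier G" "x \<in> carrier (cell_chain XF EF n)" for n g x
      by (rule equivariant_bases.act_i[OF B that])
    show "\<exists>x\<in>carrier (cell_chain XF EF n). \<exists>y\<in>carrier (cell_chain X E n).
        c = chain_incl n x \<otimes>\<^bsub>cell_chain X E n\<^esub> chain_norm n y"
      if "c \<in> carrier (cell_chain X E n)" "\<And>g. g \<in> carrier G \<Longrightarrow> chain_act n g c = c" for n c
      using equivariant_bases.invariant_decomp[OF B[of n] that] unfolding N .
    show "\<exists>x'\<in>carrier (cell_chain XF EF n). x = x' [^]\<^bsub>cell_chain XF EF n\<^esub> card (carrier G)"
      if "x \<in> carrier (cell_chain XF EF n)" "y \<in> carrier (cell_chain X E n)" "chain_incl n x = chain_norm n y" for n x y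
      by (rule equivariant_bases.i_eq_N[OF B that(1,2)]) (use that(3) in \<open>simp only: N\<close>)
    show "chain_norm n (chain_incl n x) = chain_incl n x [^]\<^bsub>cell_chain X E n\<^esub> card (carrier G)"
      if "x \<in> carrier (cell_chain XF EF n)" for n x
      using equivariant_bases.N_i[OF B[of n] that] unfolding N .
  qed
qed

theorem long_exact_sequence_prime_order:
  assumes p: "prime (card (carrier G))"
  shows "\<exists>\<alpha> \<beta> \<delta>. \<forall>n.
    exact_at (cw_homology XQ EQ integer_group n) (invariant_homology G \<phi> X E integer_group n)
      (cw_homology XF EF (integer_mod_group (card (carrier G))) n) (\<alpha> n) (\<beta> n) \<and>
    exact_at (invariant_homology G \<phi> X E integer_group n) (cw_homology XF EF (integer_mod_group (card (carrier G))) n)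
      (cw_homology XQ EQ integer_group (n - 1)) (\<beta> n) (\<delta> n) \<and>
    exact_at (cw_homology XF EF (integer_mod_group (card (carrier G))) n) (cw_homology XQ EQ integer_group (n - 1))
      (invariant_homology G \<phi> X E integer_group (n - 1)) (\<delta> n) (\<alpha> (n - 1))"
proof -
  note S = smith_complexes_cells[OF p]
  have Z: "integer_mod_group 0 = integer_group" by (simp add: integer_mod_group_def)
  have chains: "cell_chain_coeff Y D A = (\<lambda>n. tensor_product (cell_chain Y D n) A)"
    "cell_boundary_coeff Y D A = (\<lambda>n. tensor_map (cell_chain Y D (n - 1)) A (cell_boundary Y D n))"
    for Y :: "'y topology" and D and A :: "'b monoid"
    by (simp_all add: cell_chain_coeff_def cell_boundary_coeff_def fun_eq_iff)
  \<comment> \<open>The invariant complex of the algebraic part has the shape of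
    \<open>invariant_cell_chain\<close>, so the abstract sequence specializes by rewriting
    alone.\<close>
  have B: "smith_complexes.B (cell_chain X E) (carrier G) chain_act = invariant_cell_chain G \<phi> X E integer_group"
    by (rule ext) (simp add: smith_complexes.B_def[OF S] invariant_cell_chain_def cell_chain_coeff_def cell_action_coeff_def Z)
  show ?thesis
    unfolding cw_homology_def invariant_homology_def chains
    using smith_complexes.smith_sequence[OF S] unfolding B Z .
qed

end

theorem proposition2p5:
  fixes p :: nat
    and X :: "'a topology"
    and E :: "nat \<Rightarrow> 'a set set"
    and \<phi> :: "int \<Rightarrow> 'a \<Rightarrow> 'a"
  assumes "prime p"
    and "G_CW_complex (integer_mod_group p) \<phi> X E"
  shows "let G = integer_mod_group p;
             HQ = cw_homology (orbit_space G \<phi> X) (orbit_cells G \<phi> E) integer_group;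
             HG = invariant_homology G \<phi> X E integer_group;
             HF = cw_homology (fixed_space G \<phi> X) (fixed_cells G \<phi> X E) (integer_mod_group p)
         in \<exists>\<alpha> \<beta> \<delta>. \<forall>n.
              exact_at (HQ n) (HG n) (HF n) (\<alpha> n) (\<beta> n) \<and>
              exact_at (HG n) (HF n) (HQ (n - 1)) (\<beta> n) (\<delta> n) \<and>
              exact_at (HF n) (HQ (n - 1)) (HG (n - 1)) (\<delta> n) (\<alpha> (n - 1))"
proof -
  interpret G_CW "integer_mod_group p" \<phi> X E by (rule G_CW.intro[OF assms(2)])
  \<comment> \<open>A prime is positive, which excludes the infinite group
    \<open>integer_mod_group 0\<close>; the order of the group and the modulus of the coefficients
    then coincide.\<close>
  have card: "card (carrier (integer_mod_group p)) = p"
    using prime_gt_0_nat[OF assms(1)] by (simp add: carrier_integer_mod_group)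
  show ?thesis
    unfolding Let_def using long_exact_sequence_prime_order unfolding card using assms(1) by blast
qed

end
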